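(* Let $n\geq 3$, let $k$ be any field, and let $F_n$ be the free group of rank $n$. Then $\mathrm{Aut}(F_n)$ admits no faithful finite-dimensional representation over $k$. Moreover, for every representation $R:\mathrm{Aut}(F_n)\to \mathrm{GL}_d(k)$ and every proper free factor $A<F_n$, the group $R(\iota_A)$ is virtually solvable, where $\iota_A=\{\iota_a:a\in A\}$ and $\iota_a\in\mathrm{Aut}(F_n)$ is the inner automorphism $v\mapsto ava^{-1}$.
   Context: A free factor of $F_n$ is a subgroup $A$ with $F_n=A*B$ for some subgroup $B$; it is proper if $A\neq F_n$. A group is virtually solvable if it has a solvable subgroup of finite index. Automorphisms are composed from right to left. *)

theory Defs
  imports
    "HOL-Algebra.Bij"
    "HOL-Algebra.Coset"
    "HOL-Algebra.Solvable_Groups"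
    "Jordan_Normal_Form.Matrix"
begin

definition list_mult :: "('a, 'b) monoid_scheme \<Rightarrow> 'a list \<Rightarrow> 'a" where
  "list_mult G xs = foldr (\<lambda>x y. x \<otimes>\<^bsub>G\<^esub> y) xs \<one>\<^bsub>G\<^esub>"

text \<open>A word over \<open>X\<close> is a list of letters; \<open>(x, True)\<close> stands for \<open>x\<close>
  and \<open>(x, False)\<close> for its formal inverse.\<close>

definition reduced_words :: "'a set \<Rightarrow> ('a \<times> bool) list set" where
  "reduced_words X = {w \<in> lists (X \<times> UNIV).
     successively (\<lambda>(x, e) (y, f). \<not> (x = y \<and> e \<noteq> f)) w}"

definition word_value :: "('a, 'b) monoid_scheme \<Rightarrow> ('a \<times> bool) list \<Rightarrow> 'a" where
  "word_value G w = list_mult G (map (\<lambda>(x, e). if e then x else inv\<^bsub>G\<^esub> x) w)"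

text \<open>\<open>G\<close> is free on \<open>X\<close> iff every element is the value of exactly one reduced word,
  i.e. the canonical map from the free group on \<open>X\<close> (realised by reduced words) is bijective.\<close>

definition free_basis :: "('a, 'b) monoid_scheme \<Rightarrow> 'a set \<Rightarrow> bool" where
  "free_basis G X \<longleftrightarrow> X \<subseteq> carrier G \<and>
     bij_betw (word_value G) (reduced_words X) (carrier G)"

definition free_group_of_rank :: "('a, 'b) monoid_scheme \<Rightarrow> nat \<Rightarrow> bool" where
  "free_group_of_rank G n \<longleftrightarrow> group G \<and> (\<exists>X. finite X \<and> card X = n \<and> free_basis G X)"

text \<open>The normal forms of the free product of subgroups \<open>A\<close> and \<open>B\<close> of \<open>G\<close>: alternating
  lists of nontrivial elements. The tags \<open>Inl\<close> and \<open>Inr\<close> keep the two factors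
  formally disjoint even if \<open>A\<close> and \<open>B\<close> meet inside \<open>G\<close>.\<close>

definition free_product_words :: "('a, 'b) monoid_scheme \<Rightarrow> 'a set \<Rightarrow> 'a set \<Rightarrow> ('a + 'a) list set" where
  "free_product_words G A B =
     {w \<in> lists ((A - {\<one>\<^bsub>G\<^esub>}) <+> (B - {\<one>\<^bsub>G\<^esub>})).
        successively (\<lambda>s t. isl s \<noteq> isl t) w}"

text \<open>\<open>G = A * B\<close> as an internal free product: the canonical map from the free product
  (realised by its normal forms) to \<open>G\<close> is bijective.\<close>

definition internal_free_product :: "('a, 'b) monoid_scheme \<Rightarrow> 'a set \<Rightarrow> 'a set \<Rightarrow> bool" where
  "internal_free_product G A B \<longleftrightarrow> subgroup A G \<and> subgroup B G \<and>
     bij_betw (\<lambda>w. list_mult G (map (case_sum id id) w)) (free_product_words G A B) (carrier G)"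

definition free_factor :: "'a set \<Rightarrow> ('a, 'b) monoid_scheme \<Rightarrow> bool" where
  "free_factor A G \<longleftrightarrow> (\<exists>B. internal_free_product G A B)"

definition proper_free_factor :: "'a set \<Rightarrow> ('a, 'b) monoid_scheme \<Rightarrow> bool" where
  "proper_free_factor A G \<longleftrightarrow> free_factor A G \<and> A \<noteq> carrier G"

text \<open>Elements of \<open>AutoGroup G\<close> are extensional functions, hence the restriction to
  the carrier.\<close>

definition inner_aut :: "('a, 'b) monoid_scheme \<Rightarrow> 'a \<Rightarrow> 'a \<Rightarrow> 'a" where
  "inner_aut G a = (\<lambda>v \<in> carrier G. a \<otimes>\<^bsub>G\<^esub> v \<otimes>\<^bsub>G\<^esub> inv\<^bsub>G\<^esub> a)"

definition virtually_solvable :: "('a, 'b) monoid_scheme \<Rightarrow> bool" where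
  "virtually_solvable G \<longleftrightarrow>
     (\<exists>H. subgroup H G \<and> finite (rcosets\<^bsub>G\<^esub> H) \<and> solvable (G\<lparr>carrier := H\<rparr>))"

definition GL :: "nat \<Rightarrow> 'k::field mat monoid" where
  "GL d = units_of (ring_mat TYPE('k) d ())"

text \<open>\<open>AutoGroup G\<close> multiplies automorphisms by \<open>compose\<close>, i.e. from right to left.\<close>

definition aut_representation ::
  "('a, 'b) monoid_scheme \<Rightarrow> nat \<Rightarrow> (('a \<Rightarrow> 'a) \<Rightarrow> 'k::field mat) \<Rightarrow> bool" where
  "aut_representation G d R \<longleftrightarrow> R \<in> hom (AutoGroup G) (GL d)"

end

theory Submission
  imports Defs "HOL-Algebra.Algebraic_Closure_Type" "Jordan_Normal_Form.Char_Poly"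
begin

text \<open>Let \<open>F = A * B\<close> with \<open>B\<close> nontrivial. Since \<open>F\<close> is free there are \<open>z\<close> and
  automorphisms \<open>\<alpha>\<^sub>a\<close> (\<open>a \<in> A\<close>), multiplicative in \<open>a\<close>, that fix \<open>A\<close> pointwise and send \<open>z\<close> to
  \<open>a\<inverse> z\<close>. Then \<open>\<alpha>\<^sub>a\<close> commutes with \<open>\<iota>\<^sub>b\<close> for \<open>b \<in> A\<close>, and \<open>\<iota>\<^sub>z\<close> conjugates \<open>\<alpha>\<^sub>a\<close> to \<open>\<iota>\<^sub>a \<alpha>\<^sub>a\<close>.
  Hence \<open>\<rho>(a) = R(\<iota>\<^sub>a)\<close> and \<open>\<sigma>(a) = R(\<alpha>\<^sub>a)\<close>, taken over the algebraic closure, satisfy: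
  \<open>\<rho>(A)\<close> commutes with \<open>\<sigma>(A)\<close>, and \<open>\<rho>(a) \<sigma>(a)\<close> is similar to \<open>\<sigma>(a)\<close>. For \<open>g \<in> [A, A]\<close> the matrix
  \<open>\<rho>(g)\<close> has determinant \<open>1\<close> on each generalized eigenspace of \<open>\<sigma>(g)\<close>; drawing an edge \<open>q \<rightarrow> q p\<close>
  for every joint eigenvalue \<open>(q, p)\<close> of \<open>(\<sigma>(g), \<rho>(g))\<close> gives a balanced graph on which the identity
  is a multiplicative harmonic function. Eliminating its vertices one by one shows that neighbours
  agree up to torsion, so the eigenvalues of \<open>\<rho>(g)\<close> are roots of unity of order bounded in terms of
  the dimension. So \<open>\<rho>([A, A])\<close> has finitely many characteristic polynomials, whence a finite-index subgroup of \<open>A\<close> commutes with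
  \<open>[A, A]\<close> modulo a unipotent group, and Kolchin's theorem applies.

  If \<open>R\<close> were faithful, the free group on two of at least three basis elements would be virtually
  solvable; but it maps onto a subgroup of \<open>SL\<^sub>2(\<int>)\<close> that is not.\<close>

text \<open>The field is arbitrary, so absolute values cannot control eigenvalues and traces cannot
  recover them. Eigenvalues are therefore compared only inside the multiplicative group of the
  field, where harmonicity still forces agreement up to torsion, and Kolchin's theorem is reached
  through the radical of the trace form, which is zero for an irreducible algebra in every
  characteristic. Commutators enter because a determinant is trivial on \<open>[A, A]\<close> in
  every block on which all of \<open>A\<close> acts; this is harmonicity at a vertex. Balance is the
  equality of the characteristic polynomials of \<open>\<rho> g * \<sigma> g\<close> and
  \<open>\<sigma> g\<close>. The torsion bound has to be uniform in \<open>g\<close>, as otherwise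
  nothing would limit the number of characteristic polynomials. On the group side the obstacle is
  that the complement \<open>B\<close> comes without a basis. A single loop \<open>z\<close> in its
  Schreier graph is enough: an edge that is not a bridge can be relabelled so that the loop through
  it changes while the paths to its two ends do not.\<close>

no_notation var (\<open>X\<index>\<close>)
no_notation fps_nth (infixl \<open>$\<close> 75)

section \<open>Block matrices and characteristic polynomials\<close>

lemma index_mult_sum:
  assumes "A \<in> carrier_mat n m" "B \<in> carrier_mat m p" "i < n" "j < p"
  shows "(A * B) $$ (i, j) = (\<Sum>k = 0..<m. A $$ (i, k) * B $$ (k, j))"
  using assms by (auto simp: scalar_prod_def)

text \<open>Row reduction gives an invertible \<open>P\<close> with \<open>P * N\<close> in echelon
  form with \<open>r\<close> pivots, so in the coordinates of \<open>P\<close> the column space of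
  \<open>N\<close> is spanned by the first \<open>r\<close> unit vectors. The equation
  \<open>M * N = N * M'\<close> says that \<open>M\<close> maps this space into itself, which is the
  zero block at the lower left. The last two clauses recognize the zero subspace and the full
  one.\<close>

lemma image_block:
  fixes N :: "'k::field mat"
  assumes N: "N \<in> carrier_mat d c"
  obtains P Q r where "P \<in> carrier_mat d d" "Q \<in> carrier_mat d d"
    "P * Q = 1\<^sub>m d" "Q * P = 1\<^sub>m d" "r \<le> d"
    "\<forall>i j. r \<le> i \<longrightarrow> i < d \<longrightarrow> j < c \<longrightarrow> (P * N) $$ (i, j) = 0"
    "\<forall>M M'. M \<in> carrier_mat d d \<longrightarrow> M' \<in> carrier_mat c c \<longrightarrow> M * N = N * M' \<longrightarrow>
       (\<forall>i j. r \<le> i \<longrightarrow> i < d \<longrightarrow> j < r \<longrightarrow> (P * M * Q) $$ (i, j) = 0)"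
    "r = 0 \<longrightarrow> N = 0\<^sub>m d c"
    "r = d \<longrightarrow> (\<exists>X. X \<in> carrier_mat c d \<and> N * X = 1\<^sub>m d)"
proof -
  obtain P Q where P: "P \<in> carrier_mat d d" and Q: "Q \<in> carrier_mat d d"
    and PQ: "P * Q = 1\<^sub>m d" and QP: "Q * P = 1\<^sub>m d"
    and PN: "gauss_jordan_single N = P * N"
    using gauss_jordan_single(4)[OF N refl] by blast
  define C where "C = P * N"
  have C: "C \<in> carrier_mat d c" using P N by (simp add: C_def)
  have "row_echelon_form C" using gauss_jordan_single(3)[OF N refl] by (simp add: PN C_def)
  then obtain f where f: "pivot_fun C f c"
    using C unfolding row_echelon_form_def by auto
  note piv = pivot_funD[OF _ f, of d]
  have dC: "dim_row C = d" using C by auto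
  \<comment> \<open>The first row without a pivot: \<open>pivot_fun\<close> marks such a row by the
    value \<open>c\<close>. The alternative \<open>i = d\<close> covers the case that every row has
    a pivot.\<close>
  define r where "r = (LEAST i. i = d \<or> (i < d \<and> f i = c))"
  have r: "r = d \<or> (r < d \<and> f r = c)"
    unfolding r_def by (rule LeastI[of _ d]) simp
  have lt: "f i < c" if "i < r" for i
  proof -
    have "i < d" using that r by auto
    moreover have "\<not> (i = d \<or> (i < d \<and> f i = c))"
      using not_less_Least[OF that[unfolded r_def]] .
    ultimately show ?thesis using piv(1)[OF dC, of i] by auto
  qed
  have ge: "f i = c" if "r \<le> i" "i < d" for i
    using that
  proof (induction i rule: dec_induct)
    case base
    then show ?case using r by auto
  next
    case (step i)
    then show ?case using piv(3)[OF dC, of i] piv(1)[OF dC, of "Suc i"] by auto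
  qed
  have zero: "C $$ (i, j) = 0" if "r \<le> i" "i < d" "j < c" for i j
    using piv(2)[OF dC, of i j] ge[of i] that by auto
  \<comment> \<open>A pivot column of the reduced form is a unit vector, so column \<open>j\<close>
    of \<open>P * M * Q\<close> can be read off column \<open>f j\<close> of its product with
    \<open>C\<close>.\<close>
  have col: "C $$ (k, f j) = (if k = j then 1 else 0)" if "j < r" "k < d" for j k
    using piv(4,5)[OF dC, of j] lt[OF that(1)] that r by auto
  have rd: "r \<le> d" using r by auto
  have block: "(P * M * Q) $$ (i, j) = 0"
    if M: "M \<in> carrier_mat d d" "M' \<in> carrier_mat c c" "M * N = N * M'"
      and ij: "r \<le> i" "i < d" "j < r" for M M' i j
  proof -
    let ?A = "P * M * Q"
    have A: "?A \<in> carrier_mat d d" using P Q M by simp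
    have "?A * C = P * M * (Q * P) * N"
      unfolding C_def using P Q M N by (simp add: assoc_mult_mat[of _ d d _ d _ d] assoc_mult_mat[of _ d d _ d _ c])
    also have "\<dots> = P * (M * N)"
      using P M N by (simp add: QP assoc_mult_mat[of _ d d _ d _ c])
    also have "\<dots> = C * M'" unfolding C_def M(3) using P N M by (simp add: assoc_mult_mat[of _ d d _ c _ c])
    finally have eq: "?A * C = C * M'" .
    have fj: "f j < c" by (rule lt[OF ij(3)])
    have "(?A * C) $$ (i, f j) = (\<Sum>k = 0..<d. ?A $$ (i, k) * C $$ (k, f j))"
      by (rule index_mult_sum[OF A C ij(2) fj])
    also have "\<dots> = (\<Sum>k = 0..<d. if k = j then ?A $$ (i, k) else 0)"
      using ij by (intro sum.cong) (auto simp: col)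
    also have "\<dots> = ?A $$ (i, j)" using ij r by (auto simp: sum.delta)
    finally have 1: "(?A * C) $$ (i, f j) = ?A $$ (i, j)" .
    have "(C * M') $$ (i, f j) = (\<Sum>k = 0..<c. C $$ (i, k) * M' $$ (k, f j))"
      by (rule index_mult_sum[OF C M(2) ij(2) fj])
    also have "\<dots> = 0" using zero ij by (intro sum.neutral) auto
    finally show ?thesis using 1 eq by simp
  qed
  have r0: "N = 0\<^sub>m d c" if "r = 0"
  proof -
    have "C = 0\<^sub>m d c" using zero that C by (intro eq_matI) auto
    moreover have "N = Q * C" unfolding C_def using P Q N
      by (simp add: assoc_mult_mat[of Q d d P d N c, symmetric] QP)
    ultimately show ?thesis using Q by simp
  qed
  have rfull: "\<exists>X. X \<in> carrier_mat c d \<and> N * X = 1\<^sub>m d" if "r = d"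
  proof -
    \<comment> \<open>With a pivot in every row, the matrix that selects the pivot columns is a
      right inverse of \<open>C\<close>.\<close>
    define E :: "'k mat" where "E = mat c d (\<lambda>(i, j). if i = f j then 1 else 0)"
    have E: "E \<in> carrier_mat c d" by (simp add: E_def)
    have CE: "C * E = 1\<^sub>m d"
    proof (intro eq_matI)
      fix i j assume "i < dim_row (1\<^sub>m d :: 'k mat)" "j < dim_col (1\<^sub>m d :: 'k mat)"
      then have ij: "i < d" "j < d" by auto
      have fj: "f j < c" using lt ij that by simp
      have "(C * E) $$ (i, j) = (\<Sum>k = 0..<c. C $$ (i, k) * E $$ (k, j))"
        by (rule index_mult_sum[OF C E ij])
      also have "\<dots> = (\<Sum>k = 0..<c. if k = f j then C $$ (i, k) else 0)"
        using ij by (intro sum.cong) (auto simp: E_def)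
      also have "\<dots> = C $$ (i, f j)" using fj by (simp add: sum.delta)
      finally show "(C * E) $$ (i, j) = 1\<^sub>m d $$ (i, j)"
        using col[of j i] ij that by auto
    qed (use C E in auto)
    have "N * (E * P) = (Q * C) * (E * P)" unfolding C_def using P Q N
      by (simp add: assoc_mult_mat[of Q d d P d N c, symmetric] QP)
    also have "\<dots> = Q * (C * E) * P"
      using P Q C E by (simp add: assoc_mult_mat[of _ d d _ c _ d] assoc_mult_mat[of _ d c _ d _ d] assoc_mult_mat[of _ d d _ d _ d])
    also have "\<dots> = 1\<^sub>m d" using Q by (simp add: CE QP)
    finally show ?thesis using E P by (intro exI[of _ "E * P"]) auto
  qed
  show thesis
    using that[OF P Q PQ QP rd] zero[unfolded C_def] block r0 rfull by blast
qed

lemma split_upper_block: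
  assumes M: "M \<in> carrier_mat d d" and r: "r \<le> d"
    and z: "\<And>i j. r \<le> i \<Longrightarrow> i < d \<Longrightarrow> j < r \<Longrightarrow> M $$ (i, j) = 0"
  obtains A B D where "A \<in> carrier_mat r r" "B \<in> carrier_mat r (d - r)"
    "D \<in> carrier_mat (d - r) (d - r)" "M = four_block_mat A B (0\<^sub>m (d - r) r) D"
    "D = mat (d - r) (d - r) (\<lambda>(i, j). M $$ (i + r, j + r))"
proof (rule that)
  let ?A = "mat r r (\<lambda>(i, j). M $$ (i, j))"
  let ?B = "mat r (d - r) (\<lambda>(i, j). M $$ (i, j + r))"
  let ?D = "mat (d - r) (d - r) (\<lambda>(i, j). M $$ (i + r, j + r))"
  show "?A \<in> carrier_mat r r" "?B \<in> carrier_mat r (d - r)" "?D \<in> carrier_mat (d - r) (d - r)"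
    by auto
  show "M = four_block_mat ?A ?B (0\<^sub>m (d - r) r) ?D"
    using M r z by (intro eq_matI) auto
qed (rule refl)

lemma four_block_mat_inject:
  assumes "A \<in> carrier_mat r r" "A' \<in> carrier_mat r r" "D \<in> carrier_mat s s" "D' \<in> carrier_mat s s"
    and eq: "four_block_mat A B C D = four_block_mat A' B' C' D'"
  shows "A = A'" "D = D'"
proof -
  have *: "four_block_mat A B C D $$ (i, j) = four_block_mat A' B' C' D' $$ (i, j)" for i j
    by (simp add: eq)
  show "A = A'"
  proof (intro eq_matI)
    fix i j assume "i < dim_row A'" "j < dim_col A'"
    then show "A $$ (i, j) = A' $$ (i, j)" using *[of i j] assms(1-4) by auto
  qed (use assms(1-4) in auto)
  show "D = D'"
  proof (intro eq_matI)
    fix i j assume "i < dim_row D'" "j < dim_col D'"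
    then show "D $$ (i, j) = D' $$ (i, j)" using *[of "i + r" "j + r"] assms(1-4) by auto
  qed (use assms(1-4) in auto)
qed

lemma mult_upper_block:
  fixes A :: "'k::comm_ring_1 mat"
  assumes "A \<in> carrier_mat r r" "B \<in> carrier_mat r s" "D \<in> carrier_mat s s"
    "A' \<in> carrier_mat r r" "B' \<in> carrier_mat r s" "D' \<in> carrier_mat s s"
  shows "four_block_mat A B (0\<^sub>m s r) D * four_block_mat A' B' (0\<^sub>m s r) D' =
    four_block_mat (A * A') (A * B' + B * D') (0\<^sub>m s r) (D * D')"
proof -
  have 1: "A * A' + B * 0\<^sub>m s r = A * A'" "0\<^sub>m s r * A' + D * 0\<^sub>m s r = 0\<^sub>m s r"
    "0\<^sub>m s r * B' + D * D' = D * D'"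
    using assms by auto
  show ?thesis
    unfolding mult_four_block_mat[OF assms(1,2) zero_carrier_mat assms(3) assms(4,5) zero_carrier_mat assms(6)] 1 ..
qed

lemma char_poly_upper_block:
  fixes A :: "'k::idom mat"
  assumes "A \<in> carrier_mat r r" "B \<in> carrier_mat r s" "D \<in> carrier_mat s s"
  shows "char_poly (four_block_mat A B (0\<^sub>m s r) D) = char_poly A * char_poly D"
proof -
  have "char_poly_matrix (four_block_mat A B (0\<^sub>m s r) D) =
      four_block_mat (char_poly_matrix A) (map_mat (\<lambda>a. [:- a:]) B) (0\<^sub>m s r) (char_poly_matrix D)"
    using assms by (intro eq_matI) (auto simp: char_poly_matrix_def)
  then show ?thesis
    unfolding char_poly_def using assms by (simp add: det_four_block_mat_lower_left_zero[of _ r _ s])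
qed

lemma conj_mult:
  fixes P :: "'k::comm_ring_1 mat"
  assumes "P \<in> carrier_mat d d" "Q \<in> carrier_mat d d" "Q * P = 1\<^sub>m d"
    "A \<in> carrier_mat d d" "B \<in> carrier_mat d d"
  shows "P * A * Q * (P * B * Q) = P * (A * B) * Q"
proof -
  have "P * A * Q * (P * B * Q) = P * A * (Q * P) * B * Q"
    using assms(1,2,4,5) by (simp add: assoc_mult_mat[of _ d d _ d _ d])
  also have "\<dots> = P * (A * B) * Q"
    using assms(1,2,4,5) by (simp add: assms(3) assoc_mult_mat[of _ d d _ d _ d])
  finally show ?thesis .
qed

lemma conj_similar:
  fixes P :: "'k::comm_ring_1 mat"
  assumes "P \<in> carrier_mat d d" "Q \<in> carrier_mat d d" "P * Q = 1\<^sub>m d" "Q * P = 1\<^sub>m d"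
    "A \<in> carrier_mat d d"
  shows "similar_mat A (P * A * Q)"
proof -
  have "similar_mat (P * A * Q) A"
    by (rule similar_matI[of _ _ P Q d]) (use assms in simp_all)
  then show ?thesis by (rule similar_mat_sym)
qed

text \<open>The invariant subspace is the image of \<open>M - q\<close> for an eigenvalue
  \<open>q\<close>. It is proper because \<open>M - q\<close> is singular, it is stable under
  everything that commutes with \<open>M\<close>, and \<open>M\<close> acts on the quotient as the
  scalar \<open>q\<close>.\<close>

lemma eigen_block:
  fixes M :: "'k::alg_closed_field mat"
  assumes M: "M \<in> carrier_mat d d" and d: "d > 0"
  obtains q P Q r A B where "P \<in> carrier_mat d d" "Q \<in> carrier_mat d d"
    "P * Q = 1\<^sub>m d" "Q * P = 1\<^sub>m d" "r < d"
    "A \<in> carrier_mat r r" "B \<in> carrier_mat r (d - r)"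
    "P * M * Q = four_block_mat A B (0\<^sub>m (d - r) r) (q \<cdot>\<^sub>m 1\<^sub>m (d - r))"
    "\<forall>X. X \<in> carrier_mat d d \<longrightarrow> X * M = M * X \<longrightarrow>
       (\<forall>i j. r \<le> i \<longrightarrow> i < d \<longrightarrow> j < r \<longrightarrow> (P * X * Q) $$ (i, j) = 0)"
proof -
  have "degree (char_poly M) > 0" using degree_monic_char_poly[OF M] d by simp
  then obtain q where "poly (char_poly M) q = 0" using alg_closed_imp_poly_has_root by blast
  then have ev: "det (char_matrix M q) = 0"
    using eigenvalue_root_char_poly[OF M] eigenvalue_det[OF M] by simp
  let ?N = "char_matrix M q"
  have N: "?N \<in> carrier_mat d d" using M by simp
  have Ndef: "?N = M + (- q) \<cdot>\<^sub>m 1\<^sub>m d"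
    using M by (intro eq_matI) (auto simp: char_matrix_def)
  obtain P Q r where P: "P \<in> carrier_mat d d" and Q: "Q \<in> carrier_mat d d"
    and PQ: "P * Q = 1\<^sub>m d" and QP: "Q * P = 1\<^sub>m d" and rd: "r \<le> d"
    and zero: "\<forall>i j. r \<le> i \<longrightarrow> i < d \<longrightarrow> j < d \<longrightarrow> (P * ?N) $$ (i, j) = 0"
    and block: "\<forall>M M'. M \<in> carrier_mat d d \<longrightarrow> M' \<in> carrier_mat d d \<longrightarrow> M * ?N = ?N * M' \<longrightarrow>
       (\<forall>i j. r \<le> i \<longrightarrow> i < d \<longrightarrow> j < r \<longrightarrow> (P * M * Q) $$ (i, j) = 0)"
    and "r = 0 \<longrightarrow> ?N = 0\<^sub>m d d"
    and rfull: "r = d \<longrightarrow> (\<exists>X. X \<in> carrier_mat d d \<and> ?N * X = 1\<^sub>m d)"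
    by (rule image_block[OF N])
  have "r \<noteq> d"
  proof
    assume "r = d"
    then obtain X where X: "X \<in> carrier_mat d d" "?N * X = 1\<^sub>m d" using rfull by blast
    then have "det ?N * det X = 1" using det_mult[OF N X(1)] by simp
    then show False using ev by simp
  qed
  then have r: "r < d" using rd by simp
  have comm: "(P * X * Q) $$ (i, j) = 0"
    if X: "X \<in> carrier_mat d d" "X * M = M * X" and ij: "r \<le> i" "i < d" "j < r" for X i j
  proof (rule block[rule_format, OF X(1) X(1) _ ij])
    have "X * ?N = X * M + (- q) \<cdot>\<^sub>m X"
      unfolding Ndef using X(1) M by (simp add: mult_add_distrib_mat[of _ d d _ d] mult_smult_distrib[of _ d d _ d])
    moreover have "?N * X = M * X + (- q) \<cdot>\<^sub>m X"
      unfolding Ndef using X(1) M by (simp add: add_mult_distrib_mat[of _ d d _ _ d] mult_smult_assoc_mat[of _ d d _ d])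
    ultimately show "X * ?N = ?N * X" using X(2) by simp
  qed
  let ?M = "P * M * Q"
  have MM: "?M \<in> carrier_mat d d" using P M Q by simp
  have "?M $$ (i, j) = 0" if "r \<le> i" "i < d" "j < r" for i j
    using comm[OF M refl that] .
  then obtain A B D where A: "A \<in> carrier_mat r r" and B: "B \<in> carrier_mat r (d - r)"
    and "D \<in> carrier_mat (d - r) (d - r)"
    and blk: "?M = four_block_mat A B (0\<^sub>m (d - r) r) D"
    and D: "D = mat (d - r) (d - r) (\<lambda>(i, j). ?M $$ (i + r, j + r))"
    by (rule split_upper_block[OF MM rd])
  \<comment> \<open>The rows of \<open>P * ?N\<close> from \<open>r\<close> on vanish, hence also
    those of \<open>P * ?N * Q\<close>; this makes the lower right block of \<open>?M\<close>
    scalar.\<close>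
  have PN: "P * ?N * Q = ?M + (- q) \<cdot>\<^sub>m 1\<^sub>m d"
    unfolding Ndef using P M Q PQ
    by (simp add: mult_add_distrib_mat[of _ d d _ d] add_mult_distrib_mat[of _ d d _ _ d] mult_smult_distrib[of _ d d _ d] mult_smult_assoc_mat[of _ d d _ d])
  have low: "(P * ?N * Q) $$ (i, j) = 0" if ij: "r \<le> i" "i < d" "j < d" for i j
  proof -
    have "(P * ?N * Q) $$ (i, j) = (\<Sum>k = 0..<d. (P * ?N) $$ (i, k) * Q $$ (k, j))"
      by (rule index_mult_sum[of _ d d]) (use P N Q ij in auto)
    also have "\<dots> = 0" using zero ij by (intro sum.neutral) auto
    finally show ?thesis .
  qed
  have Dq: "D = q \<cdot>\<^sub>m 1\<^sub>m (d - r)"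
  proof (intro eq_matI)
    fix i j assume "i < dim_row (q \<cdot>\<^sub>m 1\<^sub>m (d - r) :: 'k mat)" "j < dim_col (q \<cdot>\<^sub>m 1\<^sub>m (d - r) :: 'k mat)"
    then have ij: "i < d - r" "j < d - r" by auto
    then have "(?M + (- q) \<cdot>\<^sub>m 1\<^sub>m d) $$ (i + r, j + r) = 0"
      using low[of "i + r" "j + r"] PN by auto
    then show "D $$ (i, j) = (q \<cdot>\<^sub>m 1\<^sub>m (d - r)) $$ (i, j)"
      unfolding D using ij MM by (auto split: if_splits)
  qed (auto simp: D)
  show thesis using that[OF P Q PQ QP r A B blk[unfolded Dq]] comm by blast
qed

text \<open>Only the block on the image of \<open>M - q\<close> has to be triangularized by
  induction, as the quotient block is already scalar.\<close>

lemma triangularizable: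
  fixes M :: "'k::alg_closed_field mat"
  assumes "M \<in> carrier_mat d d"
  shows "\<exists>T. T \<in> carrier_mat d d \<and> similar_mat M T \<and> upper_triangular T"
  using assms
proof (induction d arbitrary: M rule: less_induct)
  case (less d)
  show ?case
  proof (cases "d = 0")
    case True
    then have "upper_triangular M" using less.prems by auto
    then show ?thesis using less.prems similar_mat_refl[OF less.prems] by (intro exI[of _ M] conjI)
  next
    case False
    obtain q P Q r A B where *: "P \<in> carrier_mat d d" "Q \<in> carrier_mat d d"
      "P * Q = 1\<^sub>m d" "Q * P = 1\<^sub>m d" "r < d"
      and A: "A \<in> carrier_mat r r" and B: "B \<in> carrier_mat r (d - r)"
      and blk: "P * M * Q = four_block_mat A B (0\<^sub>m (d - r) r) (q \<cdot>\<^sub>m 1\<^sub>m (d - r))"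
      and "\<forall>X. X \<in> carrier_mat d d \<longrightarrow> X * M = M * X \<longrightarrow>
        (\<forall>i j. r \<le> i \<longrightarrow> i < d \<longrightarrow> j < r \<longrightarrow> (P * X * Q) $$ (i, j) = 0)"
      by (rule eigen_block[OF less.prems False[unfolded neq0_conv]])
    obtain T where T: "T \<in> carrier_mat r r" "similar_mat A T" "upper_triangular T"
      using less.IH[OF \<open>r < d\<close> A] by blast
    let ?D = "q \<cdot>\<^sub>m 1\<^sub>m (d - r) :: 'k mat"
    have D: "?D \<in> carrier_mat (d - r) (d - r)" by simp
    obtain B' where B': "B' \<in> carrier_mat r (d - r)" and sim: "similar_mat
        (four_block_mat A B (0\<^sub>m (d - r) r) ?D) (four_block_mat T B' (0\<^sub>m (d - r) r) ?D)"
      using similar_mat_four_block_0_ex[OF T(2) similar_mat_refl[OF D] B A D] by blast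
    have "similar_mat M (four_block_mat T B' (0\<^sub>m (d - r) r) ?D)"
      by (rule similar_mat_trans[OF conj_similar[OF *(1-4) less.prems, unfolded blk] sim])
    moreover have "upper_triangular (four_block_mat T B' (0\<^sub>m (d - r) r) ?D)"
      by (rule upper_triangular_four_block[OF T(1) D T(3)]) (auto simp: upper_triangular_def)
    moreover have "four_block_mat T B' (0\<^sub>m (d - r) r) ?D \<in> carrier_mat d d"
      using four_block_carrier_mat[OF T(1) D] \<open>r < d\<close> by simp
    ultimately show ?thesis by blast
  qed
qed

section \<open>Trace and the list of eigenvalues\<close>

definition mtr :: "'k::comm_monoid_add mat \<Rightarrow> 'k" where
  "mtr A = (\<Sum>i = 0..<dim_row A. A $$ (i, i))"

lemma mtr_mult_comm:
  fixes A :: "'k::comm_semiring_0 mat"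
  assumes A: "A \<in> carrier_mat n m" and B: "B \<in> carrier_mat m n"
  shows "mtr (A * B) = mtr (B * A)"
proof -
  have "mtr (A * B) = (\<Sum>i = 0..<n. \<Sum>k = 0..<m. A $$ (i, k) * B $$ (k, i))"
    using A B unfolding mtr_def by (intro sum.cong) (auto simp: index_mult_sum[OF A B] simp del: index_mult_mat(1))
  also have "\<dots> = (\<Sum>k = 0..<m. \<Sum>i = 0..<n. B $$ (k, i) * A $$ (i, k))"
    by (subst sum.swap) (simp add: mult.commute)
  also have "\<dots> = mtr (B * A)"
    using A B unfolding mtr_def by (intro sum.cong) (auto simp: index_mult_sum[OF B A] simp del: index_mult_mat(1))
  finally show ?thesis .
qed

lemma mtr_add: "A \<in> carrier_mat n n \<Longrightarrow> B \<in> carrier_mat n n \<Longrightarrow> mtr (A + B) = mtr A + mtr B"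
  by (auto simp: mtr_def sum.distrib[symmetric] intro!: sum.cong)

lemma mtr_smult: "A \<in> carrier_mat n n \<Longrightarrow> mtr (c \<cdot>\<^sub>m A) = c * (mtr A :: 'k::comm_semiring_0)"
  by (auto simp: mtr_def sum_distrib_left intro!: sum.cong)

lemma mtr_similar:
  fixes A :: "'k::comm_ring_1 mat"
  assumes "similar_mat A B"
  shows "mtr A = mtr B"
proof -
  obtain n P Q where *: "{A, B, P, Q} \<subseteq> carrier_mat n n" "P * Q = 1\<^sub>m n" "Q * P = 1\<^sub>m n" "A = P * B * Q"
    using similar_matD[OF assms] by blast
  have "mtr A = mtr (P * (B * Q))" using * by (simp add: assoc_mult_mat[of _ n n _ n _ n])
  also have "\<dots> = mtr (B * Q * P)" by (rule mtr_mult_comm[of _ n n]) (use * in auto)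
  also have "B * Q * P = B"
    using * by (auto simp: assoc_mult_mat[of B n n Q n P n])
  finally show ?thesis .
qed

text \<open>The clause on \<open>c \<cdot>\<^sub>m M\<close> serves blocks on which a commuting
  matrix is the scalar \<open>c\<close>. All clauses have to refer to one and the same list.\<close>

lemma eigenvalue_list:
  fixes M :: "'k::alg_closed_field mat"
  assumes M: "M \<in> carrier_mat d d"
  obtains es where "length es = d" "char_poly M = (\<Prod>e\<leftarrow>es. [:- e, 1:])"
    "det M = prod_list es" "mtr M = sum_list es"
    "\<forall>c. char_poly (c \<cdot>\<^sub>m M) = (\<Prod>e\<leftarrow>es. [:- (c * e), 1:])"
proof -
  obtain T where T: "T \<in> carrier_mat d d" and sim: "similar_mat M T" and ut: "upper_triangular T"
    using triangularizable[OF M] by blast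
  have cp: "char_poly (c \<cdot>\<^sub>m M) = (\<Prod>e\<leftarrow>diag_mat T. [:- (c * e), 1:])" for c
  proof -
    have "similar_mat (c \<cdot>\<^sub>m M) (c \<cdot>\<^sub>m T)"
      using sim unfolding similar_mat_def using similar_mat_wit_smult by blast
    then have "char_poly (c \<cdot>\<^sub>m M) = char_poly (c \<cdot>\<^sub>m T)" by (rule char_poly_similar)
    also have "\<dots> = (\<Prod>e\<leftarrow>diag_mat (c \<cdot>\<^sub>m T). [:- e, 1:])"
      by (rule char_poly_upper_triangular[of _ d]) (use T ut in \<open>auto simp: upper_triangular_def\<close>)
    also have "diag_mat (c \<cdot>\<^sub>m T) = map (\<lambda>e. c * e) (diag_mat T)"
      using T by (auto simp: diag_mat_def)
    finally show ?thesis by (simp add: o_def)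
  qed
  have "1 \<cdot>\<^sub>m M = M" by (intro eq_matI) auto
  then have cp1: "char_poly M = (\<Prod>e\<leftarrow>diag_mat T. [:- e, 1:])" using cp[of 1] by simp
  have "det M = prod_list (diag_mat T)"
    using det_similar[OF sim] det_upper_triangular[OF ut T] by simp
  moreover have "mtr M = sum_list (diag_mat T)"
    using mtr_similar[OF sim] by (simp add: mtr_def diag_mat_def interv_sum_list_conv_sum_set_nat)
  moreover have "length (diag_mat T) = d" using T by (simp add: diag_mat_def)
  ultimately show thesis using that cp1 cp by blast
qed

section \<open>Commuting matrices and torsion eigenvalues\<close>

definition mat_rep :: "('g, 'h) monoid_scheme \<Rightarrow> nat \<Rightarrow> ('g \<Rightarrow> 'k::field mat) \<Rightarrow> bool" where
  "mat_rep G d \<rho> \<longleftrightarrow> (\<forall>x \<in> carrier G. \<rho> x \<in> carrier_mat d d) \<and> \<rho> \<one>\<^bsub>G\<^esub> = 1\<^sub>m d \<and>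
     (\<forall>x \<in> carrier G. \<forall>y \<in> carrier G. \<rho> (x \<otimes>\<^bsub>G\<^esub> y) = \<rho> x * \<rho> y)"

lemma mat_rep_carrier: "mat_rep G d \<rho> \<Longrightarrow> x \<in> carrier G \<Longrightarrow> \<rho> x \<in> carrier_mat d d"
  and mat_rep_one: "mat_rep G d \<rho> \<Longrightarrow> \<rho> \<one>\<^bsub>G\<^esub> = 1\<^sub>m d"
  and mat_rep_mult: "mat_rep G d \<rho> \<Longrightarrow> x \<in> carrier G \<Longrightarrow> y \<in> carrier G \<Longrightarrow>
    \<rho> (x \<otimes>\<^bsub>G\<^esub> y) = \<rho> x * \<rho> y"
  by (auto simp: mat_rep_def)

lemma (in group) mat_rep_inv:
  assumes "mat_rep G d \<rho>" "x \<in> carrier G"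
  shows "\<rho> x * \<rho> (inv x) = 1\<^sub>m d" "\<rho> (inv x) * \<rho> x = 1\<^sub>m d"
  using assms mat_rep_mult[OF assms(1), of x "inv x"] mat_rep_mult[OF assms(1), of "inv x" x]
    mat_rep_one[OF assms(1)] by auto

text \<open>An invariant subspace splits a representation into two smaller ones, on the subspace and
  on the quotient. The corner \<open>\<beta>\<close> is a crossed term and is kept because Kolchin's
  theorem needs it.\<close>

lemma mat_rep_block:
  fixes G (structure) and \<rho> :: "'g \<Rightarrow> 'k::field mat"
  assumes G: "group G" and rep: "mat_rep G d \<rho>" and P: "P \<in> carrier_mat d d" and Q: "Q \<in> carrier_mat d d"
    and PQ: "P * Q = 1\<^sub>m d" and QP: "Q * P = 1\<^sub>m d" and r: "r \<le> d"
    and z: "\<forall>x\<in>carrier G. \<forall>i j. r \<le> i \<longrightarrow> i < d \<longrightarrow> j < r \<longrightarrow> (P * \<rho> x * Q) $$ (i, j) = 0"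
  obtains \<rho>\<^sub>1 \<beta> \<rho>\<^sub>2 where "mat_rep G r \<rho>\<^sub>1" "mat_rep G (d - r) \<rho>\<^sub>2"
    "\<forall>x\<in>carrier G. \<beta> x \<in> carrier_mat r (d - r)"
    "\<forall>x\<in>carrier G. P * \<rho> x * Q = four_block_mat (\<rho>\<^sub>1 x) (\<beta> x) (0\<^sub>m (d - r) r) (\<rho>\<^sub>2 x)"
proof -
  interpret group G by (rule G)
  have "\<exists>A B D. A \<in> carrier_mat r r \<and> B \<in> carrier_mat r (d - r) \<and> D \<in> carrier_mat (d - r) (d - r) \<and>
     P * \<rho> x * Q = four_block_mat A B (0\<^sub>m (d - r) r) D" if x: "x \<in> carrier G" for x
  proof -
    have "P * \<rho> x * Q \<in> carrier_mat d d" using P Q mat_rep_carrier[OF rep x] by simp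
    from split_upper_block[OF this r] z x show ?thesis by metis
  qed
  then obtain \<rho>\<^sub>1 \<beta> \<rho>\<^sub>2 where 1: "\<And>x. x \<in> carrier G \<Longrightarrow> \<rho>\<^sub>1 x \<in> carrier_mat r r"
    and 2: "\<And>x. x \<in> carrier G \<Longrightarrow> \<beta> x \<in> carrier_mat r (d - r)"
    and 3: "\<And>x. x \<in> carrier G \<Longrightarrow> \<rho>\<^sub>2 x \<in> carrier_mat (d - r) (d - r)"
    and 4: "\<And>x. x \<in> carrier G \<Longrightarrow> P * \<rho> x * Q = four_block_mat (\<rho>\<^sub>1 x) (\<beta> x) (0\<^sub>m (d - r) r) (\<rho>\<^sub>2 x)"
    by metis
  have one: "\<rho>\<^sub>1 \<one> = 1\<^sub>m r" "\<rho>\<^sub>2 \<one> = 1\<^sub>m (d - r)"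
  proof -
    have "four_block_mat (\<rho>\<^sub>1 \<one>) (\<beta> \<one>) (0\<^sub>m (d - r) r) (\<rho>\<^sub>2 \<one>) = P * 1\<^sub>m d * Q"
      unfolding 4[OF one_closed, symmetric] mat_rep_one[OF rep] ..
    also have "\<dots> = 1\<^sub>m d" using P PQ by simp
    also have "\<dots> = four_block_mat (1\<^sub>m r) (0\<^sub>m r (d - r)) (0\<^sub>m (d - r) r) (1\<^sub>m (d - r))"
      using r by (simp add: four_block_one_mat)
    finally show "\<rho>\<^sub>1 \<one> = 1\<^sub>m r" "\<rho>\<^sub>2 \<one> = 1\<^sub>m (d - r)"
      using four_block_mat_inject[OF 1[OF one_closed] one_carrier_mat 3[OF one_closed] one_carrier_mat] by blast+
  qed
  have mult: "\<rho>\<^sub>1 (x \<otimes> y) = \<rho>\<^sub>1 x * \<rho>\<^sub>1 y" "\<rho>\<^sub>2 (x \<otimes> y) = \<rho>\<^sub>2 x * \<rho>\<^sub>2 y"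
    if x: "x \<in> carrier G" and y: "y \<in> carrier G" for x y
  proof -
    have "four_block_mat (\<rho>\<^sub>1 (x \<otimes> y)) (\<beta> (x \<otimes> y)) (0\<^sub>m (d - r) r) (\<rho>\<^sub>2 (x \<otimes> y)) = P * (\<rho> x * \<rho> y) * Q"
      unfolding 4[OF m_closed[OF x y], symmetric] mat_rep_mult[OF rep x y] ..
    also have "\<dots> = (P * \<rho> x * Q) * (P * \<rho> y * Q)"
      by (rule conj_mult[symmetric, OF P Q QP mat_rep_carrier[OF rep x] mat_rep_carrier[OF rep y]])
    also have "\<dots> = four_block_mat (\<rho>\<^sub>1 x * \<rho>\<^sub>1 y) (\<rho>\<^sub>1 x * \<beta> y + \<beta> x * \<rho>\<^sub>2 y) (0\<^sub>m (d - r) r) (\<rho>\<^sub>2 x * \<rho>\<^sub>2 y)"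
      unfolding 4[OF x] 4[OF y] by (rule mult_upper_block[OF 1[OF x] 2[OF x] 3[OF x] 1[OF y] 2[OF y] 3[OF y]])
    finally show "\<rho>\<^sub>1 (x \<otimes> y) = \<rho>\<^sub>1 x * \<rho>\<^sub>1 y" "\<rho>\<^sub>2 (x \<otimes> y) = \<rho>\<^sub>2 x * \<rho>\<^sub>2 y"
      using four_block_mat_inject[OF 1[OF m_closed[OF x y]] mult_carrier_mat[OF 1[OF x] 1[OF y]]
          3[OF m_closed[OF x y]] mult_carrier_mat[OF 3[OF x] 3[OF y]]] by blast+
  qed
  have "mat_rep G r \<rho>\<^sub>1" "mat_rep G (d - r) \<rho>\<^sub>2"
    unfolding mat_rep_def using 1 3 one mult by auto
  then show thesis using that 2 4 by blast
qed

lemma (in group) det_derived: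
  fixes \<rho> :: "'a \<Rightarrow> 'k::field mat"
  assumes rep: "mat_rep G d \<rho>" and g: "g \<in> derived G (carrier G)"
  shows "det (\<rho> g) = 1"
proof -
  have mult: "det (\<rho> (x \<otimes> y)) = det (\<rho> x) * det (\<rho> y)" if "x \<in> carrier G" "y \<in> carrier G" for x y
    using det_mult[OF mat_rep_carrier[OF rep that(1)] mat_rep_carrier[OF rep that(2)]]
    by (simp add: mat_rep_mult[OF rep that])
  have inv: "det (\<rho> x) * det (\<rho> (inv x)) = 1" if "x \<in> carrier G" for x
    using mult[OF that inv_closed[OF that]] that by (simp add: mat_rep_one[OF rep])
  let ?H = "{x \<in> carrier G. det (\<rho> x) = 1}"
  have "subgroup ?H G"
  proof
    fix x assume "x \<in> ?H" then show "inv x \<in> ?H" using inv[of x] by auto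
  qed (auto simp: mult mat_rep_one[OF rep])
  moreover have "derived_set G (carrier G) \<subseteq> ?H"
  proof clarsimp
    fix x y assume xy: "x \<in> carrier G" "y \<in> carrier G"
    then have "det (\<rho> (x \<otimes> y \<otimes> inv x \<otimes> inv y)) = (det (\<rho> x) * det (\<rho> (inv x))) * (det (\<rho> y) * det (\<rho> (inv y)))"
      by (simp add: mult)
    then show "det (\<rho> (x \<otimes> y \<otimes> inv x \<otimes> inv y)) = 1" using xy inv by simp
  qed
  ultimately have "derived G (carrier G) \<subseteq> ?H"
    unfolding derived_def by (intro generate_subgroup_incl)
  then show ?thesis using g by auto
qed

text \<open>Each entry \<open>(q, ps)\<close> is a quotient on which \<open>M\<close> is the scalar
  \<open>q\<close> and \<open>ps\<close> lists the eigenvalues of \<open>\<rho> g\<close>. All of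
  \<open>\<rho>\<close> acts there because it commutes with \<open>M\<close>, so an element of the
  derived group has determinant 1. The same \<open>q\<close> may occur in several entries: quotients
  by the image of \<open>M - q\<close> are split off one at a time, not whole generalized
  eigenspaces.\<close>

lemma rep_commuting_blocks:
  fixes \<rho> :: "'g \<Rightarrow> 'k::alg_closed_field mat"
  assumes G: "group G" and g: "g \<in> derived G (carrier G)"
    and "mat_rep G d \<rho>" "M \<in> carrier_mat d d" "\<forall>x\<in>carrier G. \<rho> x * M = M * \<rho> x"
  shows "\<exists>bl. (\<forall>(q, ps) \<in> set bl. prod_list ps = 1) \<and>
     char_poly (\<rho> g) = (\<Prod>(q, ps)\<leftarrow>bl. \<Prod>p\<leftarrow>ps. [:- p, 1:]) \<and>
     char_poly M = (\<Prod>(q, ps)\<leftarrow>bl. \<Prod>p\<leftarrow>ps. [:- q, 1:]) \<and>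
     char_poly (\<rho> g * M) = (\<Prod>(q, ps)\<leftarrow>bl. \<Prod>p\<leftarrow>ps. [:- (q * p), 1:])"
  using assms(3-)
proof (induction d arbitrary: \<rho> M rule: less_induct)
  case (less d)
  note rep = less.prems(1) and M = less.prems(2) and comm = less.prems(3)
  interpret group G by (rule G)
  have gG: "g \<in> carrier G" using g derived_in_carrier[OF subset_refl] by blast
  show ?case
  proof (cases "d = 0")
    case True
    have "char_poly X = 1" if "X \<in> carrier_mat 0 0" for X :: "'k mat"
      using that by (simp add: char_poly_def det_dim_zero)
    then show ?thesis using True mat_rep_carrier[OF rep gG] M by (intro exI[of _ "[]"]) simp
  next
    case False
    obtain q P Q r A B where P: "P \<in> carrier_mat d d" and Q: "Q \<in> carrier_mat d d"
      and PQ: "P * Q = 1\<^sub>m d" and QP: "Q * P = 1\<^sub>m d" and r: "r < d"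
      and A: "A \<in> carrier_mat r r" and B: "B \<in> carrier_mat r (d - r)"
      and blk: "P * M * Q = four_block_mat A B (0\<^sub>m (d - r) r) (q \<cdot>\<^sub>m 1\<^sub>m (d - r))"
      and z: "\<forall>X. X \<in> carrier_mat d d \<longrightarrow> X * M = M * X \<longrightarrow>
        (\<forall>i j. r \<le> i \<longrightarrow> i < d \<longrightarrow> j < r \<longrightarrow> (P * X * Q) $$ (i, j) = 0)"
      by (rule eigen_block[OF M False[unfolded neq0_conv]])
    let ?D = "q \<cdot>\<^sub>m 1\<^sub>m (d - r) :: 'k mat"
    have D: "?D \<in> carrier_mat (d - r) (d - r)" by simp
    have "\<forall>x\<in>carrier G. \<forall>i j. r \<le> i \<longrightarrow> i < d \<longrightarrow> j < r \<longrightarrow> (P * \<rho> x * Q) $$ (i, j) = 0"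
      using z mat_rep_carrier[OF rep] comm by blast
    then obtain \<rho>\<^sub>1 \<beta> \<rho>\<^sub>2 where rep1: "mat_rep G r \<rho>\<^sub>1" and rep2: "mat_rep G (d - r) \<rho>\<^sub>2"
      and \<beta>: "\<forall>x\<in>carrier G. \<beta> x \<in> carrier_mat r (d - r)"
      and \<rho>blk: "\<forall>x\<in>carrier G. P * \<rho> x * Q = four_block_mat (\<rho>\<^sub>1 x) (\<beta> x) (0\<^sub>m (d - r) r) (\<rho>\<^sub>2 x)"
      by (rule mat_rep_block[OF G rep P Q PQ QP less_imp_le[OF r]])
    have prod1: "P * (\<rho> x * M) * Q = four_block_mat (\<rho>\<^sub>1 x * A) (\<rho>\<^sub>1 x * B + \<beta> x * ?D) (0\<^sub>m (d - r) r) (\<rho>\<^sub>2 x * ?D)"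
      and prod2: "P * (M * \<rho> x) * Q = four_block_mat (A * \<rho>\<^sub>1 x) (A * \<beta> x + B * \<rho>\<^sub>2 x) (0\<^sub>m (d - r) r) (?D * \<rho>\<^sub>2 x)"
      if x: "x \<in> carrier G" for x
      unfolding conj_mult[OF P Q QP mat_rep_carrier[OF rep x] M, symmetric]
        conj_mult[OF P Q QP M mat_rep_carrier[OF rep x], symmetric] \<rho>blk[rule_format, OF x] blk
      using mult_upper_block[OF mat_rep_carrier[OF rep1 x] \<beta>[rule_format, OF x] mat_rep_carrier[OF rep2 x] A B D]
        mult_upper_block[OF A B D mat_rep_carrier[OF rep1 x] \<beta>[rule_format, OF x] mat_rep_carrier[OF rep2 x]]
      by auto
    have comm1: "\<forall>x\<in>carrier G. \<rho>\<^sub>1 x * A = A * \<rho>\<^sub>1 x"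
    proof
      fix x assume x: "x \<in> carrier G"
      note c1 = mat_rep_carrier[OF rep1 x] and c2 = mat_rep_carrier[OF rep2 x]
      show "\<rho>\<^sub>1 x * A = A * \<rho>\<^sub>1 x"
        by (rule four_block_mat_inject(1)[OF _ _ _ _ trans[OF prod1[OF x, symmetric] trans[OF _ prod2[OF x]]]])
          (use c1 c2 A D comm x in auto)
    qed
    obtain bl where bl: "\<forall>(q, ps) \<in> set bl. prod_list ps = 1"
      "char_poly (\<rho>\<^sub>1 g) = (\<Prod>(q, ps)\<leftarrow>bl. \<Prod>p\<leftarrow>ps. [:- p, 1:])"
      "char_poly A = (\<Prod>(q, ps)\<leftarrow>bl. \<Prod>p\<leftarrow>ps. [:- q, 1:])"
      "char_poly (\<rho>\<^sub>1 g * A) = (\<Prod>(q, ps)\<leftarrow>bl. \<Prod>p\<leftarrow>ps. [:- (q * p), 1:])"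
      using less.IH[OF r rep1 A comm1] by blast
    note c1 = mat_rep_carrier[OF rep1 gG] and c2 = mat_rep_carrier[OF rep2 gG]
    obtain ps where ps: "length ps = d - r" "char_poly (\<rho>\<^sub>2 g) = (\<Prod>e\<leftarrow>ps. [:- e, 1:])"
      "det (\<rho>\<^sub>2 g) = prod_list ps" "mtr (\<rho>\<^sub>2 g) = sum_list ps"
      "\<forall>c. char_poly (c \<cdot>\<^sub>m \<rho>\<^sub>2 g) = (\<Prod>e\<leftarrow>ps. [:- (c * e), 1:])"
      by (rule eigenvalue_list[OF c2])
    have simc: "char_poly X = char_poly (P * X * Q)" if "X \<in> carrier_mat d d" for X
      by (rule char_poly_similar[OF conj_similar[OF P Q PQ QP that]])
    have "char_poly (\<rho> g) = char_poly (\<rho>\<^sub>1 g) * char_poly (\<rho>\<^sub>2 g)"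
      unfolding simc[OF mat_rep_carrier[OF rep gG]] \<rho>blk[rule_format, OF gG]
      by (rule char_poly_upper_block[OF c1 \<beta>[rule_format, OF gG] c2])
    moreover have "char_poly M = char_poly A * char_poly ?D"
      unfolding simc[OF M] blk by (rule char_poly_upper_block[OF A B D])
    moreover have "char_poly (\<rho> g * M) = char_poly (\<rho>\<^sub>1 g * A) * char_poly (\<rho>\<^sub>2 g * ?D)"
      unfolding simc[OF mult_carrier_mat[OF mat_rep_carrier[OF rep gG] M]] prod1[OF gG]
      by (rule char_poly_upper_block) (use c1 c2 A B D \<beta> gG in auto)
    moreover have "\<rho>\<^sub>2 g * ?D = q \<cdot>\<^sub>m \<rho>\<^sub>2 g"
      using c2 mult_smult_distrib[OF c2 one_carrier_mat, of q] by simp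
    moreover have "char_poly ?D = (\<Prod>p\<leftarrow>ps. [:- q, 1:])"
    proof -
      have "char_poly ?D = (\<Prod>a\<leftarrow>diag_mat ?D. [:- a, 1:])"
        by (rule char_poly_upper_triangular[OF D]) auto
      also have "diag_mat ?D = map (\<lambda>_. q) ps"
        unfolding diag_mat_def using ps(1) by (intro nth_equalityI) auto
      finally show ?thesis by (simp add: o_def)
    qed
    moreover have "prod_list ps = 1" using det_derived[OF rep2 g] ps(3) by simp
    ultimately show ?thesis using bl ps by (intro exI[of _ "(q, ps) # bl"]) (simp add: mult.commute)
  qed
qed

text \<open>The identity function on \<open>J\<close> is multiplicatively harmonic for the balanced weights \<open>w\<close>;
  neighbours then agree up to torsion whose order depends only on \<open>n\<close> and \<open>B\<close>. Eliminating a vertex \<open>v\<close> by the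
  star-mesh transformation (each path \<open>j \<rightarrow> v \<rightarrow> k\<close> becomes an edge) preserves both properties.\<close>

definition torsion_exponent :: "'k::field itself \<Rightarrow> nat \<Rightarrow> nat \<Rightarrow> nat \<Rightarrow> bool" where
  "torsion_exponent _ n B N \<longleftrightarrow> (\<forall>(J :: 'k set) w. finite J \<longrightarrow> card J = n \<longrightarrow> 0 \<notin> J \<longrightarrow>
    (\<forall>j\<in>J. \<forall>k\<in>J. w j k \<le> B) \<longrightarrow>
    (\<forall>k\<in>J. (\<Sum>j\<in>J. w k j) = (\<Sum>j\<in>J. w j k)) \<longrightarrow>
    (\<forall>j\<in>J. (\<Prod>k\<in>J. k ^ w j k) = j ^ (\<Sum>k\<in>J. w j k)) \<longrightarrow>
    (\<forall>j\<in>J. \<forall>k\<in>J. w j k > 0 \<longrightarrow> j ^ N = k ^ N))"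

lemma torsion_exponentD:
  fixes J :: "'k::field set"
  assumes "torsion_exponent TYPE('k) n B N" "finite J" "card J = n" "0 \<notin> J"
    "\<And>j k. j \<in> J \<Longrightarrow> k \<in> J \<Longrightarrow> w j k \<le> B"
    "\<And>k. k \<in> J \<Longrightarrow> (\<Sum>j\<in>J. w k j) = (\<Sum>j\<in>J. w j k)"
    "\<And>j. j \<in> J \<Longrightarrow> (\<Prod>k\<in>J. k ^ w j k) = j ^ (\<Sum>k\<in>J. w j k)"
    "j \<in> J" "k \<in> J" "w j k > 0"
  shows "j ^ N = k ^ N"
  using assms(1)[unfolded torsion_exponent_def, rule_format, OF assms(2-4), of w] assms(5-) by blast

lemma torsion_exponent_exists: "\<exists>N>0. torsion_exponent TYPE('k::field) n B N"
proof (induction n arbitrary: B)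
  case 0
  then show ?case by (intro exI[of _ 1]) (auto simp: torsion_exponent_def)
next
  case (Suc n)
  \<comment> \<open>Bounds the weights after elimination of one vertex, whose total weight to other
    vertices is at most \<open>n * B\<close>.\<close>
  define B' where "B' = (n * B + 1) * B + B * B"
  obtain N' where N': "N' > 0" and IH: "torsion_exponent TYPE('k) n B' N'"
    using Suc[of B'] by blast
  \<comment> \<open>The factorial is divisible by every positive total weight
    \<open>W \<le> n * B\<close> of the eliminated vertex; the exponent \<open>W\<close> is lost
    when that vertex is compared with its neighbours.\<close>
  define N where "N = N' * fact (n * B)"
  have "j ^ N = k ^ N" if J: "finite J" "card J = Suc n" "0 \<notin> J"
    and bound: "\<forall>j\<in>J. \<forall>k\<in>J. w j k \<le> B"
    and bal: "\<forall>k\<in>J. (\<Sum>j\<in>J. w k j) = (\<Sum>j\<in>J. w j k)"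
    and harm: "\<forall>j\<in>J. (\<Prod>k\<in>J. k ^ w j k) = j ^ (\<Sum>k\<in>J. w j k)"
    and jk: "j \<in> J" "k \<in> J" "w j k > 0"
    for J :: "'k set" and w j k
  proof -
    obtain v where v: "v \<in> J" using J by fastforce
    define J' where "J' = J - {v}"
    have J': "finite J'" "card J' = n" "0 \<notin> J'" "v \<notin> J'" "J = insert v J'"
      using J v by (auto simp: J'_def)
    define W where "W = (\<Sum>k\<in>J'. w v k)"
    \<comment> \<open>\<open>W\<close> leaves out loops at \<open>v\<close>, which cancel from
      harmonicity. If \<open>W = 0\<close>, then \<open>v\<close> has no edges to other vertices,
      and the factor 1 leaves the remaining graph as it is.\<close>
    define W1 where "W1 = (if W = 0 then 1 else W)"
    have in_v: "(\<Sum>j\<in>J'. w j v) = W"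
      using bal[rule_format, OF v] J' by (simp add: W_def)
    have W_le: "W \<le> n * B"
    proof -
      have "W \<le> (\<Sum>k\<in>J'. B)" unfolding W_def using bound J' by (intro sum_mono) auto
      then show ?thesis using J' by simp
    qed
    have W1_le: "W1 \<le> n * B + 1" using W_le by (simp add: W1_def)
    have W1_pos: "W1 > 0" by (simp add: W1_def)
    have z1: "w v k = 0" if "W = 0" "k \<in> J'" for k using that J' by (simp add: W_def)
    have z2: "w j v = 0" if "W = 0" "j \<in> J'" for j using that in_v J' by simp
    have out1: "w v k * W = W1 * w v k" if "k \<in> J'" for k using z1 that by (simp add: W1_def)
    have in1: "w j v * W = W1 * w j v" if "j \<in> J'" for j using z2 that by (simp add: W1_def)
    \<comment> \<open>The star-mesh weight of an edge is its old weight plus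
      \<open>w j v * w v k\<close> divided by \<open>W\<close>; it is multiplied by \<open>W\<close>
      here to remain a natural number.\<close>
    define w' where "w' = (\<lambda>j k. W1 * w j k + w j v * w v k)"
    have out: "(\<Sum>k\<in>J'. w' j k) = W1 * (\<Sum>k\<in>J. w j k)" if "j \<in> J'" for j
    proof -
      have "(\<Sum>k\<in>J'. w' j k) = W1 * (\<Sum>k\<in>J'. w j k) + w j v * W"
        unfolding w'_def W_def by (simp add: sum.distrib sum_distrib_left)
      also have "\<dots> = W1 * (w j v + (\<Sum>k\<in>J'. w j k))" using in1[OF that] by (simp add: algebra_simps)
      finally show ?thesis using J' by simp
    qed
    have inn: "(\<Sum>j\<in>J'. w' j k) = W1 * (\<Sum>j\<in>J. w j k)" if "k \<in> J'" for k
    proof -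
      have "(\<Sum>j\<in>J'. w' j k) = W1 * (\<Sum>j\<in>J'. w j k) + (\<Sum>j\<in>J'. w j v) * w v k"
        unfolding w'_def by (simp add: sum.distrib sum_distrib_left sum_distrib_right)
      also have "\<dots> = W1 * (w v k + (\<Sum>j\<in>J'. w j k))"
        using out1[OF that] in_v by (simp add: algebra_simps)
      finally show ?thesis using J' by simp
    qed
    have harm_v: "(\<Prod>k\<in>J'. k ^ w v k) = v ^ W"
    proof -
      have "v ^ w v v * (\<Prod>k\<in>J'. k ^ w v k) = v ^ (w v v + W)"
        using harm[rule_format, OF v] J' by (simp add: W_def)
      moreover have "v \<noteq> 0" using v J by auto
      ultimately show ?thesis by (simp add: power_add)
    qed
    have harm': "(\<Prod>k\<in>J'. k ^ w' j k) = j ^ (\<Sum>k\<in>J'. w' j k)" if j: "j \<in> J'" for j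
    proof -
      have "(\<Prod>k\<in>J'. k ^ w' j k) = (\<Prod>k\<in>J'. k ^ w j k) ^ W1 * (\<Prod>k\<in>J'. k ^ w v k) ^ w j v"
        unfolding w'_def
        by (simp add: power_add prod.distrib power_mult[symmetric] mult.commute prod_power_distrib)
      also have "\<dots> = (v ^ w j v * (\<Prod>k\<in>J'. k ^ w j k)) ^ W1"
      proof -
        have "(v ^ W) ^ w j v = v ^ (w j v * W)" by (simp add: power_mult[symmetric] mult.commute)
        also have "\<dots> = (v ^ w j v) ^ W1"
          unfolding in1[OF j] by (simp add: power_mult[symmetric] mult.commute)
        finally show ?thesis unfolding harm_v power_mult_distrib by (simp only: mult.commute)
      qed
      also have "v ^ w j v * (\<Prod>k\<in>J'. k ^ w j k) = j ^ (\<Sum>k\<in>J. w j k)"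
        using harm[rule_format, of j] j J' by simp
      finally show ?thesis unfolding out[OF j] by (simp add: power_mult[symmetric] mult.commute)
    qed
    have bound': "w' j k \<le> B'" if "j \<in> J'" "k \<in> J'" for j k
    proof -
      have "w j k \<le> B" "w j v \<le> B" "w v k \<le> B" using that bound J' by auto
      then show ?thesis unfolding w'_def B'_def using W1_le by (intro add_mono mult_mono) auto
    qed
    have bal': "(\<Sum>j\<in>J'. w' k j) = (\<Sum>j\<in>J'. w' j k)" if "k \<in> J'" for k
      unfolding out[OF that] inn[OF that] using bal that J' by auto
    have IH': "j ^ N' = k ^ N'" if "j \<in> J'" "k \<in> J'" "w' j k > 0" for j k
      by (rule torsion_exponentD[OF IH J'(1-3), where w = w']) (use bound' bal' harm' that in auto)
    have Ndvd: "N' dvd N" by (simp add: N_def)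
    have lift: "j ^ N = k ^ N" if "j ^ m = k ^ m" "m dvd N" for j k :: 'k and m
      using that by (auto simp: power_mult elim!: dvdE)
    \<comment> \<open>By balance some \<open>j\<close> has an edge into \<open>v\<close>. In the
      reduced graph \<open>j\<close> is joined to every out-neighbour of \<open>v\<close>, so these
      agree after raising to the power \<open>N'\<close>. Harmonicity at \<open>v\<close> then
      compares their common value with \<open>v\<close>.\<close>
    have v_nbr: "k ^ N = v ^ N" if k: "k \<in> J'" "w v k > 0" for k
    proof -
      have "W > 0" using z1 k by (cases "W = 0") auto
      then obtain j where j: "j \<in> J'" "w j v > 0" using in_v by (metis sum_nonneg_eq_0_iff J'(1) neq0_conv sum.neutral)
      have "k' ^ (N' * w v k') = k ^ (N' * w v k')" if "k' \<in> J'" for k'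
      proof (cases "w v k' = 0")
        case False
        then have "w' j k' > 0" "w' j k > 0" using j k by (auto simp: w'_def)
        then have "k' ^ N' = k ^ N'" using IH'[of j k'] IH'[of j k] j k that by simp
        then show ?thesis by (simp add: power_mult)
      qed simp
      then have "(\<Prod>k'\<in>J'. k' ^ (N' * w v k')) = (\<Prod>k'\<in>J'. k ^ (N' * w v k'))"
        by (intro prod.cong) auto
      also have "\<dots> = k ^ (N' * W)" by (simp add: W_def power_sum sum_distrib_left)
      also have "(\<Prod>k'\<in>J'. k' ^ (N' * w v k')) = v ^ (N' * W)"
        using arg_cong[OF harm_v, of "\<lambda>x. x ^ N'"]
        by (simp add: prod_power_distrib power_mult[symmetric] mult.commute)
      finally have "k ^ (N' * W) = v ^ (N' * W)" by simp
      moreover have "N' * W dvd N"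
        unfolding N_def using \<open>W > 0\<close> W_le by (intro mult_dvd_mono dvd_fact) auto
      ultimately show ?thesis by (rule lift)
    qed
    consider "j = k" | "j \<in> J'" "k \<in> J'" | "j = v" "k \<in> J'" | "j \<in> J'" "k = v"
      using jk J' by auto
    then show ?thesis
    proof cases
      case 2
      then have "w' j k > 0" using jk W1_pos by (simp add: w'_def)
      then show ?thesis using IH'[OF 2] lift Ndvd by blast
    next
      case 3
      then show ?thesis using v_nbr[of k] jk by simp
    next
      case 4
      have "W > 0" using z2 4 jk by (cases "W = 0") auto
      then obtain l where l: "l \<in> J'" "w v l > 0"
        unfolding W_def by (metis sum_nonneg_eq_0_iff J'(1) neq0_conv sum.neutral)
      then have "w' j l > 0" using 4 jk by (simp add: w'_def)
      then have "j ^ N = l ^ N" using IH'[OF 4(1) l(1)] lift Ndvd by blast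
      then show ?thesis using v_nbr[OF l] 4 by simp
    qed simp
  qed
  moreover have "N > 0" using N' by (simp add: N_def)
  ultimately show ?case unfolding torsion_exponent_def by blast
qed

section \<open>From joint eigenvalues to a weighted graph\<close>

lemma sum_size_filter:
  assumes "finite J" "\<forall>x\<in>#L. f x \<in> J"
  shows "(\<Sum>j\<in>J. size {#x \<in># L. P x \<and> f x = j#}) = size {#x \<in># L. P x#}"
  using assms(2)
proof (induction L)
  case (add x L)
  have "(\<Sum>j\<in>J. size {#y \<in># add_mset x L. P y \<and> f y = j#})
      = (\<Sum>j\<in>J. size {#y \<in># L. P y \<and> f y = j#} + (if j = f x then if P x then 1 else 0 else 0))"
    by (intro sum.cong) auto
  then show ?case using add assms(1) by (simp add: sum.distrib sum.delta)
qed simp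

lemma prod_size_filter:
  fixes f :: "'a \<Rightarrow> 'b::comm_monoid_mult"
  assumes "finite J" "\<forall>x\<in>#L. f x \<in> J"
  shows "(\<Prod>j\<in>J. j ^ size {#x \<in># L. P x \<and> f x = j#}) = (\<Prod>x\<in>#{#x \<in># L. P x#}. f x)"
  using assms(2)
proof (induction L)
  case (add x L)
  have "(\<Prod>j\<in>J. j ^ size {#y \<in># add_mset x L. P y \<and> f y = j#})
      = (\<Prod>j\<in>J. j ^ size {#y \<in># L. P y \<and> f y = j#} * (if j = f x then if P x then j else 1 else 1))"
    by (intro prod.cong) (auto simp: mult.commute)
  then show ?case using add assms(1) by (auto simp: prod.distrib prod.delta intro: mult.commute)
qed simp

lemma proots_prod_linear:
  "proots (\<Prod>x\<leftarrow>xs. [:- x, 1:]) = mset (xs :: 'k::field list)"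
proof -
  have "proots (\<Prod>p\<leftarrow>map (\<lambda>x. [:- x, 1:]) xs. p) = (\<Sum>p\<leftarrow>map (\<lambda>x. [:- x, 1:]) xs. proots p)"
    by (rule proots_prod_list) auto
  also have "\<dots> = mset xs" by (induction xs) auto
  finally show ?thesis by simp
qed

text \<open>Vertices are the scalars \<open>q\<close> that occur with some \<open>p\<close>, and
  every pair is an edge from \<open>q\<close> to \<open>q * p\<close>. Equality of the two products
  of linear factors says that in-degrees equal out-degrees. Product 1 in each \<open>ps\<close> says
  that the heads of the edges leaving \<open>q\<close> multiply to \<open>q\<close> to the power of
  its out-degree.\<close>

lemma block_eigenvalues_torsion:
  obtains N where "N > 0" "\<And>bl :: ('k::field \<times> 'k list) list.
    \<lbrakk>\<forall>(q, ps) \<in> set bl. prod_list ps = 1; (\<Sum>(q, ps)\<leftarrow>bl. length ps) = d;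
     \<forall>(q, ps) \<in> set bl. ps \<noteq> [] \<longrightarrow> q \<noteq> 0;
     (\<Prod>(q, ps)\<leftarrow>bl. \<Prod>p\<leftarrow>ps. [:- (q * p), 1:]) = (\<Prod>(q, ps)\<leftarrow>bl. \<Prod>p\<leftarrow>ps. [:- q, 1:])\<rbrakk> \<Longrightarrow>
    \<forall>(q, ps) \<in> set bl. \<forall>p \<in> set ps. p ^ N = 1"
proof -
  have "\<forall>n. \<exists>N>0. torsion_exponent TYPE('k) n d N"
    using torsion_exponent_exists by blast
  then obtain Nf where Nf: "\<And>n. Nf n > (0::nat)" and tors: "\<And>n. torsion_exponent TYPE('k) n d (Nf n)"
    by metis
  \<comment> \<open>The number of vertices varies with \<open>bl\<close> but is at most
    \<open>d\<close>; the product serves all sizes at once.\<close>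
  define N where "N = (\<Prod>n\<le>d. Nf n)"
  have N: "N > 0" unfolding N_def by (intro prod_pos) (auto simp: Nf)
  show thesis
  proof (rule that[OF N])
    fix bl :: "('k \<times> 'k list) list"
    assume pr: "\<forall>(q, ps) \<in> set bl. prod_list ps = 1" and len: "(\<Sum>(q, ps)\<leftarrow>bl. length ps) = d"
      and nz: "\<forall>(q, ps) \<in> set bl. ps \<noteq> [] \<longrightarrow> q \<noteq> 0"
      and eq: "(\<Prod>(q, ps)\<leftarrow>bl. \<Prod>p\<leftarrow>ps. [:- (q * p), 1:]) = (\<Prod>(q, ps)\<leftarrow>bl. \<Prod>p\<leftarrow>ps. [:- q, 1:])"
    define xs where "xs = concat (map (\<lambda>(q, ps). map (Pair q) ps) bl)"
    define L where "L = mset xs"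
    let ?g = "\<lambda>(q, p). q * p :: 'k"
    have cc: "(\<Prod>(q, ps)\<leftarrow>bl. \<Prod>p\<leftarrow>ps. [:- h q p, 1:]) = (\<Prod>x\<leftarrow>map (\<lambda>(q, p). h q p) xs. [:- x, 1:])"
      for h :: "'k \<Rightarrow> 'k \<Rightarrow> 'k"
      unfolding xs_def by (induction bl) (auto simp: o_def)
    have ms: "image_mset ?g L = image_mset fst L"
    proof -
      have "mset (map ?g xs) = mset (map (\<lambda>(q, p). q) xs)"
        using arg_cong[OF eq, of proots] unfolding cc proots_prod_linear .
      then show ?thesis by (simp add: L_def case_prod_unfold)
    qed
    define J where "J = fst ` set_mset L"
    have fst_J: "\<forall>x\<in>#L. fst x \<in> J" by (simp add: J_def)
    have g_J: "\<forall>x\<in>#L. ?g x \<in> J"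
    proof
      fix x assume "x \<in># L"
      then have "?g x \<in># image_mset ?g L" by simp
      then show "?g x \<in> J" unfolding ms by (simp add: J_def)
    qed
    have J: "finite J" by (simp add: J_def)
    have size_L: "size L = d" unfolding L_def xs_def len[symmetric] by (induction bl) auto
    have "card J \<le> size L" unfolding J_def
      by (metis card_image_le finite_set_mset le_trans size_mset_set L_def card_length size_mset set_mset_mset)
    then have card_J: "card J \<le> d" using size_L by simp
    have J0: "0 \<notin> J" using nz unfolding J_def L_def xs_def by force
    define w where "w j k = size {#x \<in># L. fst x = j \<and> ?g x = k#}" for j k
    have row: "(\<Sum>k\<in>J. w j k) = size {#x \<in># L. fst x = j#}" for j
      unfolding w_def by (rule sum_size_filter[OF J g_J])
    have col: "(\<Sum>j\<in>J. w j k) = size {#x \<in># L. ?g x = k#}" for k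
      unfolding w_def using sum_size_filter[OF J fst_J, of "\<lambda>x. ?g x = k"]
      by (simp add: conj_commute)
    have cnt: "size {#x \<in># L. h x = k#} = count (image_mset h L) k" for h :: "'k \<times> 'k \<Rightarrow> 'k" and k
      by (simp add: count_conv_size_mset filter_mset_image_mset)
    have bal: "(\<Sum>j\<in>J. w k j) = (\<Sum>j\<in>J. w j k)" for k
      unfolding row col cnt ms ..
    have pj: "(\<Prod>x\<in>#{#x \<in># L. fst x = j#}. snd x) = 1" for j
    proof -
      have e1: "(\<Prod>x\<in>#{#x \<in># L. fst x = j#}. snd x) = prod_list (map snd (filter (\<lambda>x. fst x = j) xs))"
        unfolding L_def by (simp add: prod_mset_prod_list flip: mset_filter mset_map)
      have flt: "filter (\<lambda>x. c) ys = (if c then ys else [])" for c and ys :: "'k list" by simp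
      have "prod_list (map snd (filter (\<lambda>x. fst x = j) xs)) = 1" using pr unfolding xs_def
        by (induction bl) (auto simp: filter_map o_def flt)
      then show ?thesis unfolding e1 .
    qed
    have harm: "(\<Prod>k\<in>J. k ^ w j k) = j ^ (\<Sum>k\<in>J. w j k)" for j
    proof -
      have "(\<Prod>k\<in>J. k ^ w j k) = (\<Prod>x\<in>#{#x \<in># L. fst x = j#}. ?g x)"
        unfolding w_def by (rule prod_size_filter[OF J g_J])
      also have "\<dots> = (\<Prod>x\<in>#{#x \<in># L. fst x = j#}. j * snd x)"
        by (intro arg_cong[where f = prod_mset] image_mset_cong) auto
      also have "\<dots> = j ^ size {#x \<in># L. fst x = j#} * (\<Prod>x\<in>#{#x \<in># L. fst x = j#}. snd x)"
        by (simp add: prod_mset.distrib)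
      finally show ?thesis unfolding row pj by simp
    qed
    have w_le: "w j k \<le> d" for j k unfolding w_def using size_L size_filter_mset_lesseq by metis
    have tor: "j ^ Nf (card J) = k ^ Nf (card J)" if "j \<in> J" "k \<in> J" "w j k > 0" for j k
      by (rule torsion_exponentD[OF tors J refl J0, where w = w]) (use w_le bal harm that in auto)
    have "p ^ N = 1" if "(q, ps) \<in> set bl" "p \<in> set ps" for q ps p
    proof -
      have x: "(q, p) \<in># L" using that by (force simp: L_def xs_def)
      then have "(q, p) \<in># {#x \<in># L. fst x = q \<and> ?g x = q * p#}" by simp
      then have "{#x \<in># L. fst x = q \<and> ?g x = q * p#} \<noteq> {#}" by (metis empty_not_add_mset insert_DiffM)
      then have "w q (q * p) > 0" unfolding w_def nonempty_has_size .
      moreover have "q \<in> J" "q * p \<in> J" using fst_J g_J x by force+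
      ultimately have "q ^ Nf (card J) = (q * p) ^ Nf (card J)" using tor by blast
      moreover have "q \<noteq> 0" using \<open>q \<in> J\<close> J0 by auto
      ultimately have "p ^ Nf (card J) = 1" by (simp add: power_mult_distrib)
      moreover have "Nf (card J) dvd N" unfolding N_def using card_J by (intro dvd_prodI) auto
      ultimately show ?thesis by (auto simp: power_mult elim!: dvdE)
    qed
    then show "\<forall>(q, ps) \<in> set bl. \<forall>p \<in> set ps. p ^ N = 1" by blast
  qed
qed


lemma det_0_if_char_poly_root_0:
  fixes M :: "'k::field mat"
  assumes "M \<in> carrier_mat d d" "poly (char_poly M) 0 = 0"
  shows "det M = 0"
proof -
  have "char_matrix M 0 = M" using assms(1) by (intro eq_matI) (auto simp: char_matrix_def)
  then show ?thesis
    using assms eigenvalue_root_char_poly[OF assms(1)] eigenvalue_det[OF assms(1)] by metis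
qed

text \<open>The exponent \<open>N\<close> is obtained from \<open>d\<close> before any
  \<open>g\<close> is chosen. Invertibility of \<open>\<sigma> x\<close> keeps 0 from being a vertex
  of the graph, and \<open>conj\<close> is what makes the graph balanced.\<close>

lemma derived_eigenvalues_torsion:
  fixes \<rho> \<sigma> :: "'g \<Rightarrow> 'k::alg_closed_field mat"
  assumes G: "group G" and rep: "mat_rep G d \<rho>"
    and \<sigma>: "\<And>x. x \<in> carrier G \<Longrightarrow> \<sigma> x \<in> carrier_mat d d" "\<And>x. x \<in> carrier G \<Longrightarrow> det (\<sigma> x) \<noteq> 0"
    and comm: "\<And>x y. x \<in> carrier G \<Longrightarrow> y \<in> carrier G \<Longrightarrow> \<rho> x * \<sigma> y = \<sigma> y * \<rho> x"
    and conj: "\<And>x. x \<in> carrier G \<Longrightarrow> char_poly (\<rho> x * \<sigma> x) = char_poly (\<sigma> x)"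
  shows "\<exists>N>0. \<forall>g \<in> derived G (carrier G). \<exists>es. length es = d \<and> (\<forall>e\<in>set es. e ^ N = 1) \<and>
    char_poly (\<rho> g) = (\<Prod>e\<leftarrow>es. [:- e, 1:])"
proof -
  interpret group G by (rule G)
  obtain N where N: "N > 0" and tors: "\<And>bl :: ('k \<times> 'k list) list.
    \<lbrakk>\<forall>(q, ps) \<in> set bl. prod_list ps = 1; (\<Sum>(q, ps)\<leftarrow>bl. length ps) = d;
     \<forall>(q, ps) \<in> set bl. ps \<noteq> [] \<longrightarrow> q \<noteq> 0;
     (\<Prod>(q, ps)\<leftarrow>bl. \<Prod>p\<leftarrow>ps. [:- (q * p), 1:]) = (\<Prod>(q, ps)\<leftarrow>bl. \<Prod>p\<leftarrow>ps. [:- q, 1:])\<rbrakk> \<Longrightarrow>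
    \<forall>(q, ps) \<in> set bl. \<forall>p \<in> set ps. p ^ N = 1"
    using block_eigenvalues_torsion[of d] by blast
  have "\<exists>es. length es = d \<and> (\<forall>e\<in>set es. e ^ N = 1) \<and> char_poly (\<rho> g) = (\<Prod>e\<leftarrow>es. [:- e, 1:])"
    if g: "g \<in> derived G (carrier G)" for g
  proof -
    have gG: "g \<in> carrier G" using g derived_in_carrier[OF subset_refl] by blast
    obtain bl where bl: "\<forall>(q, ps) \<in> set bl. prod_list ps = 1"
      "char_poly (\<rho> g) = (\<Prod>(q, ps)\<leftarrow>bl. \<Prod>p\<leftarrow>ps. [:- p, 1:])"
      "char_poly (\<sigma> g) = (\<Prod>(q, ps)\<leftarrow>bl. \<Prod>p\<leftarrow>ps. [:- q, 1:])"
      "char_poly (\<rho> g * \<sigma> g) = (\<Prod>(q, ps)\<leftarrow>bl. \<Prod>p\<leftarrow>ps. [:- (q * p), 1:])"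
      using rep_commuting_blocks[OF G g rep \<sigma>(1)[OF gG]] comm gG by blast
    define es where "es = concat (map snd bl)"
    have cp: "char_poly (\<rho> g) = (\<Prod>e\<leftarrow>es. [:- e, 1:])"
      unfolding bl(2) es_def by (induction bl) auto
    have len: "length es = d"
    proof -
      have "degree (\<Prod>e\<leftarrow>es. [:- e, 1:]) = length es" by (rule degree_linear_factors)
      then show ?thesis using degree_monic_char_poly[OF mat_rep_carrier[OF rep gG]] cp by simp
    qed
    have "(\<Sum>(q, ps)\<leftarrow>bl. length ps) = length es" unfolding es_def by (induction bl) auto
    moreover have "q \<noteq> 0" if "(q, ps) \<in> set bl" "ps \<noteq> []" for q ps
    proof
      assume "q = 0"
      then have "poly (char_poly (\<sigma> g)) 0 = 0"
        unfolding bl(3) using that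
      proof (induction bl)
        case (Cons b bl)
        show ?case
        proof (cases "b = (q, ps)")
          case True
          then show ?thesis using Cons.prems by (cases ps) auto
        next
          case False
          then show ?thesis using Cons by (cases b) auto
        qed
      qed simp
      then show False using det_0_if_char_poly_root_0[OF \<sigma>(1)[OF gG]] \<sigma>(2)[OF gG] by simp
    qed
    ultimately have "\<forall>(q, ps) \<in> set bl. \<forall>p \<in> set ps. p ^ N = 1"
      using bl conj[OF gG] len by (intro tors) auto
    then have "\<forall>e\<in>set es. e ^ N = 1" by (force simp: es_def)
    then show ?thesis using len cp by blast
  qed
  then show ?thesis using N by blast
qed

section \<open>Kolchin's theorem\<close>

text \<open>Presents a subspace as a column space, the form in which \<open>image_block\<close> can
  use it. The induction runs over the number \<open>k\<close> of leading coordinates that may be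
  nonzero on \<open>W\<close>; a vector that is nonzero in the last of them supplies one more
  column.\<close>

lemma subspace_range:
  fixes W :: "'k::field vec set"
  assumes "W \<subseteq> carrier_vec d" "0\<^sub>v d \<in> W" "\<And>v w. v \<in> W \<Longrightarrow> w \<in> W \<Longrightarrow> v + w \<in> W"
    "\<And>a v. v \<in> W \<Longrightarrow> a \<cdot>\<^sub>v v \<in> W"
  obtains c N where "N \<in> carrier_mat d c" "W = {N *\<^sub>v u |u. u \<in> carrier_vec c}"
proof -
  have gen: "\<exists>c N. N \<in> carrier_mat d c \<and> W = {N *\<^sub>v u |u. u \<in> carrier_vec c}"
    if "k \<le> d" "W \<subseteq> carrier_vec d" "0\<^sub>v d \<in> W" "\<forall>v\<in>W. \<forall>w\<in>W. v + w \<in> W"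
      "\<forall>a. \<forall>v\<in>W. a \<cdot>\<^sub>v v \<in> W" "\<forall>w\<in>W. \<forall>i. k \<le> i \<longrightarrow> i < d \<longrightarrow> w $ i = 0" for k and W :: "'k vec set"
    using that
  proof (induction k arbitrary: W)
    case 0
    have "w = 0\<^sub>v d" if "w \<in> W" for w using 0 that by (intro eq_vecI) auto
    then have "W = {0\<^sub>v d}" using 0 by blast
    moreover have "0\<^sub>m d 0 *\<^sub>v u = 0\<^sub>v d" if "u \<in> carrier_vec 0" for u :: "'k vec"
      using that by (intro eq_vecI) (auto simp: scalar_prod_def)
    then have "{0\<^sub>m d 0 *\<^sub>v u |u. u \<in> carrier_vec 0} = {0\<^sub>v d :: 'k vec}"
      by (fastforce intro: exI[of _ "0\<^sub>v 0"])
    ultimately show ?case by (intro exI[of _ 0] exI[of _ "0\<^sub>m d 0"]) auto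
  next
    case (Suc k)
    note clo = Suc.prems
    show ?case
    proof (cases "\<forall>w\<in>W. w $ k = 0")
      case True
      have "\<forall>w\<in>W. \<forall>i. k \<le> i \<longrightarrow> i < d \<longrightarrow> w $ i = 0"
      proof (intro ballI allI impI)
        fix w i assume "w \<in> W" "k \<le> i" "i < d"
        then show "w $ i = 0" using True clo(6) by (cases "i = k") auto
      qed
      then show ?thesis using Suc.IH[of W] clo by simp
    next
      case False
      then obtain w1 where w1: "w1 \<in> W" "w1 $ k \<noteq> 0" by blast
      have w1c: "w1 \<in> carrier_vec d" using w1 clo by auto
      define W0 where "W0 = {w \<in> W. w $ k = 0}"
      have kd: "k < d" using clo by simp
      have "\<exists>c N. N \<in> carrier_mat d c \<and> W0 = {N *\<^sub>v u |u. u \<in> carrier_vec c}"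
      proof (rule Suc.IH)
        show "\<forall>w\<in>W0. \<forall>i\<ge>k. i < d \<longrightarrow> w $ i = 0"
        proof (intro ballI allI impI)
          fix w i assume "w \<in> W0" "k \<le> i" "i < d"
          then show "w $ i = 0" using clo(6) by (cases "i = k") (auto simp: W0_def)
        qed
        show "\<forall>v\<in>W0. \<forall>w\<in>W0. v + w \<in> W0" "\<forall>a. \<forall>v\<in>W0. a \<cdot>\<^sub>v v \<in> W0"
          using clo kd unfolding W0_def by (auto simp: subset_iff)
      qed (use clo kd in \<open>auto simp: W0_def\<close>)
      then obtain c N where N: "N \<in> carrier_mat d c" and W0: "W0 = {N *\<^sub>v u |u. u \<in> carrier_vec c}" by blast
      define N' where "N' = mat d (Suc c) (\<lambda>(i, j). if j = 0 then w1 $ i else N $$ (i, j - 1))"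
      have N': "N' \<in> carrier_mat d (Suc c)" by (simp add: N'_def)
      have mv: "N' *\<^sub>v u = u $ 0 \<cdot>\<^sub>v w1 + N *\<^sub>v vec c (\<lambda>j. u $ Suc j)" if "u \<in> carrier_vec (Suc c)" for u
        using that N w1c unfolding N'_def
        by (intro eq_vecI) (auto simp: scalar_prod_def sum.atLeast0_lessThan_Suc_shift simp del: sum.op_ivl_Suc)
      have "N' *\<^sub>v u \<in> W" if u: "u \<in> carrier_vec (Suc c)" for u
      proof -
        have "N *\<^sub>v vec c (\<lambda>j. u $ Suc j) \<in> W0" unfolding W0 by force
        then show ?thesis unfolding mv[OF u] using clo w1 by (auto simp: W0_def)
      qed
      moreover have "\<exists>u. w = N' *\<^sub>v u \<and> u \<in> carrier_vec (Suc c)" if w: "w \<in> W" for w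
      proof -
        define a where "a = w $ k / w1 $ k"
        have wc: "w \<in> carrier_vec d" using w clo by auto
        have "w + (- a) \<cdot>\<^sub>v w1 \<in> W" using clo w w1 by blast
        moreover have "(w + (- a) \<cdot>\<^sub>v w1) $ k = 0" using wc w1c kd w1 by (simp add: a_def)
        ultimately have "w + (- a) \<cdot>\<^sub>v w1 \<in> W0" by (simp add: W0_def)
        then obtain u where u: "u \<in> carrier_vec c" "w + (- a) \<cdot>\<^sub>v w1 = N *\<^sub>v u" unfolding W0 by blast
        define u' where "u' = vec (Suc c) (\<lambda>j. if j = 0 then a else u $ (j - 1))"
        have "vec c (\<lambda>j. u' $ Suc j) = u" using u by (intro eq_vecI) (auto simp: u'_def)
        then have "N' *\<^sub>v u' = a \<cdot>\<^sub>v w1 + (w + (- a) \<cdot>\<^sub>v w1)"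
          using mv[of u'] u by (simp add: u'_def)
        also have "\<dots> = w" using wc w1c by (intro eq_vecI) auto
        finally show ?thesis by (intro exI[of _ u']) (simp add: u'_def)
      qed
      ultimately have "W = {N' *\<^sub>v u |u. u \<in> carrier_vec (Suc c)}" by blast
      then show ?thesis using N' by blast
    qed
  qed
  have "\<exists>c N. N \<in> carrier_mat d c \<and> W = {N *\<^sub>v u |u. u \<in> carrier_vec c}"
    by (rule gen[of d]) (use assms in auto)
  then show thesis using that by blast
qed

text \<open>There is no clause for zero, since the zero multiple of a member provides it. For
  \<open>S\<close> closed under products this is the enveloping algebra.\<close>

inductive_set mat_span :: "'k::field mat set \<Rightarrow> 'k mat set" for S where
  base: "A \<in> S \<Longrightarrow> A \<in> mat_span S"
| add: "A \<in> mat_span S \<Longrightarrow> B \<in> mat_span S \<Longrightarrow> A + B \<in> mat_span S"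
| smult: "A \<in> mat_span S \<Longrightarrow> c \<cdot>\<^sub>m A \<in> mat_span S"

lemma mat_span_carrier:
  assumes "S \<subseteq> carrier_mat d d" "A \<in> mat_span S"
  shows "A \<in> carrier_mat d d"
  using assms(2,1) by induction auto

lemma mat_span_mult:
  assumes S: "S \<subseteq> carrier_mat d d" and mult: "\<And>A B. A \<in> S \<Longrightarrow> B \<in> S \<Longrightarrow> A * B \<in> S"
    and A: "A \<in> mat_span S" and B: "B \<in> mat_span S"
  shows "A * B \<in> mat_span S"
  using A
proof induction
  case A: (base A)
  show ?case using B
  proof induction
    case (base B)
    then show ?case using mult A by (blast intro: mat_span.base)
  next
    case (add B C)
    have "A * (B + C) = A * B + A * C"
      by (rule mult_add_distrib_mat[of _ d d _ d]) (use A S add mat_span_carrier[OF S] in auto)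
    then show ?case using add by (auto intro: mat_span.add)
  next
    case (smult B c)
    have "A * (c \<cdot>\<^sub>m B) = c \<cdot>\<^sub>m (A * B)"
      by (rule mult_smult_distrib[of _ d d _ d]) (use A S smult mat_span_carrier[OF S] in auto)
    then show ?case using smult by (auto intro: mat_span.smult)
  qed
next
  case (add A C)
  have "(A + C) * B = A * B + C * B"
    by (rule add_mult_distrib_mat[of _ d d _ _ d]) (use B add mat_span_carrier[OF S] in auto)
  then show ?case using add by (auto intro: mat_span.add)
next
  case (smult A c)
  have "(c \<cdot>\<^sub>m A) * B = c \<cdot>\<^sub>m (A * B)"
    by (rule mult_smult_assoc_mat[of _ d d _ d]) (use B smult mat_span_carrier[OF S] in auto)
  then show ?case using smult by (auto intro: mat_span.smult)
qed

lemma singular_factor: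
  fixes N :: "'k::field mat"
  assumes N: "N \<in> carrier_mat r r" and det: "det N = 0"
  obtains X Y where "X \<in> carrier_mat r (r - 1)" "Y \<in> carrier_mat (r - 1) r" "N = X * Y"
proof -
  obtain P Q s where P: "P \<in> carrier_mat r r" and Q: "Q \<in> carrier_mat r r"
    and PQ: "P * Q = 1\<^sub>m r" and QP: "Q * P = 1\<^sub>m r" and s: "s \<le> r"
    and zero: "\<forall>i j. s \<le> i \<longrightarrow> i < r \<longrightarrow> j < r \<longrightarrow> (P * N) $$ (i, j) = 0"
    and "\<forall>M M'. M \<in> carrier_mat r r \<longrightarrow> M' \<in> carrier_mat r r \<longrightarrow> M * N = N * M' \<longrightarrow>
       (\<forall>i j. s \<le> i \<longrightarrow> i < r \<longrightarrow> j < s \<longrightarrow> (P * M * Q) $$ (i, j) = 0)"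
    and "s = 0 \<longrightarrow> N = 0\<^sub>m r r"
    and full: "s = r \<longrightarrow> (\<exists>X. X \<in> carrier_mat r r \<and> N * X = 1\<^sub>m r)"
    by (rule image_block[OF N])
  have "s \<noteq> r"
  proof
    assume "s = r"
    then obtain X where X: "X \<in> carrier_mat r r" "N * X = 1\<^sub>m r" using full by blast
    then have "det N * det X = 1" using det_mult[OF N X(1)] by simp
    then show False using det by simp
  qed
  then have sr: "s \<le> r - 1" "r > 0" using s by auto
  define X where "X = mat r (r - 1) (\<lambda>(i, j). Q $$ (i, j))"
  define Y where "Y = mat (r - 1) r (\<lambda>(i, j). (P * N) $$ (i, j))"
  have PN: "P * N \<in> carrier_mat r r" using P N by simp
  have "N = Q * (P * N)" using P Q N QP by (simp add: assoc_mult_mat[of Q r r P r N r, symmetric])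
  also have "\<dots> = X * Y"
  proof (intro eq_matI)
    fix i j assume "i < dim_row (X * Y)" "j < dim_col (X * Y)"
    then have ij: "i < r" "j < r" by (auto simp: X_def Y_def)
    have "(Q * (P * N)) $$ (i, j) = (\<Sum>k = 0..<r. Q $$ (i, k) * (P * N) $$ (k, j))"
      by (rule index_mult_sum[OF Q PN ij])
    also have "\<dots> = (\<Sum>k = 0..<Suc (r - 1). Q $$ (i, k) * (P * N) $$ (k, j))" using sr by simp
    also have "\<dots> = (\<Sum>k = 0..<r - 1. Q $$ (i, k) * (P * N) $$ (k, j)) + Q $$ (i, r - 1) * (P * N) $$ (r - 1, j)"
      by (rule sum.atLeast0_lessThan_Suc)
    also have "(P * N) $$ (r - 1, j) = 0" using zero sr ij by (simp del: index_mult_mat)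
    also have "(\<Sum>k = 0..<r - 1. Q $$ (i, k) * (P * N) $$ (k, j)) + Q $$ (i, r - 1) * 0 =
        (\<Sum>k = 0..<r - 1. Q $$ (i, k) * (P * N) $$ (k, j))" by simp
    also have "\<dots> = (\<Sum>k = 0..<r - 1. X $$ (i, k) * Y $$ (k, j))"
      using ij by (intro sum.cong) (auto simp: X_def Y_def simp del: index_mult_mat)
    also have "\<dots> = (X * Y) $$ (i, j)"
      by (rule index_mult_sum[symmetric, of _ r]) (use ij in \<open>auto simp: X_def Y_def\<close>)
    finally show "(Q * (P * N)) $$ (i, j) = (X * Y) $$ (i, j)" .
  qed (use Q PN in \<open>auto simp: X_def Y_def\<close>)
  finally have "N = X * Y" .
  moreover have "X \<in> carrier_mat r (r - 1)" "Y \<in> carrier_mat (r - 1) r" by (simp_all add: X_def Y_def)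
  ultimately show thesis by (intro that)
qed

text \<open>A nonzero element \<open>T\<close> of the radical of the trace form factoring through the least possible dimension satisfies
  \<open>T A T = \<lambda> T\<close> for every \<open>A\<close>, so it yields an idempotent of rank one, whose trace is \<open>1\<close>.\<close>

lemma irreducible_trace_form:
  fixes E :: "'k::alg_closed_field mat set"
  assumes E: "E \<subseteq> carrier_mat d d" and one: "1\<^sub>m d \<in> E"
    and add: "\<And>A B. A \<in> E \<Longrightarrow> B \<in> E \<Longrightarrow> A + B \<in> E"
    and smult: "\<And>c A. A \<in> E \<Longrightarrow> c \<cdot>\<^sub>m A \<in> E"
    and mult: "\<And>A B. A \<in> E \<Longrightarrow> B \<in> E \<Longrightarrow> A * B \<in> E"
    and irr: "\<And>v w. v \<in> carrier_vec d \<Longrightarrow> v \<noteq> 0\<^sub>v d \<Longrightarrow> w \<in> carrier_vec d \<Longrightarrow> \<exists>A\<in>E. A *\<^sub>v v = w"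
    and T: "T \<in> E" and tr: "\<And>A. A \<in> E \<Longrightarrow> mtr (T * A) = 0"
  shows "T = 0\<^sub>m d d"
proof (rule ccontr)
  assume T0: "T \<noteq> 0\<^sub>m d d"
  define I where "I = {M \<in> E. \<forall>A\<in>E. mtr (M * A) = 0}"
  define fac where "fac r \<longleftrightarrow> (\<exists>X Y. X \<in> carrier_mat d r \<and> Y \<in> carrier_mat r d \<and> X * Y \<in> I \<and> X * Y \<noteq> 0\<^sub>m d d)" for r
  have "fac d" unfolding fac_def
    using T T0 tr E by (intro exI[of _ T] exI[of _ "1\<^sub>m d"]) (auto simp: I_def)
  define r where "r = (LEAST r. fac r)"
  have "fac r" unfolding r_def using \<open>fac d\<close> by (rule LeastI)
  have min: "\<not> fac s" if "s < r" for s using that not_less_Least unfolding r_def by blast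
  obtain X Y where X: "X \<in> carrier_mat d r" and Y: "Y \<in> carrier_mat r d"
    and XI: "X * Y \<in> I" and X0: "X * Y \<noteq> 0\<^sub>m d d"
    using \<open>fac r\<close> unfolding fac_def by blast
  define S where "S = X * Y"
  have S: "S \<in> carrier_mat d d" "S \<in> E" "S \<in> I" "S \<noteq> 0\<^sub>m d d" using X Y XI X0 by (auto simp: S_def I_def)
  have r0: "r > 0"
  proof (rule ccontr)
    assume "\<not> r > 0"
    then have "X * Y = 0\<^sub>m d d" using X Y by (intro eq_matI) (auto simp: scalar_prod_def)
    then show False using X0 by simp
  qed
  \<comment> \<open>For an eigenvalue \<open>q\<close> of \<open>Y * A * X\<close> the matrix
    \<open>Y * A * X - q\<close> factors through dimension \<open>r - 1\<close>, hence so does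
    \<open>S * A * S - q S\<close>. The latter is again in the radical, so it vanishes by minimality
    of \<open>r\<close>.\<close>
  have STS: "\<exists>q. S * A * S = q \<cdot>\<^sub>m S" if A: "A \<in> E" for A
  proof -
    have Ac: "A \<in> carrier_mat d d" using A E by auto
    define C where "C = Y * A * X"
    have C: "C \<in> carrier_mat r r" using X Y Ac by (simp add: C_def)
    have "degree (char_poly C) > 0" using degree_monic_char_poly[OF C] r0 by simp
    then obtain q where "poly (char_poly C) q = 0" using alg_closed_imp_poly_has_root by blast
    then have "det (char_matrix C q) = 0"
      using eigenvalue_root_char_poly[OF C] eigenvalue_det[OF C] by simp
    then obtain C1 C2 where C1: "C1 \<in> carrier_mat r (r - 1)" and C2: "C2 \<in> carrier_mat (r - 1) r"
      and CC: "char_matrix C q = C1 * C2"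
      using singular_factor[of "char_matrix C q" r] C by auto
    define S' where "S' = S * A * S + (- q) \<cdot>\<^sub>m S"
    have "S' = X * char_matrix C q * Y"
    proof -
      have CM: "char_matrix C q = C + (- q) \<cdot>\<^sub>m 1\<^sub>m r" using C by (simp add: char_matrix_def)
      have "X * char_matrix C q * Y = (X * C + (- q) \<cdot>\<^sub>m X) * Y"
        unfolding CM using X C by (simp add: mult_add_distrib_mat[of _ d r _ r] mult_smult_distrib[of _ d r _ r])
      also have "\<dots> = X * C * Y + (- q) \<cdot>\<^sub>m (X * Y)"
        using X Y C by (simp add: add_mult_distrib_mat[of _ d r _ _ d] mult_smult_assoc_mat[of _ d r _ d])
      also have "X * C * Y = S * A * S"
        unfolding C_def S_def using X Y Ac
        by (simp add: assoc_mult_mat[of _ d r _ r _ d] assoc_mult_mat[of _ r d _ r _ d] assoc_mult_mat[of _ d r _ d _ d]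
            assoc_mult_mat[of _ r d _ d _ d] assoc_mult_mat[of _ d d _ r _ d] assoc_mult_mat[of _ r d _ d _ r]
            assoc_mult_mat[of _ d r _ d _ r])
      finally show ?thesis by (simp add: S'_def S_def)
    qed
    then have fact: "S' = (X * C1) * (C2 * Y)"
      unfolding CC using X Y C1 C2
      by (simp add: assoc_mult_mat[of _ d r _ "r - 1" _ r] assoc_mult_mat[of _ d r _ r _ d]
          assoc_mult_mat[of _ d r _ "r - 1" _ d] assoc_mult_mat[of _ r "r - 1" _ r _ d])
    have SI: "S' \<in> I"
    proof -
      have "S' \<in> E" unfolding S'_def using S A by (intro add smult mult)
      moreover have "mtr (S' * B) = 0" if B: "B \<in> E" for B
      proof -
        have Bc: "B \<in> carrier_mat d d" using B E by auto
        have "S' * B = S * (A * S * B) + (- q) \<cdot>\<^sub>m (S * B)"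
          unfolding S'_def using S Ac Bc
          by (simp add: add_mult_distrib_mat[of _ d d _ _ d] mult_smult_assoc_mat[of _ d d _ d] assoc_mult_mat[of _ d d _ d _ d])
        then have "mtr (S' * B) = mtr (S * (A * S * B)) + (- q) * mtr (S * B)"
          using S Ac Bc by (simp add: mtr_add[of _ d] mtr_smult[of _ d])
        also have "\<dots> = 0" using S A B mult unfolding I_def by auto
        finally show ?thesis .
      qed
      ultimately show ?thesis by (simp add: I_def)
    qed
    have S'0: "S' = 0\<^sub>m d d"
    proof -
      have "X * C1 \<in> carrier_mat d (r - 1)" "C2 * Y \<in> carrier_mat (r - 1) d"
        using X Y C1 C2 by auto
      then show ?thesis using SI min[of "r - 1"] r0 unfolding fac_def fact by force
    qed
    have "S * A * S = q \<cdot>\<^sub>m S"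
    proof (intro eq_matI)
      fix i j assume "i < dim_row (q \<cdot>\<^sub>m S)" "j < dim_col (q \<cdot>\<^sub>m S)"
      then have ij: "i < d" "j < d" using S by auto
      have "S' $$ (i, j) = (S * A * S) $$ (i, j) - q * S $$ (i, j)"
        unfolding S'_def using ij S Ac by (simp del: index_mult_mat(1))
      then show "(S * A * S) $$ (i, j) = (q \<cdot>\<^sub>m S) $$ (i, j)"
        unfolding S'0 using ij S by (simp del: index_mult_mat(1))
    qed (use S Ac in auto)
    then show ?thesis by blast
  qed
  obtain x where x: "x \<in> carrier_vec d" "S *\<^sub>v x \<noteq> 0\<^sub>v d"
  proof -
    have "\<exists>i<d. \<exists>j<d. S $$ (i, j) \<noteq> 0"
    proof (rule ccontr)
      assume "\<not> ?thesis"
      then have "S = 0\<^sub>m d d" using S(1) by (intro eq_matI) auto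
      then show False using S(4) by simp
    qed
    then obtain i j where ij: "i < d" "j < d" "S $$ (i, j) \<noteq> 0" by blast
    have "(S *\<^sub>v unit_vec d j) $ i \<noteq> 0" using ij S by (simp add: scalar_prod_right_unit)
    then have "S *\<^sub>v unit_vec d j \<noteq> 0\<^sub>v d" using ij by auto
    then show thesis by (rule that[OF unit_vec_carrier])
  qed
  define y where "y = S *\<^sub>v x"
  have y: "y \<in> carrier_vec d" "y \<noteq> 0\<^sub>v d" using x S by (auto simp: y_def)
  obtain A where A: "A \<in> E" "A *\<^sub>v y = x" using irr[OF y x(1)] by blast
  have Ac: "A \<in> carrier_mat d d" using A E by auto
  \<comment> \<open>\<open>e\<close> fixes \<open>y\<close>, and by \<open>STS\<close> and
    transitivity every column of \<open>e\<close> is a multiple of \<open>y\<close>. Such a matrix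
    has trace 1, whereas \<open>S\<close> in the radical forces trace 0.\<close>
  define e where "e = S * A"
  have e: "e \<in> carrier_mat d d" using S Ac by (simp add: e_def)
  have ey: "e *\<^sub>v y = y" unfolding e_def using A Ac S y by (simp add: assoc_mult_mat_vec[of _ d d _ d] y_def)
  have "\<exists>q. e *\<^sub>v unit_vec d j = q \<cdot>\<^sub>v y" if j: "j < d" for j
  proof -
    obtain B where B: "B \<in> E" "B *\<^sub>v y = unit_vec d j" using irr[OF y, of "unit_vec d j"] by auto
    have Bc: "B \<in> carrier_mat d d" using B E by auto
    obtain q where q: "S * (A * B) * S = q \<cdot>\<^sub>m S" using STS mult A B by blast
    have "e *\<^sub>v unit_vec d j = (S * (A * B) * S) *\<^sub>v x"
      unfolding B(2)[symmetric] e_def y_def using S Ac Bc x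
      by (simp add: assoc_mult_mat_vec[of _ d d _ d] assoc_mult_mat[of _ d d _ d _ d])
    also have "\<dots> = q \<cdot>\<^sub>v y" unfolding q y_def using S x
      by (intro eq_vecI) (auto simp: scalar_prod_def sum_distrib_left mult.assoc)
    finally show ?thesis by blast
  qed
  then obtain q where q: "\<And>j. j < d \<Longrightarrow> e *\<^sub>v unit_vec d j = q j \<cdot>\<^sub>v y" by metis
  have eij: "e $$ (i, j) = q j * y $ i" if "i < d" "j < d" for i j
  proof -
    have "e $$ (i, j) = (e *\<^sub>v unit_vec d j) $ i" using e that by (simp add: scalar_prod_right_unit)
    also have "\<dots> = q j * y $ i" unfolding q[OF that(2)] using y that by simp
    finally show ?thesis .
  qed
  have "\<exists>i<d. y $ i \<noteq> 0"
  proof (rule ccontr)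
    assume "\<not> ?thesis"
    then have "y = 0\<^sub>v d" using y(1) by (intro eq_vecI) auto
    then show False using y(2) by simp
  qed
  then obtain i where i: "i < d" "y $ i \<noteq> 0" by blast
  have "y $ i = (\<Sum>j = 0..<d. e $$ (i, j) * y $ j)"
    using arg_cong[OF ey, of "\<lambda>v. v $ i"] e y i by (simp add: scalar_prod_def)
  also have "\<dots> = y $ i * mtr e"
    unfolding mtr_def sum_distrib_left using e i by (intro sum.cong) (auto simp: eij)
  finally have "mtr e = 1" using i by simp
  moreover have "mtr e = 0" unfolding e_def using S A by (auto simp: I_def)
  ultimately show False by simp
qed

lemma mult_unit_vec_index:
  fixes A :: "'k::semiring_1 mat"
  assumes "A \<in> carrier_mat n m" "i < n" "j < m"
  shows "(A *\<^sub>v unit_vec m j) $ i = A $$ (i, j)"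
  using assms by (simp add: scalar_prod_right_unit)

lemma conj_cancel:
  fixes P :: "'k::comm_ring_1 mat"
  assumes "P \<in> carrier_mat d d" "Q \<in> carrier_mat d d" "P * Q = 1\<^sub>m d" "Q * P = 1\<^sub>m d"
    "A \<in> carrier_mat d d" "B \<in> carrier_mat d d" "P * A * Q = P * B * Q"
  shows "A = B"
proof -
  have *: "Q * (P * X * Q) * P = X" if X: "X \<in> carrier_mat d d" for X
  proof -
    have "Q * (P * X * Q) * P = (Q * P) * X * (Q * P)"
      using assms(1,2) X by (simp add: assoc_mult_mat[of _ d d _ d _ d])
    then show ?thesis using X assms(4) by simp
  qed
  show ?thesis by (rule trans[OF *[OF assms(5), symmetric, unfolded assms(7)] *[OF assms(6)]])
qed

lemma (in group) mat_rep_kernel_subgroup: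
  assumes rep: "mat_rep G d \<rho>"
  shows "subgroup {x \<in> carrier G. \<rho> x = 1\<^sub>m d} G"
proof
  fix x assume x: "x \<in> {x \<in> carrier G. \<rho> x = 1\<^sub>m d}"
  then have "\<rho> (inv x) * 1\<^sub>m d = 1\<^sub>m d" using mat_rep_inv(2)[OF rep, of x] by simp
  then have "\<rho> (inv x) = 1\<^sub>m d" using mat_rep_carrier[OF rep, of "inv x"] x by simp
  then show "inv x \<in> {x \<in> carrier G. \<rho> x = 1\<^sub>m d}" using x by simp
qed (auto simp: mat_rep_mult[OF rep] mat_rep_one[OF rep])

lemma (in group) exp_of_derived_antimono:
  "m \<le> n \<Longrightarrow> (derived G ^^ n) (carrier G) \<subseteq> (derived G ^^ m) (carrier G)"
  using mono_exp_of_derived[OF exp_of_derived_in_carrier[OF subset_refl, of "n - m"], of m]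
    funpow_add[of m "n - m" "derived G"] by (simp add: o_def)

text \<open>Unipotent matrices all have trace \<open>d\<close>, so each \<open>\<rho> x - 1\<close>
  is in the radical of the trace form on the span of the image and vanishes if the span acts
  irreducibly. Otherwise an invariant subspace lowers the dimension, and matrices that are trivial
  on both blocks commute. The conclusion is a derived term in the kernel instead of a common
  triangular form, as solvability is what is wanted in the end.\<close>

lemma kolchin:
  fixes G (structure) and \<rho> :: "'g \<Rightarrow> 'k::alg_closed_field mat"
  assumes G: "group G"
    and "mat_rep G d \<rho>" "\<forall>x\<in>carrier G. \<forall>e. eigenvalue (\<rho> x) e \<longrightarrow> e = 1"
  shows "\<exists>n. \<forall>x\<in>(derived G ^^ n) (carrier G). \<rho> x = 1\<^sub>m d"
  using assms(2-)
proof (induction d arbitrary: \<rho> rule: less_induct)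
  case (less d)
  note rep = less.prems(1) and unip = less.prems(2)
  interpret group G by (rule G)
  define S where "S = \<rho> ` carrier G"
  have S: "S \<subseteq> carrier_mat d d" using mat_rep_carrier[OF rep] by (auto simp: S_def)
  have Smult: "A * B \<in> S" if "A \<in> S" "B \<in> S" for A B
    using that unfolding S_def by (auto simp: mat_rep_mult[OF rep, symmetric])
  let ?E = "mat_span S"
  have E: "?E \<subseteq> carrier_mat d d" using mat_span_carrier[OF S] by blast
  have Emult: "A * B \<in> ?E" if "A \<in> ?E" "B \<in> ?E" for A B
    using mat_span_mult[OF S Smult that] .
  have SE: "\<rho> x \<in> ?E" if "x \<in> carrier G" for x using that by (auto simp: S_def intro: mat_span.base)
  have one: "1\<^sub>m d \<in> ?E" using SE[OF one_closed] mat_rep_one[OF rep] by simp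
  have tr: "mtr (\<rho> x) = of_nat d" if x: "x \<in> carrier G" for x
  proof -
    note c = mat_rep_carrier[OF rep x]
    obtain es where es: "length es = d" "char_poly (\<rho> x) = (\<Prod>e\<leftarrow>es. [:- e, 1:])"
      "det (\<rho> x) = prod_list es" "mtr (\<rho> x) = sum_list es"
      "\<forall>c. char_poly (c \<cdot>\<^sub>m \<rho> x) = (\<Prod>e\<leftarrow>es. [:- (c * e), 1:])"
      by (rule eigenvalue_list[OF c])
    have "e = 1" if "e \<in> set es" for e
    proof -
      have "poly (char_poly (\<rho> x)) e = 0"
        unfolding es(2) using that by (induction es) auto
      then show ?thesis using eigenvalue_root_char_poly[OF c] unip x by blast
    qed
    then have "es = replicate d 1" using es(1) by (metis replicate_eqI)
    then show ?thesis using es(4) by (simp add: sum_list_replicate)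
  qed
  show ?case
  \<comment> \<open>Transitivity on nonzero vectors stands for irreducibility. If it fails for
    \<open>y\<close> and \<open>z\<close>, the orbit of \<open>y\<close> under the span is an
    invariant subspace that contains \<open>y\<close> and misses \<open>z\<close>.\<close>
  proof (cases "\<forall>v\<in>carrier_vec d. v \<noteq> 0\<^sub>v d \<longrightarrow> (\<forall>w\<in>carrier_vec d. \<exists>A\<in>?E. A *\<^sub>v v = w)")
    case True
    have "\<rho> x = 1\<^sub>m d" if x: "x \<in> carrier G" for x
    proof -
      note c = mat_rep_carrier[OF rep x]
      let ?T = "\<rho> x + (- 1) \<cdot>\<^sub>m 1\<^sub>m d"
      have T: "?T \<in> ?E" using SE[OF x] one by (intro mat_span.add mat_span.smult)
      have Tc: "?T \<in> carrier_mat d d" using T E by blast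
      have "mtr (?T * A) = 0" if "A \<in> ?E" for A
        using that
      proof induction
        case (base A)
        then obtain z where z: "z \<in> carrier G" "A = \<rho> z" by (auto simp: S_def)
        note cz = mat_rep_carrier[OF rep z(1)]
        have "?T * A = \<rho> (x \<otimes> z) + (- 1) \<cdot>\<^sub>m \<rho> z"
          unfolding z(2) mat_rep_mult[OF rep x z(1)] using c cz
          by (simp add: add_mult_distrib_mat[of _ d d _ _ d] mult_smult_assoc_mat[of _ d d _ d])
        then show ?case
          using tr[OF m_closed[OF x z(1)]] tr[OF z(1)] mat_rep_carrier[OF rep m_closed[OF x z(1)]] cz
          by (simp add: mtr_add[of _ d] mtr_smult[of _ d])
      next
        case (add A B)
        have AB: "A \<in> carrier_mat d d" "B \<in> carrier_mat d d" using add E by auto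
        have "?T * (A + B) = ?T * A + ?T * B"
          by (rule mult_add_distrib_mat[of _ d d _ d]) (use T E AB in auto)
        then show ?case
          using add mtr_add[OF mult_carrier_mat[OF Tc AB(1)] mult_carrier_mat[OF Tc AB(2)]] by simp
      next
        case (smult A a)
        have A: "A \<in> carrier_mat d d" using smult E by auto
        have "?T * (a \<cdot>\<^sub>m A) = a \<cdot>\<^sub>m (?T * A)"
          by (rule mult_smult_distrib[of _ d d _ d]) (use T E A in auto)
        then show ?case using smult mtr_smult[OF mult_carrier_mat[OF Tc A]] by simp
      qed
      then have T0: "?T = 0\<^sub>m d d"
        using irreducible_trace_form[OF E one mat_span.add mat_span.smult Emult _ T] True by blast
      show ?thesis
      proof (intro eq_matI)
        fix i j assume "i < dim_row (1\<^sub>m d :: 'k mat)" "j < dim_col (1\<^sub>m d :: 'k mat)"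
        then have ij: "i < d" "j < d" by auto
        have "?T $$ (i, j) = \<rho> x $$ (i, j) - 1\<^sub>m d $$ (i, j)" using ij c by simp
        then show "\<rho> x $$ (i, j) = 1\<^sub>m d $$ (i, j)" unfolding T0 using ij by simp
      qed (use c in auto)
    qed
    then show ?thesis by (intro exI[of _ 0]) simp
  next
    case False
    then obtain y z where y: "y \<in> carrier_vec d" "y \<noteq> 0\<^sub>v d"
      and z: "z \<in> carrier_vec d" "\<forall>A\<in>?E. A *\<^sub>v y \<noteq> z" by blast
    define W where "W = {A *\<^sub>v y |A. A \<in> ?E}"
    have W: "W \<subseteq> carrier_vec d" using E y by (auto simp: W_def)
    have W0: "0\<^sub>v d \<in> W"
      using mat_span.smult[OF one, of 0] y unfolding W_def
      by (intro CollectI exI[of _ "0 \<cdot>\<^sub>m 1\<^sub>m d"]) (auto intro!: eq_vecI simp: scalar_prod_def)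
    have Wadd: "v + w \<in> W" if vw: "v \<in> W" "w \<in> W" for v w
    proof -
      obtain A B where AB: "A \<in> ?E" "B \<in> ?E" "v = A *\<^sub>v y" "w = B *\<^sub>v y" using vw by (auto simp: W_def)
      have "v + w = (A + B) *\<^sub>v y" unfolding AB
        by (rule add_mult_distrib_mat_vec[symmetric, of _ d d]) (use AB E y in auto)
      then show ?thesis using AB unfolding W_def by (blast intro: mat_span.add)
    qed
    have Wsmult: "a \<cdot>\<^sub>v v \<in> W" if v: "v \<in> W" for a v
    proof -
      obtain A where A: "A \<in> ?E" "v = A *\<^sub>v y" using v by (auto simp: W_def)
      have "A \<in> carrier_mat d d" using A E by auto
      then have "a \<cdot>\<^sub>v v = (a \<cdot>\<^sub>m A) *\<^sub>v y" unfolding A using y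
        by (intro eq_vecI) (auto simp: scalar_prod_def sum_distrib_left mult.assoc)
      then show ?thesis using A unfolding W_def by (blast intro: mat_span.smult)
    qed
    obtain c N where N: "N \<in> carrier_mat d c" and WN: "W = {N *\<^sub>v u |u. u \<in> carrier_vec c}"
      by (rule subspace_range[OF W W0 Wadd Wsmult])
    obtain P Q r where P: "P \<in> carrier_mat d d" and Q: "Q \<in> carrier_mat d d"
      and PQ: "P * Q = 1\<^sub>m d" and QP: "Q * P = 1\<^sub>m d" and rd: "r \<le> d"
      and "\<forall>i j. r \<le> i \<longrightarrow> i < d \<longrightarrow> j < c \<longrightarrow> (P * N) $$ (i, j) = 0"
      and block: "\<forall>M M'. M \<in> carrier_mat d d \<longrightarrow> M' \<in> carrier_mat c c \<longrightarrow> M * N = N * M' \<longrightarrow>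
         (\<forall>i j. r \<le> i \<longrightarrow> i < d \<longrightarrow> j < r \<longrightarrow> (P * M * Q) $$ (i, j) = 0)"
      and rnull: "r = 0 \<longrightarrow> N = 0\<^sub>m d c"
      and rfull: "r = d \<longrightarrow> (\<exists>X. X \<in> carrier_mat c d \<and> N * X = 1\<^sub>m d)"
      by (rule image_block[OF N])
    have "y \<in> W" using one y unfolding W_def by (intro CollectI exI[of _ "1\<^sub>m d"]) auto
    then obtain u where u: "u \<in> carrier_vec c" "y = N *\<^sub>v u" unfolding WN by blast
    have "r \<noteq> 0"
    proof
      assume "r = 0"
      then have "y = 0\<^sub>v d" using rnull u by (auto intro!: eq_vecI simp: scalar_prod_def)
      then show False using y by simp
    qed
    have "r \<noteq> d"
    proof
      assume "r = d"
      then obtain X where X: "X \<in> carrier_mat c d" "N * X = 1\<^sub>m d" using rfull by blast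
      have "z = N *\<^sub>v (X *\<^sub>v z)"
        using assoc_mult_mat_vec[OF N X(1) z(1)] X z by simp
      then have "z \<in> W" unfolding WN using X z by auto
      then show False using z(2) by (auto simp: W_def)
    qed
    have r: "r < d" "d - r < d" using \<open>r \<noteq> 0\<close> \<open>r \<noteq> d\<close> rd by auto
    have "\<exists>M'. M' \<in> carrier_mat c c \<and> \<rho> x * N = N * M'" if x: "x \<in> carrier G" for x
    proof -
      note cx = mat_rep_carrier[OF rep x]
      have "\<exists>u. u \<in> carrier_vec c \<and> (\<rho> x * N) *\<^sub>v unit_vec c j = N *\<^sub>v u" if j: "j < c" for j
      proof -
        have "N *\<^sub>v unit_vec c j \<in> W" unfolding WN by auto
        then obtain A where A: "A \<in> ?E" "N *\<^sub>v unit_vec c j = A *\<^sub>v y" by (auto simp: W_def)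
        have Ac: "A \<in> carrier_mat d d" using A E by auto
        have "(\<rho> x * N) *\<^sub>v unit_vec c j = (\<rho> x * A) *\<^sub>v y"
          using cx N A Ac y by (simp add: assoc_mult_mat_vec[of _ d d _ c] assoc_mult_mat_vec[of _ d d _ d])
        also have "\<dots> \<in> W" unfolding W_def using Emult[OF SE[OF x] A(1)] by blast
        finally show ?thesis unfolding WN by blast
      qed
      then obtain f where f: "\<And>j. j < c \<Longrightarrow> f j \<in> carrier_vec c"
        "\<And>j. j < c \<Longrightarrow> (\<rho> x * N) *\<^sub>v unit_vec c j = N *\<^sub>v f j" by metis
      define M' where "M' = mat c c (\<lambda>(i, j). f j $ i)"
      have "\<rho> x * N = N * M'"
      proof (intro eq_matI)
        fix i j assume "i < dim_row (N * M')" "j < dim_col (N * M')"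
        then have ij: "i < d" "j < c" using N by (auto simp: M'_def)
        have xN: "\<rho> x * N \<in> carrier_mat d c" using cx N by simp
        have "(\<rho> x * N) $$ (i, j) = ((\<rho> x * N) *\<^sub>v unit_vec c j) $ i"
          by (rule mult_unit_vec_index[OF xN ij, symmetric])
        also have "\<dots> = (N *\<^sub>v f j) $ i" using f(2)[OF ij(2)] by simp
        also have "\<dots> = (N * M') $$ (i, j)"
          using N ij f(1)[OF ij(2)] by (simp add: M'_def scalar_prod_def)
        finally show "(\<rho> x * N) $$ (i, j) = (N * M') $$ (i, j)" .
      qed (use cx N in \<open>auto simp: M'_def\<close>)
      then show ?thesis by (intro exI[of _ M']) (simp add: M'_def)
    qed
    then have "\<forall>x\<in>carrier G. \<forall>i j. r \<le> i \<longrightarrow> i < d \<longrightarrow> j < r \<longrightarrow> (P * \<rho> x * Q) $$ (i, j) = 0"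
      using block mat_rep_carrier[OF rep] by blast
    then obtain \<rho>\<^sub>1 \<beta> \<rho>\<^sub>2 where rep1: "mat_rep G r \<rho>\<^sub>1" and rep2: "mat_rep G (d - r) \<rho>\<^sub>2"
      and \<beta>: "\<forall>x\<in>carrier G. \<beta> x \<in> carrier_mat r (d - r)"
      and \<rho>blk: "\<forall>x\<in>carrier G. P * \<rho> x * Q = four_block_mat (\<rho>\<^sub>1 x) (\<beta> x) (0\<^sub>m (d - r) r) (\<rho>\<^sub>2 x)"
      by (rule mat_rep_block[OF G rep P Q PQ QP rd])
    have cp: "char_poly (\<rho> x) = char_poly (\<rho>\<^sub>1 x) * char_poly (\<rho>\<^sub>2 x)" if x: "x \<in> carrier G" for x
      unfolding char_poly_similar[OF conj_similar[OF P Q PQ QP mat_rep_carrier[OF rep x]]] \<rho>blk[rule_format, OF x]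
      by (rule char_poly_upper_block[OF mat_rep_carrier[OF rep1 x] \<beta>[rule_format, OF x] mat_rep_carrier[OF rep2 x]])
    have unip1: "\<forall>x\<in>carrier G. \<forall>e. eigenvalue (\<rho>\<^sub>1 x) e \<longrightarrow> e = 1"
      and unip2: "\<forall>x\<in>carrier G. \<forall>e. eigenvalue (\<rho>\<^sub>2 x) e \<longrightarrow> e = 1"
      using unip cp eigenvalue_root_char_poly[OF mat_rep_carrier[OF rep]]
        eigenvalue_root_char_poly[OF mat_rep_carrier[OF rep1]]
        eigenvalue_root_char_poly[OF mat_rep_carrier[OF rep2]] by (simp_all)
    obtain n1 n2 where n1: "\<forall>x\<in>(derived G ^^ n1) (carrier G). \<rho>\<^sub>1 x = 1\<^sub>m r"
      and n2: "\<forall>x\<in>(derived G ^^ n2) (carrier G). \<rho>\<^sub>2 x = 1\<^sub>m (d - r)"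
      using less.IH[OF r(1) rep1 unip1] less.IH[OF r(2) rep2 unip2] by blast
    define n where "n = n1 + n2"
    let ?H = "(derived G ^^ n) (carrier G)"
    have HG: "?H \<subseteq> carrier G" by (rule exp_of_derived_in_carrier[OF subset_refl])
    have H12: "\<rho>\<^sub>1 x = 1\<^sub>m r" "\<rho>\<^sub>2 x = 1\<^sub>m (d - r)" if "x \<in> ?H" for x
      using that n1 n2 exp_of_derived_antimono[of n1 n] exp_of_derived_antimono[of n2 n]
      unfolding n_def by auto
    \<comment> \<open>With identity blocks on the diagonal, a product only adds the corners
      \<open>\<beta>\<close>, so these matrices commute and one more derived step kills
      \<open>\<rho>\<close>.\<close>
    have comm: "\<rho> (x \<otimes> y) = \<rho> (y \<otimes> x)" if xy: "x \<in> ?H" "y \<in> ?H" for x y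
    proof -
      have xyG: "x \<in> carrier G" "y \<in> carrier G" using xy HG by auto
      note cx = mat_rep_carrier[OF rep xyG(1)] and cy = mat_rep_carrier[OF rep xyG(2)]
      have *: "P * (\<rho> x * \<rho> y) * Q = four_block_mat (1\<^sub>m r) (\<beta> y + \<beta> x) (0\<^sub>m (d - r) r) (1\<^sub>m (d - r))"
        if xy: "x \<in> ?H" "y \<in> ?H" and xyG: "x \<in> carrier G" "y \<in> carrier G" for x y
        unfolding conj_mult[OF P Q QP mat_rep_carrier[OF rep xyG(1)] mat_rep_carrier[OF rep xyG(2)], symmetric]
          \<rho>blk[rule_format, OF xyG(1)] \<rho>blk[rule_format, OF xyG(2)] H12[OF xy(1)] H12[OF xy(2)]
        using mult_upper_block[OF one_carrier_mat \<beta>[rule_format, OF xyG(1)] one_carrier_mat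
            one_carrier_mat \<beta>[rule_format, OF xyG(2)] one_carrier_mat]
          left_mult_one_mat[OF \<beta>[rule_format, OF xyG(2)]] right_mult_one_mat[OF \<beta>[rule_format, OF xyG(1)]]
        by simp
      have "P * (\<rho> x * \<rho> y) * Q = P * (\<rho> y * \<rho> x) * Q"
        unfolding *[OF xy xyG] *[OF xy(2,1) xyG(2,1)]
        comm_add_mat[OF \<beta>[rule_format, OF xyG(1)] \<beta>[rule_format, OF xyG(2)]] ..
      then have "\<rho> x * \<rho> y = \<rho> y * \<rho> x"
        using conj_cancel[OF P Q PQ QP] cx cy by simp
      then show ?thesis using mat_rep_mult[OF rep] xyG by simp
    qed
    have "derived_set G ?H \<subseteq> {x \<in> carrier G. \<rho> x = 1\<^sub>m d}"
    proof clarify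
      fix x y assume xy: "x \<in> ?H" "y \<in> ?H"
      then have xyG: "x \<in> carrier G" "y \<in> carrier G" using HG by auto
      have "x \<otimes> y \<otimes> inv x \<otimes> inv y = (x \<otimes> y) \<otimes> inv (y \<otimes> x)"
        using xyG by (simp add: inv_mult_group m_assoc)
      then have "\<rho> (x \<otimes> y \<otimes> inv x \<otimes> inv y) = \<rho> (y \<otimes> x) * \<rho> (inv (y \<otimes> x))"
        using xyG comm[OF xy] mat_rep_mult[OF rep, of "x \<otimes> y" "inv (y \<otimes> x)"] by simp
      also have "\<dots> = 1\<^sub>m d" by (rule mat_rep_inv(1)[OF rep]) (use xyG in simp)
      finally show "x \<otimes> y \<otimes> inv x \<otimes> inv y \<in> carrier G \<and>
        \<rho> (x \<otimes> y \<otimes> inv x \<otimes> inv y) = 1\<^sub>m d" using xyG by simp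
    qed
    then have "derived G ?H \<subseteq> {x \<in> carrier G. \<rho> x = 1\<^sub>m d}"
      unfolding derived_def using mat_rep_kernel_subgroup[OF rep] by (rule generate_subgroup_incl)
    then show ?thesis by (intro exI[of _ "Suc n"]) auto
  qed
qed

section \<open>Finitely many characteristic polynomials\<close>

inductive_set fspan :: "('x \<Rightarrow> 'k::field) set \<Rightarrow> ('x \<Rightarrow> 'k) set" for B where
  zero: "(\<lambda>_. 0) \<in> fspan B"
| base: "b \<in> B \<Longrightarrow> b \<in> fspan B"
| add: "f \<in> fspan B \<Longrightarrow> g \<in> fspan B \<Longrightarrow> (\<lambda>x. f x + g x) \<in> fspan B"
| smult: "f \<in> fspan B \<Longrightarrow> (\<lambda>x. c * f x) \<in> fspan B"

lemma fspan_mono: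
  assumes "B \<subseteq> C" "f \<in> fspan B"
  shows "f \<in> fspan C"
  using assms(2) by induction (use assms(1) in \<open>auto intro: fspan.intros\<close>)

lemma fspan_diff: "f \<in> fspan B \<Longrightarrow> g \<in> fspan B \<Longrightarrow> (\<lambda>x. f x - g x) \<in> fspan B"
  using fspan.add[OF _ fspan.smult[of g B "- 1"], of f] by simp

lemma fspan_insertE:
  assumes "f \<in> fspan (insert b B)"
  shows "\<exists>a g. g \<in> fspan B \<and> f = (\<lambda>x. a * b x + g x)"
  using assms
proof induction
  case zero
  then show ?case by (intro exI[of _ 0] exI[of _ "\<lambda>_. 0"]) (auto intro: fspan.zero)
next
  case (base f)
  then consider "f = b" | "f \<in> B" by blast
  then show ?case
  proof cases
    case 1
    then show ?thesis by (intro exI[of _ 1] exI[of _ "\<lambda>_. 0"]) (auto intro: fspan.zero)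
  next
    case 2
    then show ?thesis by (intro exI[of _ 0] exI[of _ f]) (auto intro: fspan.base)
  qed
next
  case (add f1 f2)
  then obtain a1 g1 a2 g2 where "g1 \<in> fspan B" "f1 = (\<lambda>x. a1 * b x + g1 x)"
    "g2 \<in> fspan B" "f2 = (\<lambda>x. a2 * b x + g2 x)" by blast
  then show ?case
    by (intro exI[of _ "a1 + a2"] exI[of _ "\<lambda>x. g1 x + g2 x"]) (auto intro: fspan.add simp: algebra_simps)
next
  case (smult f c)
  then obtain a g where "g \<in> fspan B" "f = (\<lambda>x. a * b x + g x)" by blast
  then show ?case
    by (intro exI[of _ "c * a"] exI[of _ "\<lambda>x. c * g x"]) (auto intro: fspan.smult simp: algebra_simps)
qed

text \<open>A new generator \<open>b\<close> costs at most one further point. Such a point is needed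
  only if some \<open>b + h\<close>, with \<open>h\<close> in the old span, vanishes on
  \<open>Y\<close> without vanishing on \<open>X\<close>, and then a point \<open>z\<close> where it
  is nonzero is enough.\<close>

lemma fspan_determined:
  assumes "finite B"
  shows "\<exists>Y. finite Y \<and> Y \<subseteq> X \<and> (\<forall>f\<in>fspan B. (\<forall>x\<in>Y. f x = 0) \<longrightarrow> (\<forall>x\<in>X. f x = 0))"
  using assms
proof (induction B)
  case empty
  have "f = (\<lambda>_. 0)" if "f \<in> fspan {}" for f :: "'a \<Rightarrow> 'b"
    using that by induction auto
  then show ?case by (intro exI[of _ "{}"]) auto
next
  case (insert b B)
  then obtain Y where Y: "finite Y" "Y \<subseteq> X"
    and det: "\<And>f. f \<in> fspan B \<Longrightarrow> \<forall>x\<in>Y. f x = 0 \<Longrightarrow> \<forall>x\<in>X. f x = 0" by blast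
  show ?case
  proof (cases "\<forall>g\<in>fspan B. (\<forall>x\<in>Y. b x + g x = 0) \<longrightarrow> (\<forall>x\<in>X. b x + g x = 0)")
    case True
    have "\<forall>x\<in>X. f x = 0" if f: "f \<in> fspan (insert b B)" "\<forall>x\<in>Y. f x = 0" for f
    proof -
      obtain a g where g: "g \<in> fspan B" "f = (\<lambda>x. a * b x + g x)" using fspan_insertE[OF f(1)] by blast
      show ?thesis
      proof (cases "a = 0")
        case True
        then have fg: "f x = g x" for x unfolding g(2) by simp
        show ?thesis using det[OF g(1)] f(2) unfolding fg by blast
      next
        case False
        have e: "f x = a * (b x + inverse a * g x)" for x unfolding g(2) using False by (simp add: field_simps)
        then have "\<forall>x\<in>Y. b x + inverse a * g x = 0" using f(2) False by auto
        then have "\<forall>x\<in>X. b x + inverse a * g x = 0" using bspec[OF True fspan.smult[OF g(1), of "inverse a"]] by blast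
        then show ?thesis unfolding e by simp
      qed
    qed
    then show ?thesis using Y by blast
  next
    case False
    then obtain h z where h: "h \<in> fspan B" "\<forall>x\<in>Y. b x + h x = 0" "z \<in> X" "b z + h z \<noteq> 0" by blast
    have "\<forall>x\<in>X. f x = 0" if f: "f \<in> fspan (insert b B)" "\<forall>x\<in>insert z Y. f x = 0" for f
    proof -
      obtain a g where g: "g \<in> fspan B" "f = (\<lambda>x. a * b x + g x)" using fspan_insertE[OF f(1)] by blast
      have mem: "(\<lambda>x. g x - a * h x) \<in> fspan B" by (intro fspan_diff fspan.smult g h)
      have d: "g x - a * h x = f x - a * (b x + h x)" for x unfolding g(2) by (simp add: algebra_simps)
      have "\<forall>x\<in>Y. g x - a * h x = 0" unfolding d using f(2) h(2) by simp
      then have *: "\<forall>x\<in>X. g x - a * h x = 0" by (rule det[OF mem])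
      then have "a * (b z + h z) = 0" using d[of z] f h(3) by simp
      then have "a = 0" using h(4) by simp
      then show ?thesis using * g by simp
    qed
    then have "\<forall>f\<in>fspan (insert b B). (\<forall>x\<in>insert z Y. f x = 0) \<longrightarrow> (\<forall>x\<in>X. f x = 0)" by blast
    moreover have "finite (insert z Y)" "insert z Y \<subseteq> X" using Y h(3) by simp_all
    ultimately show ?thesis by blast
  qed
qed

text \<open>Separation of variables: all \<open>F i\<close> lie in one finite-dimensional space of
  functions of \<open>x\<close>. The closure rules below recognize this for polynomial expressions
  in functions of \<open>i\<close> alone and functions of \<open>x\<close> alone.\<close>

definition fin_spanned :: "'i set \<Rightarrow> ('i \<Rightarrow> 'x \<Rightarrow> 'k::field) \<Rightarrow> bool" where
  "fin_spanned I F \<longleftrightarrow> (\<exists>B. finite B \<and> (\<forall>i\<in>I. F i \<in> fspan B))"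

lemma fin_spanned_const: "fin_spanned I (\<lambda>i x. c i)"
proof -
  have "(\<lambda>x. c i) \<in> fspan {\<lambda>_. 1}" for i
    using fspan.smult[OF fspan.base[of "\<lambda>_. 1" "{\<lambda>_. 1}"], of "c i"] by simp
  then show ?thesis unfolding fin_spanned_def by (intro exI[of _ "{\<lambda>_. 1}"]) auto
qed

lemma fin_spanned_fixed: "fin_spanned I (\<lambda>i. f)"
  unfolding fin_spanned_def by (intro exI[of _ "{f}"]) (auto intro: fspan.base)

lemma fin_spanned_add:
  assumes "fin_spanned I F" "fin_spanned I G"
  shows "fin_spanned I (\<lambda>i x. F i x + G i x)"
proof -
  obtain B C where "finite B" "\<forall>i\<in>I. F i \<in> fspan B" "finite C" "\<forall>i\<in>I. G i \<in> fspan C"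
    using assms unfolding fin_spanned_def by blast
  then show ?thesis unfolding fin_spanned_def
    by (intro exI[of _ "B \<union> C"]) (auto intro!: fspan.add intro: fspan_mono[of B "B \<union> C"] fspan_mono[of C "B \<union> C"])
qed

lemma fin_spanned_mult:
  assumes "fin_spanned I F" "fin_spanned I G"
  shows "fin_spanned I (\<lambda>i x. F i x * G i x)"
proof -
  obtain B C where B: "finite B" "\<forall>i\<in>I. F i \<in> fspan B" and C: "finite C" "\<forall>i\<in>I. G i \<in> fspan C"
    using assms unfolding fin_spanned_def by blast
  define D where "D = (\<lambda>(b, c) x. b x * c x) ` (B \<times> C)"
  have "(\<lambda>x. f x * g x) \<in> fspan D" if f: "f \<in> fspan B" and g: "g \<in> fspan C" for f g
    using f
  proof induction
    case (base b)
    show ?case using g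
    proof induction
      case (base c)
      then show ?case using \<open>b \<in> B\<close> by (intro fspan.base) (force simp: D_def)
    next
      case (add f g)
      then show ?case using fspan.add[OF add.IH] by (simp add: algebra_simps)
    next
      case (smult f a)
      then show ?case using fspan.smult[OF smult.IH, of a] by (simp add: algebra_simps)
    qed (auto intro: fspan.zero)
  next
    case (add f g)
    then show ?case using fspan.add[OF add.IH] by (simp add: algebra_simps)
  next
    case (smult f a)
    then show ?case using fspan.smult[OF smult.IH, of a] by (simp add: algebra_simps)
  qed (auto intro: fspan.zero)
  moreover have "finite D" using B C by (simp add: D_def)
  ultimately show ?thesis unfolding fin_spanned_def using B C by blast
qed

lemma fin_spanned_sum:
  assumes "finite A" "\<And>a. a \<in> A \<Longrightarrow> fin_spanned I (F a)"
  shows "fin_spanned I (\<lambda>i x. \<Sum>a\<in>A. F a i x)"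
  using assms
proof (induction A)
  case empty
  show ?case using fin_spanned_const[of I "\<lambda>_. 0"] by simp
next
  case (insert a A)
  then show ?case using fin_spanned_add[of I "F a" "\<lambda>i x. \<Sum>a\<in>A. F a i x"] by simp
qed

lemma fin_spanned_prod:
  assumes "finite A" "\<And>a. a \<in> A \<Longrightarrow> fin_spanned I (F a)"
  shows "fin_spanned I (\<lambda>i x. \<Prod>a\<in>A. F a i x)"
  using assms
proof (induction A)
  case empty
  show ?case using fin_spanned_const[of I "\<lambda>_. 1"] by simp
next
  case (insert a A)
  then show ?case using fin_spanned_mult[of I "F a" "\<lambda>i x. \<Prod>a\<in>A. F a i x"] by simp
qed

text \<open>Members of the family are determined on \<open>X\<close> by their values at finitely
  many points, and there the values range over a finite product of the sets
  \<open>V x\<close>.\<close>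

lemma fin_spanned_finite_image:
  fixes F :: "'i \<Rightarrow> 'x \<Rightarrow> 'k::field"
  assumes F: "fin_spanned I F" and V: "\<And>x. x \<in> X \<Longrightarrow> finite (V x)"
    and FV: "\<And>i x. i \<in> I \<Longrightarrow> x \<in> X \<Longrightarrow> F i x \<in> V x"
  shows "finite ((\<lambda>i. restrict (F i) X) ` I)"
proof -
  obtain B where B: "finite B" "\<forall>i\<in>I. F i \<in> fspan B" using F unfolding fin_spanned_def by blast
  obtain Y where Y: "finite Y" "Y \<subseteq> X"
    and det: "\<And>f. f \<in> fspan B \<Longrightarrow> \<forall>x\<in>Y. f x = 0 \<Longrightarrow> \<forall>x\<in>X. f x = 0"
    using fspan_determined[OF B(1)] by metis
  let ?S = "(\<lambda>i. restrict (F i) X) ` I"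
  have "inj_on (\<lambda>f. restrict f Y) ?S"
  proof (rule inj_onI, clarify)
    fix i j assume ij: "i \<in> I" "j \<in> I" and eq: "restrict (restrict (F i) X) Y = restrict (restrict (F j) X) Y"
    have "F i x = F j x" if "x \<in> Y" for x using fun_cong[OF eq, of x] that Y by auto
    then have "\<forall>x\<in>X. F i x - F j x = 0"
      using det[OF fspan_diff[of "F i" B "F j"]] B ij by auto
    then show "restrict (F i) X = restrict (F j) X" by (auto simp: restrict_def)
  qed
  moreover have "(\<lambda>f. restrict f Y) ` ?S \<subseteq> PiE Y V" using FV Y by (auto simp: subset_iff)
  then have "finite ((\<lambda>f. restrict f Y) ` ?S)"
    using finite_PiE[OF Y(1), of V] V Y finite_subset by blast
  ultimately show ?thesis by (rule finite_imageD[rotated])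
qed

lemma finite_image_factor:
  assumes "finite (f ` A)" "\<And>a b. a \<in> A \<Longrightarrow> b \<in> A \<Longrightarrow> f a = f b \<Longrightarrow> g a = g b"
  shows "finite (g ` A)"
proof -
  have "g a = g (inv_into A f (f a))" if "a \<in> A" for a
  proof (rule assms(2)[OF that])
    show "inv_into A f (f a) \<in> A" "f a = f (inv_into A f (f a))"
      using that by (simp_all add: inv_into_into f_inv_into_f)
  qed
  then have "g ` A \<subseteq> (\<lambda>v. g (inv_into A f v)) ` (f ` A)" by blast
  then show ?thesis using assms(1) finite_surj by blast
qed

lemma (in group) exp_of_derived_consistent:
  assumes "subgroup U G"
  shows "(derived (G\<lparr>carrier := U\<rparr>) ^^ n) U = (derived G ^^ n) U"
proof (induction n)
  case (Suc n)
  have "(derived G ^^ n) U \<subseteq> U"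
  proof (induction n)
    case (Suc n)
    then show ?case using derived_incl[OF _ assms] by simp
  qed simp
  then show ?case using Suc derived_consistent[OF _ assms] by simp
qed simp

text \<open>The characteristic polynomial of \<open>\<rho> (g \<otimes> h)\<close> plays the role of
  a trace form on the derived group. \<open>L\<close> preserves it when conjugating the first
  argument, and \<open>U\<close> is its radical. Taking \<open>h\<close> trivial shows that
  \<open>U\<close> is unipotent. Whole characteristic polynomials are used because traces do not
  determine eigenvalues in positive characteristic.\<close>

lemma rep_virtually_solvable:
  fixes G (structure) and \<rho> :: "'g \<Rightarrow> 'k::alg_closed_field mat"
  assumes G: "group G" and rep: "mat_rep G d \<rho>" and N: "N > 0"
    and tors: "\<forall>g \<in> derived G (carrier G). \<exists>es. length es = d \<and> (\<forall>e\<in>set es. e ^ N = 1) \<and>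
      char_poly (\<rho> g) = (\<Prod>e\<leftarrow>es. [:- e, 1:])"
  shows "\<exists>L n. subgroup L G \<and> finite (rcosets L) \<and> (\<forall>x\<in>(derived G ^^ n) L. \<rho> x = 1\<^sub>m d)"
proof -
  interpret group G by (rule G)
  define \<Gamma> where "\<Gamma> = derived G (carrier G)"
  define \<phi> where "\<phi> m x = poly (char_poly (\<rho> m)) x" for m x
  interpret \<Gamma>: normal \<Gamma> G unfolding \<Gamma>_def by (rule derived_self_is_normal)
  have \<Gamma>G: "g \<in> carrier G" if "g \<in> \<Gamma>" for g using that \<Gamma>.subset by blast
  have \<Gamma>conj: "l \<otimes> g \<otimes> inv l \<in> \<Gamma>" "inv l \<otimes> g \<otimes> l \<in> \<Gamma>" if "l \<in> carrier G" "g \<in> \<Gamma>" for l g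
    using \<Gamma>.inv_op_closed1[OF that] \<Gamma>.inv_op_closed2[OF that] by auto
  have cyc: "\<phi> (x \<otimes> y) = \<phi> (y \<otimes> x)" if xy: "x \<in> carrier G" "y \<in> carrier G" for x y
  proof -
    note cx = mat_rep_carrier[OF rep xy(1)] and cix = mat_rep_carrier[OF rep inv_closed[OF xy(1)]]
    have "y \<otimes> x = inv x \<otimes> (x \<otimes> y) \<otimes> x" using xy by (simp add: m_assoc[symmetric])
    then have "\<rho> (y \<otimes> x) = \<rho> (inv x) * \<rho> (x \<otimes> y) * \<rho> x"
      using xy by (simp add: mat_rep_mult[OF rep, symmetric])
    then have "char_poly (\<rho> (x \<otimes> y)) = char_poly (\<rho> (y \<otimes> x))"
      using char_poly_similar[OF conj_similar[OF cix cx mat_rep_inv(2)[OF rep xy(1)] mat_rep_inv(1)[OF rep xy(1)]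
          mat_rep_carrier[OF rep m_closed[OF xy]]]] by simp
    then show ?thesis by (auto simp: \<phi>_def)
  qed
  \<comment> \<open>As \<open>l\<close> varies, the functions \<open>(x, g, h) \<mapsto> \<phi> (l g l\<inverse> h) x\<close> lie in a finite-dimensional space and
    take finitely many values at each point, so there are finitely many of them and \<open>L\<close> has finite
    index. Commutators of \<open>L\<close> with \<open>\<Gamma>\<close> fall into the unipotent group \<open>U\<close> below.\<close>
  define L where "L = {l \<in> carrier G. \<forall>g\<in>\<Gamma>. \<forall>h\<in>\<Gamma>. \<phi> (l \<otimes> g \<otimes> inv l \<otimes> h) = \<phi> (g \<otimes> h)}"
  have LG: "l \<in> carrier G" if "l \<in> L" for l using that by (simp add: L_def)
  have LD: "\<phi> (l \<otimes> g \<otimes> inv l \<otimes> h) = \<phi> (g \<otimes> h)" if "l \<in> L" "g \<in> \<Gamma>" "h \<in> \<Gamma>" for l g h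
    using that by (simp add: L_def)
  have L: "subgroup L G"
  proof
    fix l m assume l: "l \<in> L" and m: "m \<in> L"
    show "l \<otimes> m \<in> L" unfolding L_def
    proof (intro CollectI conjI ballI)
      fix g h assume gh: "g \<in> \<Gamma>" "h \<in> \<Gamma>"
      have "l \<otimes> m \<otimes> g \<otimes> inv (l \<otimes> m) \<otimes> h = l \<otimes> (m \<otimes> g \<otimes> inv m) \<otimes> inv l \<otimes> h"
        using LG[OF l] LG[OF m] gh \<Gamma>G by (simp add: inv_mult_group m_assoc)
      then show "\<phi> (l \<otimes> m \<otimes> g \<otimes> inv (l \<otimes> m) \<otimes> h) = \<phi> (g \<otimes> h)"
        using LD[OF l \<Gamma>conj(1)[OF LG[OF m] gh(1)] gh(2)] LD[OF m gh] by simp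
    qed (use LG l m in auto)
  next
    fix l assume l: "l \<in> L"
    note lG = LG[OF l]
    show "inv l \<in> L" unfolding L_def
    proof (intro CollectI conjI ballI)
      fix g h assume gh: "g \<in> \<Gamma>" "h \<in> \<Gamma>"
      have "\<phi> (inv l \<otimes> g \<otimes> inv (inv l) \<otimes> h) = \<phi> (inv l \<otimes> (g \<otimes> l \<otimes> h))"
        using lG gh \<Gamma>G by (simp add: m_assoc)
      also have "\<dots> = \<phi> (g \<otimes> l \<otimes> h \<otimes> inv l)" by (rule cyc) (use lG gh \<Gamma>G in auto)
      also have "\<dots> = \<phi> (g \<otimes> (l \<otimes> h \<otimes> inv l))" using lG gh \<Gamma>G by (simp add: m_assoc)
      also have "\<dots> = \<phi> (l \<otimes> h \<otimes> inv l \<otimes> g)" by (rule cyc) (use lG gh \<Gamma>G in auto)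
      also have "\<dots> = \<phi> (h \<otimes> g)" by (rule LD[OF l gh(2,1)])
      also have "\<dots> = \<phi> (g \<otimes> h)" by (rule cyc) (use gh \<Gamma>G in auto)
      finally show "\<phi> (inv l \<otimes> g \<otimes> inv (inv l) \<otimes> h) = \<phi> (g \<otimes> h)" .
    qed (use lG in auto)
  qed (use \<Gamma>G in \<open>auto simp: L_def\<close>)
  \<comment> \<open>The scalar \<open>x\<close> is made part of the point, so that characteristic
    polynomials become scalar-valued functions.\<close>
  define X where "X = (UNIV :: 'k set) \<times> \<Gamma> \<times> \<Gamma>"
  define M where "M l = (\<lambda>(x, g, h). \<phi> (l \<otimes> g \<otimes> inv l \<otimes> h) x)" for l
  \<comment> \<open>An entry of the characteristic matrix of
    \<open>\<rho> (l \<otimes> g \<otimes> inv l \<otimes> h)\<close> at \<open>x\<close>, expanded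
    so that \<open>l\<close> and the point \<open>(x, g, h)\<close> are separated; \<open>D\<close>
    is the Leibniz formula for its determinant.\<close>
  define E where "E i j l = (\<lambda>(x, g, h). (if i = j then x else 0) +
     (- 1) * (\<Sum>a = 0..<d. \<Sum>b = 0..<d. \<Sum>c = 0..<d. \<rho> l $$ (i, a) * (\<rho> g $$ (a, b) * (\<rho> (inv l) $$ (b, c) * \<rho> h $$ (c, j)))))" for i j l
  define D where "D l = (\<lambda>p. \<Sum>\<pi> | \<pi> permutes {0..<d}. signof \<pi> * (\<Prod>i = 0..<d. E i (\<pi> i) l p))" for l
  have fE: "fin_spanned (carrier G) (E i j)" for i j
  proof -
    have e: "E i j = (\<lambda>l p. (\<lambda>(x, g, h). if i = j then x else 0) p + (\<lambda>_. - 1) l *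
      (\<Sum>a = 0..<d. \<Sum>b = 0..<d. \<Sum>c = 0..<d. (\<lambda>l. \<rho> l $$ (i, a)) l * ((\<lambda>(x, g, h). \<rho> g $$ (a, b)) p *
        ((\<lambda>l. \<rho> (inv l) $$ (b, c)) l * (\<lambda>(x, g, h). \<rho> h $$ (c, j)) p))))"
      by (auto simp: E_def fun_eq_iff)
    show ?thesis unfolding e
      by (intro fin_spanned_add fin_spanned_mult fin_spanned_sum fin_spanned_const fin_spanned_fixed) auto
  qed
  have fD: "fin_spanned (carrier G) D"
    unfolding D_def
    by (intro fin_spanned_sum fin_spanned_mult fin_spanned_prod fin_spanned_const fE) (auto intro: finite_permutations)
  have DM: "D l p = M l p" if l: "l \<in> carrier G" and p: "p \<in> X" for l p
  proof -
    obtain x g h where pp: "p = (x, g, h)" "g \<in> \<Gamma>" "h \<in> \<Gamma>" using p by (auto simp: X_def)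
    have g: "g \<in> carrier G" and h: "h \<in> carrier G" using pp \<Gamma>G by auto
    let ?m = "l \<otimes> g \<otimes> inv l \<otimes> h"
    note cl = mat_rep_carrier[OF rep l] and cg = mat_rep_carrier[OF rep g] and ch = mat_rep_carrier[OF rep h]
      and ci = mat_rep_carrier[OF rep inv_closed[OF l]]
    have m: "?m \<in> carrier G" using l g h by auto
    have cm: "\<rho> ?m = \<rho> l * (\<rho> g * (\<rho> (inv l) * \<rho> h))"
      using l g h by (simp add: mat_rep_mult[OF rep, symmetric] m_assoc)
    have ent: "\<rho> ?m $$ (i, j) = (\<Sum>a = 0..<d. \<Sum>b = 0..<d. \<Sum>c = 0..<d. \<rho> l $$ (i, a) * (\<rho> g $$ (a, b) * (\<rho> (inv l) $$ (b, c) * \<rho> h $$ (c, j))))"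
      if "i < d" "j < d" for i j
    proof -
      have 1: "(\<rho> (inv l) * \<rho> h) $$ (b, j) = (\<Sum>c = 0..<d. \<rho> (inv l) $$ (b, c) * \<rho> h $$ (c, j))" if "b < d" for b
        by (rule index_mult_sum[OF ci ch that \<open>j < d\<close>])
      have 2: "(\<rho> g * (\<rho> (inv l) * \<rho> h)) $$ (a, j) = (\<Sum>b = 0..<d. \<rho> g $$ (a, b) * (\<Sum>c = 0..<d. \<rho> (inv l) $$ (b, c) * \<rho> h $$ (c, j)))" if "a < d" for a
        unfolding index_mult_sum[OF cg mult_carrier_mat[OF ci ch] that \<open>j < d\<close>] by (intro sum.cong) (auto simp: 1 simp del: index_mult_mat)
      show ?thesis
        unfolding cm index_mult_sum[OF cl mult_carrier_mat[OF cg mult_carrier_mat[OF ci ch]] that]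
        by (intro sum.cong) (auto simp: 2 sum_distrib_left simp del: index_mult_mat)
    qed
    have cM: "- char_matrix (\<rho> ?m) x \<in> carrier_mat d d" using mat_rep_carrier[OF rep m] by simp
    have "M l p = det (- char_matrix (\<rho> ?m) x)"
      unfolding M_def \<phi>_def pp(1) using char_poly_matrix[OF mat_rep_carrier[OF rep m]] by simp
    also have "\<dots> = (\<Sum>\<pi> | \<pi> permutes {0..<d}. signof \<pi> * (\<Prod>i = 0..<d. (- char_matrix (\<rho> ?m) x) $$ (i, \<pi> i)))"
      by (rule det_def'[OF cM])
    also have "\<dots> = D l p"
      unfolding D_def
    proof (intro sum.cong refl arg_cong2[where f = "(*)"] prod.cong)
      fix \<pi> i assume "\<pi> \<in> {\<pi>. \<pi> permutes {0..<d}}" "i \<in> {0..<d}"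
      then have i: "i < d" "\<pi> i < d" by (auto simp: permutes_in_image)
      then show "(- char_matrix (\<rho> ?m) x) $$ (i, \<pi> i) = E i (\<pi> i) l p"
        unfolding E_def pp(1) prod.case ent[OF i, symmetric] using mat_rep_carrier[OF rep m]
        by (auto simp: char_matrix_def)
    qed
    finally show ?thesis by simp
  qed
  \<comment> \<open>All candidates for characteristic polynomials on \<open>\<Gamma>\<close>; at a
    fixed \<open>x\<close> they leave finitely many values.\<close>
  define CP where "CP = (\<lambda>es. \<Prod>e\<leftarrow>es. [:- e, 1 :: 'k:]) ` {es. set es \<subseteq> {e. e ^ N = 1} \<and> length es = d}"
  have "finite {e :: 'k. e ^ N = 1}"
  proof -
    have "monom 1 N - 1 \<noteq> (0 :: 'k poly)"
    proof
      assume "monom 1 N - 1 = (0 :: 'k poly)"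
      then have "coeff (monom 1 N - 1) N = (0 :: 'k)" by simp
      then show False using N by simp
    qed
    then have "finite {e. poly (monom 1 N - 1) e = (0 :: 'k)}" by (rule poly_roots_finite)
    then show ?thesis by (simp add: poly_monom)
  qed
  then have CP: "finite CP" unfolding CP_def by (intro finite_imageI finite_lists_length_eq)
  have \<phi>CP: "\<phi> g x \<in> (\<lambda>c. poly c x) ` CP" if "g \<in> \<Gamma>" for g x
  proof -
    obtain es where "length es = d" "\<forall>e\<in>set es. e ^ N = 1" "char_poly (\<rho> g) = (\<Prod>e\<leftarrow>es. [:- e, 1:])"
      using tors \<open>g \<in> \<Gamma>\<close>[unfolded \<Gamma>_def] by blast
    then have "es \<in> {es. set es \<subseteq> {e. e ^ N = 1} \<and> length es = d}"
      and cp: "char_poly (\<rho> g) = (\<Prod>e\<leftarrow>es. [:- e, 1:])" by auto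
    from this(1) have "char_poly (\<rho> g) \<in> CP" unfolding CP_def cp by (rule imageI)
    then show ?thesis unfolding \<phi>_def by (rule imageI)
  qed
  have fin: "finite ((\<lambda>l. restrict (D l) X) ` carrier G)"
  proof (rule fin_spanned_finite_image[OF fD, where V = "\<lambda>(x, g, h). (\<lambda>c. poly c x) ` CP"])
    fix l p assume l: "l \<in> carrier G" and p: "p \<in> X"
    show "D l p \<in> (case p of (x, g, h) \<Rightarrow> (\<lambda>c. poly c x) ` CP)"
    proof -
      obtain x g h where pp: "p = (x, g, h)" "g \<in> \<Gamma>" "h \<in> \<Gamma>" using p by (auto simp: X_def)
      have "l \<otimes> g \<otimes> inv l \<otimes> h \<in> \<Gamma>" using \<Gamma>conj(1)[OF l pp(2)] pp(3) by simp
      then have "M l p \<in> (case p of (x, g, h) \<Rightarrow> (\<lambda>c. poly c x) ` CP)"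
        unfolding M_def pp(1) prod.case by (rule \<phi>CP)
      then show ?thesis unfolding DM[OF l p] .
    qed
  qed (use CP in auto)
  have eq: "\<phi> (l \<otimes> g \<otimes> inv l \<otimes> h) = \<phi> (m \<otimes> g \<otimes> inv m \<otimes> h)"
    if lm: "l \<in> carrier G" "m \<in> carrier G" "restrict (D l) X = restrict (D m) X" and gh: "g \<in> \<Gamma>" "h \<in> \<Gamma>" for l m g h
  proof
    fix x
    have "(x, g, h) \<in> X" using gh by (simp add: X_def)
    then show "\<phi> (l \<otimes> g \<otimes> inv l \<otimes> h) x = \<phi> (m \<otimes> g \<otimes> inv m \<otimes> h) x"
      using fun_cong[OF lm(3), of "(x, g, h)"] DM[OF lm(1), of "(x, g, h)"] DM[OF lm(2), of "(x, g, h)"]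
      by (simp add: M_def)
  qed
  \<comment> \<open>A right coset \<open>L #> a\<close> is determined by the function that belongs
    to \<open>inv a\<close>: if \<open>inv a\<close> and \<open>inv b\<close> give the same
    function, cyclic invariance of \<open>\<phi>\<close> puts \<open>b \<otimes> inv a\<close> into
    \<open>L\<close>.\<close>
  have "finite ((\<lambda>a. L #> a) ` carrier G)"
  proof (rule finite_image_factor[where f = "\<lambda>a. restrict (D (inv a)) X"])
    have "(\<lambda>a. restrict (D (inv a)) X) ` carrier G \<subseteq> (\<lambda>l. restrict (D l) X) ` carrier G" by auto
    then show "finite ((\<lambda>a. restrict (D (inv a)) X) ` carrier G)" using fin finite_subset by blast
    fix a b assume ab: "a \<in> carrier G" "b \<in> carrier G" "restrict (D (inv a)) X = restrict (D (inv b)) X"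
    have "b \<otimes> inv a \<in> L" unfolding L_def
    proof (intro CollectI conjI ballI)
      fix g h assume gh: "g \<in> \<Gamma>" "h \<in> \<Gamma>"
      note ghG = \<Gamma>G[OF gh(1)] \<Gamma>G[OF gh(2)]
      have h': "inv b \<otimes> h \<otimes> b \<in> \<Gamma>" by (rule \<Gamma>conj(2)[OF ab(2) gh(2)])
      have "\<phi> (b \<otimes> inv a \<otimes> g \<otimes> inv (b \<otimes> inv a) \<otimes> h)
          = \<phi> (b \<otimes> (inv a \<otimes> g \<otimes> a \<otimes> inv b \<otimes> h))"
        using ab ghG by (simp add: inv_mult_group m_assoc)
      also have "\<dots> = \<phi> (inv a \<otimes> g \<otimes> a \<otimes> inv b \<otimes> h \<otimes> b)"
        by (rule cyc) (use ab ghG in auto)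
      also have "\<dots> = \<phi> (inv a \<otimes> g \<otimes> inv (inv a) \<otimes> (inv b \<otimes> h \<otimes> b))"
        using ab ghG by (simp add: m_assoc)
      also have "\<dots> = \<phi> (inv b \<otimes> g \<otimes> inv (inv b) \<otimes> (inv b \<otimes> h \<otimes> b))"
        by (rule eq[OF _ _ ab(3) gh(1) h']) (use ab in auto)
      also have "\<dots> = \<phi> (inv b \<otimes> (g \<otimes> h \<otimes> b))"
        using ab ghG by (simp add: m_assoc) (simp add: m_assoc[symmetric])
      also have "\<dots> = \<phi> (g \<otimes> h \<otimes> b \<otimes> inv b)" by (rule cyc) (use ab ghG in auto)
      also have "\<dots> = \<phi> (g \<otimes> h)" using ab ghG by (simp add: m_assoc)
      finally show "\<phi> (b \<otimes> inv a \<otimes> g \<otimes> inv (b \<otimes> inv a) \<otimes> h) = \<phi> (g \<otimes> h)" .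
    qed (use ab in auto)
    moreover have "b = (b \<otimes> inv a) \<otimes> a" using ab by (simp add: m_assoc)
    ultimately have "b \<in> L #> a" unfolding r_coset_def by blast
    then show "L #> a = L #> b" by (rule repr_independence[OF _ ab(1) L])
  qed
  then have finL: "finite (rcosets L)" unfolding RCOSETS_def by (simp add: UNION_singleton_eq_range)
  define U where "U = {u \<in> \<Gamma>. \<forall>h\<in>\<Gamma>. \<phi> (u \<otimes> h) = \<phi> h}"
  have U\<Gamma>: "u \<in> \<Gamma>" "u \<in> carrier G" if "u \<in> U" for u using that \<Gamma>G by (auto simp: U_def)
  have UD: "\<phi> (u \<otimes> h) = \<phi> h" if "u \<in> U" "h \<in> \<Gamma>" for u h using that by (simp add: U_def)
  have U: "subgroup U G"
  proof
    fix u v assume u: "u \<in> U" and v: "v \<in> U"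
    show "u \<otimes> v \<in> U" unfolding U_def
    proof (intro CollectI conjI ballI)
      fix h assume h: "h \<in> \<Gamma>"
      have "\<phi> (u \<otimes> v \<otimes> h) = \<phi> (u \<otimes> (v \<otimes> h))" using U\<Gamma> u v \<Gamma>G h by (simp add: m_assoc)
      then show "\<phi> (u \<otimes> v \<otimes> h) = \<phi> h" using UD[OF u] UD[OF v h] U\<Gamma>[OF v] h by simp
    qed (use U\<Gamma> u v in auto)
  next
    fix u assume u: "u \<in> U"
    show "inv u \<in> U" unfolding U_def
    proof (intro CollectI conjI ballI)
      fix h assume h: "h \<in> \<Gamma>"
      have "\<phi> h = \<phi> (u \<otimes> (inv u \<otimes> h))" using U\<Gamma>[OF u] \<Gamma>G[OF h] by (simp add: m_assoc[symmetric])
      also have "\<dots> = \<phi> (inv u \<otimes> h)" by (rule UD[OF u]) (use U\<Gamma>[OF u] h in auto)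
      finally show "\<phi> (inv u \<otimes> h) = \<phi> h" by simp
    qed (use U\<Gamma> u in auto)
  qed (use \<Gamma>G in \<open>auto simp: U_def\<close>)
  have "derived G L \<subseteq> L" by (rule derived_incl[OF subset_refl L])
  moreover have "derived G L \<subseteq> \<Gamma>" unfolding \<Gamma>_def by (rule mono_derived) (use LG in auto)
  ultimately have "derived_set G (derived G L) \<subseteq> U"
  proof (intro subsetI)
    fix z assume z: "z \<in> derived_set G (derived G L)" and sub: "derived G L \<subseteq> L" "derived G L \<subseteq> \<Gamma>"
    obtain l g where lg: "l \<in> L" "l \<in> \<Gamma>" "g \<in> \<Gamma>" and zz: "z = l \<otimes> g \<otimes> inv l \<otimes> inv g"
      using z sub by blast
    note lG = LG[OF lg(1)] and gG = \<Gamma>G[OF lg(3)]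
    show "z \<in> U" unfolding U_def
    proof (intro CollectI conjI ballI)
      show "z \<in> \<Gamma>" unfolding zz using lg by auto
      fix h assume h: "h \<in> \<Gamma>"
      have "\<phi> (z \<otimes> h) = \<phi> (l \<otimes> g \<otimes> inv l \<otimes> (inv g \<otimes> h))"
        unfolding zz using lG gG \<Gamma>G[OF h] by (simp add: m_assoc)
      also have "\<dots> = \<phi> (g \<otimes> (inv g \<otimes> h))" by (rule LD) (use lg h in auto)
      also have "\<dots> = \<phi> h" using gG \<Gamma>G[OF h] by (simp add: m_assoc[symmetric])
      finally show "\<phi> (z \<otimes> h) = \<phi> h" .
    qed
  qed
  then have DDL: "derived G (derived G L) \<subseteq> U"
    unfolding derived_def[of G "derived G L"] by (rule generate_subgroup_incl[OF _ U])
  let ?U = "G\<lparr>carrier := U\<rparr>"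
  have "mat_rep ?U d \<rho>" using rep U\<Gamma>(2) by (simp add: mat_rep_def)
  moreover have "group ?U" by (rule subgroup_imp_group[OF U])
  moreover have "e = 1" if u: "u \<in> U" and e: "eigenvalue (\<rho> u) e" for u e
  proof -
    have "\<phi> u = \<phi> \<one>" using UD[OF u \<Gamma>.one_closed] U\<Gamma>[OF u] by simp
    then have "eigenvalue (\<rho> \<one>) e"
      using e eigenvalue_root_char_poly[OF mat_rep_carrier[OF rep]] U\<Gamma>(2)[OF u] one_closed
      by (metis \<phi>_def)
    then obtain v where v: "v \<in> carrier_vec d" "v \<noteq> 0\<^sub>v d" "v = e \<cdot>\<^sub>v v"
      unfolding mat_rep_one[OF rep] eigenvalue_def eigenvector_def by auto
    obtain i where i: "i < d" "v $ i \<noteq> 0" using v(1,2) by (metis carrier_vecD eq_vecI index_zero_vec)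
    have "v $ i = e * v $ i" using arg_cong[OF v(3), of "\<lambda>w. w $ i"] v(1) i by simp
    then show ?thesis using i by simp
  qed
  ultimately obtain n where "\<forall>x\<in>(derived ?U ^^ n) (carrier ?U). \<rho> x = 1\<^sub>m d"
    using kolchin[of ?U d \<rho>] by auto
  then have n: "\<forall>x\<in>(derived G ^^ n) U. \<rho> x = 1\<^sub>m d" using exp_of_derived_consistent[OF U] by simp
  \<comment> \<open>Two derived steps lead from \<open>L\<close> into \<open>U\<close>: the first
    one reaches \<open>\<Gamma>\<close>, the second one takes commutators of elements of
    \<open>L\<close> with elements of \<open>\<Gamma>\<close>.\<close>
  have "(derived G ^^ (n + 2)) L = (derived G ^^ n) (derived G (derived G L))"
    by (simp only: funpow_add o_apply) (simp add: numeral_2_eq_2)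
  also have "\<dots> \<subseteq> (derived G ^^ n) U" by (rule mono_exp_of_derived[OF DDL])
  finally show ?thesis using n L finL by blast
qed

section \<open>Cocycles on free groups\<close>

declare in_listsD [rule del] in_listsI [rule del]

section \<open>Words, their values and labels on the edges of the Cayley graph\<close>

definition inv_word :: "('a \<times> bool) list \<Rightarrow> ('a \<times> bool) list" where
  "inv_word w = rev (map (\<lambda>(x, e). (x, \<not> e)) w)"

lemma length_inv_word [simp]: "length (inv_word w) = length w"
  by (simp add: inv_word_def)

lemma inv_word_in_lists: "w \<in> lists (X \<times> UNIV) \<Longrightarrow> inv_word w \<in> lists (X \<times> UNIV)"
  by (auto simp: inv_word_def in_lists_conv_set)

lemma word_value_Nil [simp]: "word_value G [] = \<one>\<^bsub>G\<^esub>"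
  by (simp add: word_value_def list_mult_def)

lemma word_value_Cons: "word_value G ((x, e) # w) = (if e then x else inv\<^bsub>G\<^esub> x) \<otimes>\<^bsub>G\<^esub> word_value G w"
  by (simp add: word_value_def list_mult_def)

context group
begin

lemma word_value_closed: "X \<subseteq> carrier G \<Longrightarrow> w \<in> lists (X \<times> UNIV) \<Longrightarrow> word_value G w \<in> carrier G"
  by (induction w) (auto simp: word_value_Cons)

lemma word_value_append:
  assumes "X \<subseteq> carrier G" "v \<in> lists (X \<times> UNIV)" "w \<in> lists (X \<times> UNIV)"
  shows "word_value G (v @ w) = word_value G v \<otimes> word_value G w"
  using assms(2)
proof induction
  case (Cons l v)
  then show ?case using assms(1,3) word_value_closed[OF assms(1)]
    by (cases l) (auto simp: word_value_Cons m_assoc subsetD[OF assms(1)])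
qed (simp add: word_value_closed[OF assms(1,3)])

lemma word_value_inv_word:
  assumes "X \<subseteq> carrier G" "w \<in> lists (X \<times> UNIV)"
  shows "word_value G (inv_word w) = inv (word_value G w)"
  using assms(2)
proof (induction w)
  case (Cons l w)
  obtain x e where l: "l = (x, e)" by (cases l)
  have x: "x \<in> X" "x \<in> carrier G" using Cons l assms by auto
  have "inv_word (l # w) = inv_word w @ [(x, \<not> e)]" by (simp add: inv_word_def l)
  then have "word_value G (inv_word (l # w)) = word_value G (inv_word w) \<otimes> word_value G [(x, \<not> e)]"
    using word_value_append[OF assms(1) inv_word_in_lists, of w "[(x, \<not> e)]"] Cons x by simp
  then show ?case using Cons x l word_value_closed[OF assms(1), of w]
    by (auto simp: word_value_Cons inv_mult_group)
qed (simp add: inv_word_def)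

end

text \<open>\<open>c x g\<close> labels the edge of the Cayley graph from \<open>g\<close> to
  \<open>x \<otimes> g\<close>. The word is read from its right end, starting at the vertex
  \<open>g\<close>. An inverse letter runs backwards through the edge that ends at the current
  vertex, hence the shifted argument and the inverse.\<close>

fun cocycle_word :: "('a, 'b) monoid_scheme \<Rightarrow> ('h, 'c) monoid_scheme \<Rightarrow> ('a \<Rightarrow> 'a \<Rightarrow> 'h) \<Rightarrow>
    ('a \<times> bool) list \<Rightarrow> 'a \<Rightarrow> 'h" where
  "cocycle_word G H c [] g = \<one>\<^bsub>H\<^esub>"
| "cocycle_word G H c ((x, e) # w) g =
     (if e then c x (word_value G w \<otimes>\<^bsub>G\<^esub> g)
      else inv\<^bsub>H\<^esub> (c x (inv\<^bsub>G\<^esub> x \<otimes>\<^bsub>G\<^esub> (word_value G w \<otimes>\<^bsub>G\<^esub> g)))) \<otimes>\<^bsub>H\<^esub> cocycle_word G H c w g"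

text \<open>\<open>\<kappa> f g\<close> is the holonomy from the vertex \<open>g\<close> to the
  vertex \<open>f \<otimes> g\<close>; the identity composes two paths.\<close>

definition is_cocycle :: "('a, 'b) monoid_scheme \<Rightarrow> ('h, 'c) monoid_scheme \<Rightarrow> ('a \<Rightarrow> 'a \<Rightarrow> 'h) \<Rightarrow> bool" where
  "is_cocycle G H \<kappa> \<longleftrightarrow> (\<forall>f\<in>carrier G. \<forall>g\<in>carrier G. \<kappa> f g \<in> carrier H) \<and>
     (\<forall>f\<in>carrier G. \<forall>f'\<in>carrier G. \<forall>g\<in>carrier G. \<kappa> (f \<otimes>\<^bsub>G\<^esub> f') g = \<kappa> f (f' \<otimes>\<^bsub>G\<^esub> g) \<otimes>\<^bsub>H\<^esub> \<kappa> f' g)"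

lemma is_cocycleD:
  fixes G (structure)
  assumes "is_cocycle G H \<kappa>"
  shows "f \<in> carrier G \<Longrightarrow> g \<in> carrier G \<Longrightarrow> \<kappa> f g \<in> carrier H"
    and "f \<in> carrier G \<Longrightarrow> f' \<in> carrier G \<Longrightarrow> g \<in> carrier G \<Longrightarrow>
      \<kappa> (f \<otimes> f') g = \<kappa> f (f' \<otimes> g) \<otimes>\<^bsub>H\<^esub> \<kappa> f' g"
  using assms by (auto simp: is_cocycle_def)

lemma cocycle_inv:
  fixes G (structure)
  assumes G: "group G" and H: "group H" and \<kappa>: "is_cocycle G H \<kappa>"
    and fg: "f \<in> carrier G" "g \<in> carrier G"
  shows "\<kappa> \<one> g = \<one>\<^bsub>H\<^esub>" "\<kappa> (inv f) (f \<otimes> g) = inv\<^bsub>H\<^esub> (\<kappa> f g)"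
proof -
  interpret G: group G by (rule G)
  interpret H: group H by (rule H)
  note c = is_cocycleD(1)[OF \<kappa>] and m = is_cocycleD(2)[OF \<kappa>]
  have "\<kappa> \<one> g \<otimes>\<^bsub>H\<^esub> \<kappa> \<one> g = \<kappa> \<one> g" using m[OF G.one_closed G.one_closed fg(2)] fg by simp
  then show 1: "\<kappa> \<one> g = \<one>\<^bsub>H\<^esub>" using c[OF G.one_closed fg(2)] by simp
  have "\<kappa> (inv f) (f \<otimes> g) \<otimes>\<^bsub>H\<^esub> \<kappa> f g = \<one>\<^bsub>H\<^esub>"
    using m[OF G.inv_closed[OF fg(1)] fg] 1 fg by simp
  then show "\<kappa> (inv f) (f \<otimes> g) = inv\<^bsub>H\<^esub> (\<kappa> f g)"
    using c fg by (simp add: H.inv_equality)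
qed

lemma free_basis_words:
  assumes "group G" "free_basis G X" "f \<in> carrier G"
  obtains w where "w \<in> lists (X \<times> UNIV)" "word_value G w = f"
  using assms unfolding free_basis_def bij_betw_def reduced_words_def by (metis (no_types, lifting) image_iff mem_Collect_eq)

text \<open>For \<open>c x g\<close> independent of \<open>g\<close> this is the universal property; in general it says that a
  crossed homomorphism, i.e. the holonomy of a graph on which \<open>G\<close> acts, can be prescribed freely on a basis.\<close>

lemma free_basis_cocycle:
  fixes G (structure)
  assumes G: "group G" and H: "group H" and X: "free_basis G X"
    and c: "\<And>x g. x \<in> X \<Longrightarrow> g \<in> carrier G \<Longrightarrow> c x g \<in> carrier H"
  obtains \<kappa> where "is_cocycle G H \<kappa>" "\<And>x g. x \<in> X \<Longrightarrow> g \<in> carrier G \<Longrightarrow> \<kappa> x g = c x g"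
proof -
  interpret G: group G by (rule G)
  interpret H: group H by (rule H)
  have XG: "X \<subseteq> carrier G" and bij: "bij_betw (word_value G) (reduced_words X) (carrier G)"
    using X by (auto simp: free_basis_def)
  have xG: "x \<in> carrier G" if "x \<in> X" for x using that XG by blast
  let ?K = "cocycle_word G H c"
  let ?l = "\<lambda>(x, e). if e then x else inv x"
  let ?cl = "\<lambda>(x, e) g. if e then c x g else inv\<^bsub>H\<^esub> (c x (inv x \<otimes> g))"
  have K: "?K w g \<in> carrier H" if "w \<in> lists (X \<times> UNIV)" "g \<in> carrier G" for w g
    using that by (induction w) (auto simp: G.word_value_closed[OF XG] xG c)
  define rw where "rw = inv_into (reduced_words X) (word_value G)"
  have rw: "rw f \<in> reduced_words X" "word_value G (rw f) = f" if "f \<in> carrier G" for f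
    using that bij unfolding rw_def bij_betw_def by (metis inv_into_into, metis f_inv_into_f)
  have rwv: "rw (word_value G w) = w" if "w \<in> reduced_words X" for w
    using that bij unfolding rw_def bij_betw_def by (metis inv_into_f_f)
  have rwl: "rw f \<in> lists (X \<times> UNIV)" if "f \<in> carrier G" for f
    using rw(1)[OF that] by (simp add: reduced_words_def)
  define \<kappa> where "\<kappa> f g = ?K (rw f) g" for f g
  \<comment> \<open>Prepending a letter to a reduced word either cancels its first letter, and then
    the two labels are inverse to each other, or gives a reduced word again.\<close>
  have step: "\<kappa> (?l l \<otimes> f) g = ?cl l (f \<otimes> g) \<otimes>\<^bsub>H\<^esub> \<kappa> f g"
    if l: "l \<in> X \<times> UNIV" and f: "f \<in> carrier G" and g: "g \<in> carrier G" for l f g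
  proof -
    obtain x e where le: "l = (x, e)" "x \<in> X" using l by auto
    note x = xG[OF le(2)]
    show ?thesis
    proof (cases "\<exists>w'. rw f = (x, \<not> e) # w'")
      case True
      then obtain w' where w': "rw f = (x, \<not> e) # w'" by blast
      have red: "w' \<in> reduced_words X"
        using rw(1)[OF f] unfolding w' reduced_words_def by (auto simp: successively_Cons)
      then have w'l: "w' \<in> lists (X \<times> UNIV)" by (simp add: reduced_words_def)
      note w'G = G.word_value_closed[OF XG w'l]
      have fe: "f = (if e then inv x else x) \<otimes> word_value G w'"
        using rw(2)[OF f] by (simp add: w' word_value_Cons split: if_splits)
      have "?l l \<otimes> f = word_value G w'"
        unfolding fe le using x w'G by (simp add: G.m_assoc[symmetric])
      then have 1: "\<kappa> (?l l \<otimes> f) g = ?K w' g" using rwv[OF red] by (simp add: \<kappa>_def)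
      have "?cl l (f \<otimes> g) \<otimes>\<^bsub>H\<^esub> ?cl (x, \<not> e) (word_value G w' \<otimes> g) = \<one>\<^bsub>H\<^esub>"
        unfolding fe le using x w'G g c[OF le(2)]
        by (simp add: G.m_assoc G.m_assoc[symmetric, of "inv x" x])
      moreover have "\<kappa> f g = ?cl (x, \<not> e) (word_value G w' \<otimes> g) \<otimes>\<^bsub>H\<^esub> ?K w' g"
        by (simp add: \<kappa>_def w')
      ultimately show ?thesis unfolding 1
        using le x f g w'G c[OF le(2)] K[OF w'l g] by (simp add: H.m_assoc[symmetric])
    next
      case False
      have "l # rw f \<in> reduced_words X"
        using rw(1)[OF f] le False unfolding reduced_words_def
        by (cases "rw f") (auto simp: successively_Cons)
      moreover have "?l l \<otimes> f = word_value G (l # rw f)"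
        using rw(2)[OF f] by (simp add: le word_value_Cons)
      ultimately have "rw (?l l \<otimes> f) = l # rw f" using rwv by simp
      then show ?thesis using rw(2)[OF f] by (simp add: \<kappa>_def le)
    qed
  qed
  have words: "\<kappa> (word_value G w \<otimes> f) g = ?K w (f \<otimes> g) \<otimes>\<^bsub>H\<^esub> \<kappa> f g"
    if w: "w \<in> lists (X \<times> UNIV)" and f: "f \<in> carrier G" and g: "g \<in> carrier G" for w f g
    using w
  proof (induction w)
    case Nil
    then show ?case using f K[OF rwl[OF f] g] by (simp add: \<kappa>_def)
  next
    case (Cons l w)
    obtain x e where le: "l = (x, e)" "x \<in> X" using Cons by auto
    note x = xG[OF le(2)]
    have wG: "word_value G w \<in> carrier G" using Cons G.word_value_closed[OF XG] by auto
    have lG: "?l l \<in> carrier G" using x le by auto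
    have "\<kappa> (word_value G (l # w) \<otimes> f) g = \<kappa> (?l l \<otimes> (word_value G w \<otimes> f)) g"
      using lG wG f by (simp add: le word_value_Cons G.m_assoc)
    also have "\<dots> = ?cl l (word_value G w \<otimes> f \<otimes> g) \<otimes>\<^bsub>H\<^esub> \<kappa> (word_value G w \<otimes> f) g"
      by (rule step) (use le wG f g in auto)
    also have "\<dots> = ?K (l # w) (f \<otimes> g) \<otimes>\<^bsub>H\<^esub> \<kappa> f g"
    proof -
      have wl: "w \<in> lists (X \<times> UNIV)" and IH: "\<kappa> (word_value G w \<otimes> f) g = ?K w (f \<otimes> g) \<otimes>\<^bsub>H\<^esub> \<kappa> f g"
        using Cons by auto
      have clH: "?cl l (word_value G w \<otimes> (f \<otimes> g)) \<in> carrier H"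
        using c[OF le(2)] x wG f g by (simp add: le)
      have \<kappa>H: "\<kappa> f g \<in> carrier H" using K[OF rwl[OF f] g] by (simp add: \<kappa>_def)
      have "?K (l # w) (f \<otimes> g) = ?cl l (word_value G w \<otimes> (f \<otimes> g)) \<otimes>\<^bsub>H\<^esub> ?K w (f \<otimes> g)"
        by (simp add: le)
      then show ?thesis
        unfolding IH G.m_assoc[OF wG f g]
        using H.m_assoc[OF clH K[OF wl G.m_closed[OF f g]] \<kappa>H] by simp
    qed
    finally show ?case .
  qed
  have "is_cocycle G H \<kappa>"
    unfolding is_cocycle_def
  proof (intro conjI ballI)
    fix f g assume "f \<in> carrier G" "g \<in> carrier G"
    then show "\<kappa> f g \<in> carrier H" using K[OF rwl] by (simp add: \<kappa>_def)
  next
    fix f f' g assume f: "f \<in> carrier G" and f': "f' \<in> carrier G" and g: "g \<in> carrier G"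
    show "\<kappa> (f \<otimes> f') g = \<kappa> f (f' \<otimes> g) \<otimes>\<^bsub>H\<^esub> \<kappa> f' g"
      using words[OF rwl[OF f] f' g] rw(2)[OF f] by (simp add: \<kappa>_def)
  qed
  moreover have "\<kappa> x g = c x g" if x: "x \<in> X" and g: "g \<in> carrier G" for x g
  proof -
    have "[] \<in> reduced_words X" by (simp add: reduced_words_def)
    then have "rw \<one> = []" using rwv by force
    then show ?thesis
      using step[of "(x, True)" "\<one>" g] x g xG[OF x] c by (simp add: \<kappa>_def)
  qed
  ultimately show thesis by (rule that)
qed

lemma free_basis_induct:
  fixes G (structure)
  assumes "group G" "free_basis G X" "f \<in> carrier G"
    and "P \<one>"
    and "\<And>x f. x \<in> X \<Longrightarrow> f \<in> carrier G \<Longrightarrow> P f \<Longrightarrow> P (x \<otimes> f)"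
    and "\<And>x f. x \<in> X \<Longrightarrow> f \<in> carrier G \<Longrightarrow> P f \<Longrightarrow> P (inv x \<otimes> f)"
  shows "P f"
proof -
  have X: "X \<subseteq> carrier G" using assms(2) by (simp add: free_basis_def)
  obtain w where w: "w \<in> lists (X \<times> UNIV)" "word_value G w = f"
    using free_basis_words[OF assms(1-3)] .
  have "P (word_value G w)" using w(1)
  proof (induction w)
    case (Cons l w)
    then show ?case using assms(5,6) group.word_value_closed[OF assms(1) X, of w]
      by (cases l) (auto simp: word_value_Cons)
  qed (simp add: assms(4))
  then show ?thesis by (simp add: w)
qed

text \<open>Used with \<open>b\<close> in a subgroup, where invariance means that the labels live on
  the Schreier graph of the subgroup, and with arbitrary \<open>b\<close>, where it turns a cocycle
  into a homomorphism.\<close>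

lemma free_basis_cocycle_invariant:
  fixes G (structure)
  assumes G: "group G" and H: "group H" and X: "free_basis G X" and \<kappa>: "is_cocycle G H \<kappa>"
    and b: "b \<in> carrier G" and inv: "\<And>x g. x \<in> X \<Longrightarrow> g \<in> carrier G \<Longrightarrow> \<kappa> x (g \<otimes> b) = \<kappa> x g"
    and f: "f \<in> carrier G" and g: "g \<in> carrier G"
  shows "\<kappa> f (g \<otimes> b) = \<kappa> f g"
proof -
  interpret G: group G by (rule G)
  have xG: "x \<in> carrier G" if "x \<in> X" for x using that X by (auto simp: free_basis_def)
  note m = is_cocycleD(2)[OF \<kappa>] and ci = cocycle_inv[OF G H \<kappa>]
  have "\<forall>g\<in>carrier G. \<kappa> f (g \<otimes> b) = \<kappa> f g"
  proof (rule free_basis_induct[OF G X f])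
    show "\<forall>g\<in>carrier G. \<kappa> \<one> (g \<otimes> b) = \<kappa> \<one> g" using ci(1)[OF G.one_closed] b by simp
  next
    fix x f assume x: "x \<in> X" and f: "f \<in> carrier G" and IH: "\<forall>g\<in>carrier G. \<kappa> f (g \<otimes> b) = \<kappa> f g"
    show "\<forall>g\<in>carrier G. \<kappa> (x \<otimes> f) (g \<otimes> b) = \<kappa> (x \<otimes> f) g"
      using m[OF xG[OF x] f] IH inv[OF x] f b by (simp add: G.m_assoc[symmetric])
    have i: "\<kappa> (inv x) g = inv\<^bsub>H\<^esub> (\<kappa> x (inv x \<otimes> g))" if "g \<in> carrier G" for g
      using ci(2)[OF xG[OF x], of "inv x \<otimes> g"] xG[OF x] that by (simp add: G.m_assoc[symmetric])
    have "\<kappa> (inv x) (g \<otimes> b) = \<kappa> (inv x) g" if g: "g \<in> carrier G" for g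
      using inv[OF x, of "inv x \<otimes> g"] xG[OF x] g b by (simp add: i G.m_assoc)
    then show "\<forall>g\<in>carrier G. \<kappa> (inv x \<otimes> f) (g \<otimes> b) = \<kappa> (inv x \<otimes> f) g"
      using m[OF G.inv_closed[OF xG[OF x]] f] IH f b by (simp add: G.m_assoc[symmetric])
  qed
  then show ?thesis using g by blast
qed

lemma free_basis_hom:
  fixes G (structure)
  assumes G: "group G" and H: "group H" and X: "free_basis G X" and \<phi>: "\<And>x. x \<in> X \<Longrightarrow> \<phi> x \<in> carrier H"
  obtains h where "h \<in> hom G H" "\<And>x. x \<in> X \<Longrightarrow> h x = \<phi> x"
proof -
  interpret G: group G by (rule G)
  obtain \<kappa> where \<kappa>: "is_cocycle G H \<kappa>" and \<kappa>x: "\<And>x g. x \<in> X \<Longrightarrow> g \<in> carrier G \<Longrightarrow> \<kappa> x g = \<phi> x"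
    using free_basis_cocycle[OF G H X, of "\<lambda>x _. \<phi> x"] \<phi> by blast
  have inv: "\<kappa> f (\<one> \<otimes> b) = \<kappa> f \<one>" if "f \<in> carrier G" "b \<in> carrier G" for f b
    by (rule free_basis_cocycle_invariant[OF G H X \<kappa> that(2) _ that(1) G.one_closed]) (use \<kappa>x that in auto)
  have "(\<lambda>f. \<kappa> f \<one>) \<in> hom G H"
  proof (rule homI)
    fix f f' assume f: "f \<in> carrier G" "f' \<in> carrier G"
    have "\<kappa> (f \<otimes> f') \<one> = \<kappa> f f' \<otimes>\<^bsub>H\<^esub> \<kappa> f' \<one>"
      using is_cocycleD(2)[OF \<kappa> f G.one_closed] f by simp
    also have "\<kappa> f f' = \<kappa> f \<one>" using inv[OF f] f(2) by simp
    finally show "\<kappa> (f \<otimes> f') \<one> = \<kappa> f \<one> \<otimes>\<^bsub>H\<^esub> \<kappa> f' \<one>" .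
  qed (simp add: is_cocycleD(1)[OF \<kappa>])
  then show thesis by (rule that) (simp add: \<kappa>x)
qed

section \<open>Free products: induction and universal property, from normal forms\<close>

lemma list_mult_Nil [simp]: "list_mult G [] = \<one>\<^bsub>G\<^esub>"
  and list_mult_Cons [simp]: "list_mult G (x # xs) = x \<otimes>\<^bsub>G\<^esub> list_mult G xs"
  by (simp_all add: list_mult_def)

lemma internal_free_product_induct:
  fixes G (structure)
  assumes G: "group G" and AB: "internal_free_product G A B" and f: "f \<in> carrier G"
    and one: "P \<one>"
    and A: "\<And>a f. a \<in> A \<Longrightarrow> f \<in> carrier G \<Longrightarrow> P f \<Longrightarrow> P (a \<otimes> f)"
    and B: "\<And>b f. b \<in> B \<Longrightarrow> f \<in> carrier G \<Longrightarrow> P f \<Longrightarrow> P (b \<otimes> f)"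
  shows "P f"
proof -
  interpret G: group G by (rule G)
  have sub: "subgroup A G" "subgroup B G"
    and bij: "bij_betw (\<lambda>w. list_mult G (map (case_sum id id) w)) (free_product_words G A B) (carrier G)"
    using AB by (auto simp: internal_free_product_def)
  have "f \<in> (\<lambda>w. list_mult G (map (case_sum id id) w)) ` free_product_words G A B"
    using bij f by (simp add: bij_betw_def)
  then obtain w where w: "w \<in> free_product_words G A B" "f = list_mult G (map (case_sum id id) w)" by blast
  have "set w \<subseteq> A <+> B" using w(1) unfolding free_product_words_def in_lists_conv_set by auto
  then have "list_mult G (map (case_sum id id) w) \<in> carrier G \<and> P (list_mult G (map (case_sum id id) w))"
  proof (induction w)
    case (Cons s w)
    then show ?case
      using A B subgroup.mem_carrier[OF sub(1)] subgroup.mem_carrier[OF sub(2)] by auto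
  qed (simp add: one)
  then show ?thesis by (simp add: w)
qed

text \<open>The map is read off the normal form. Multiplication by an element of a factor either
  merges with the first syllable, perhaps cancelling it, or adds a new one; induction over such
  multiplications gives multiplicativity.\<close>

lemma internal_free_product_hom:
  fixes G :: "('a, 'b) monoid_scheme" (structure) and H :: "('c, 'd) monoid_scheme"
  assumes G: "group G" and H: "group H" and AB: "internal_free_product G A B"
    and \<alpha>: "\<alpha> \<in> hom (G\<lparr>carrier := A\<rparr>) H" and \<beta>: "\<beta> \<in> hom (G\<lparr>carrier := B\<rparr>) H"
  obtains h where "h \<in> hom G H" "\<And>a. a \<in> A \<Longrightarrow> h a = \<alpha> a" "\<And>b. b \<in> B \<Longrightarrow> h b = \<beta> b"
proof -
  interpret G: group G by (rule G)
  interpret H: group H by (rule H)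
  have A: "subgroup A G" and B: "subgroup B G"
    and bij: "bij_betw (\<lambda>w. list_mult G (map (case_sum id id) w)) (free_product_words G A B) (carrier G)"
    using AB by (auto simp: internal_free_product_def)
  let ?v = "\<lambda>w. list_mult G (map (case_sum id id) w)"
  let ?W = "free_product_words G A B"
  let ?p = "\<lambda>w. list_mult H (map (case_sum \<alpha> \<beta>) w)"
  define nf where "nf = inv_into ?W ?v"
  have nf: "nf f \<in> ?W" "?v (nf f) = f" if "f \<in> carrier G" for f
    using that bij unfolding nf_def bij_betw_def by (metis inv_into_into, metis f_inv_into_f)
  have nfv: "nf (?v w) = w" if "w \<in> ?W" for w
    using that bij unfolding nf_def bij_betw_def by (metis inv_into_f_f)
  have hA: "\<alpha> a \<in> carrier H" "\<alpha> (a \<otimes> a') = \<alpha> a \<otimes>\<^bsub>H\<^esub> \<alpha> a'" if "a \<in> A" "a' \<in> A" for a a'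
    using \<alpha> that by (auto simp: hom_def)
  have hB: "\<beta> b \<in> carrier H" "\<beta> (b \<otimes> b') = \<beta> b \<otimes>\<^bsub>H\<^esub> \<beta> b'" if "b \<in> B" "b' \<in> B" for b b'
    using \<beta> that by (auto simp: hom_def)
  have \<alpha>1: "\<alpha> \<one> = \<one>\<^bsub>H\<^esub>" and \<beta>1: "\<beta> \<one> = \<one>\<^bsub>H\<^esub>"
    using hA[of "\<one>" "\<one>"] hB[of "\<one>" "\<one>"] subgroup.one_closed[OF A] subgroup.one_closed[OF B] by auto
  have wp: "?p w \<in> carrier H" "?v w \<in> carrier G" if "set w \<subseteq> A <+> B" for w
    using that hA hB subgroup.mem_carrier[OF A] subgroup.mem_carrier[OF B] by (induction w) auto
  have Wset: "set w \<subseteq> A <+> B" if "w \<in> ?W" for w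
    using that unfolding free_product_words_def in_lists_conv_set by auto
  have WC: "s # w \<in> ?W \<longleftrightarrow> s \<in> (A - {\<one>}) <+> (B - {\<one>}) \<and> w \<in> ?W \<and> (w = [] \<or> isl s \<noteq> isl (hd w))" for s w
    by (auto simp: free_product_words_def successively_Cons)
  define h where "h f = ?p (nf f)" for f
  have hc: "h f \<in> carrier H" if "f \<in> carrier G" for f
    using wp(1)[OF Wset[OF nf(1)[OF that]]] by (simp add: h_def)
  \<comment> \<open>\<open>con\<close>, \<open>C\<close> and \<open>\<psi>\<close> stand for either
    of the two factors, so that one case analysis covers both.\<close>
  have step: "h (c \<otimes> f) = \<psi> c \<otimes>\<^bsub>H\<^esub> h f"
    if case': "(con = Inl \<and> C = A \<and> \<psi> = \<alpha>) \<or> (con = Inr \<and> C = B \<and> \<psi> = \<beta>)"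
      and c: "c \<in> C" and f: "f \<in> carrier G" for con :: "'a \<Rightarrow> 'a + 'a" and C \<psi> c f
  proof (cases "c = \<one>")
    case True
    then show ?thesis using case' \<alpha>1 \<beta>1 f hc[OF f] by auto
  next
    case False
    have C: "subgroup C G" using case' A B by auto
    note CG = subgroup.mem_carrier[OF C]
    have conv: "case_sum id id (con x) = x" "case_sum \<alpha> \<beta> (con x) = \<psi> x" "isl (con x) = isl (con y)" for x y
      using case' by auto
    have conmem: "con x \<in> (A - {\<one>}) <+> (B - {\<one>}) \<longleftrightarrow> x \<in> C - {\<one>}" for x
      using case' by auto
    have \<psi>: "\<psi> x \<in> carrier H" "\<psi> (x \<otimes> y) = \<psi> x \<otimes>\<^bsub>H\<^esub> \<psi> y" if "x \<in> C" "y \<in> C" for x y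
      using case' that hA hB by auto
    have \<psi>1: "\<psi> \<one> = \<one>\<^bsub>H\<^esub>" using case' \<alpha>1 \<beta>1 by auto
    show ?thesis
    proof (cases "nf f \<noteq> [] \<and> isl (hd (nf f)) = isl (con c)")
      case True
      then obtain t w where w: "nf f = t # w" "isl t = isl (con c)" by (cases "nf f") auto
      have tw: "t \<in> (A - {\<one>}) <+> (B - {\<one>})" "w \<in> ?W" "w = [] \<or> isl t \<noteq> isl (hd w)"
        using nf(1)[OF f] unfolding w WC by auto
      obtain c' where c': "t = con c'" using w(2) case' by (cases t) auto
      have c'C: "c' \<in> C" "c' \<noteq> \<one>" using tw(1) unfolding c' conmem by auto
      have wG: "?v w \<in> carrier G" "?p w \<in> carrier H" using wp Wset[OF tw(2)] by auto
      have fe: "f = c' \<otimes> ?v w" using nf(2)[OF f] by (simp add: w(1) c' conv)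
      have hf: "h f = \<psi> c' \<otimes>\<^bsub>H\<^esub> ?p w" by (simp add: h_def w(1) c' conv)
      have cf: "c \<otimes> f = (c \<otimes> c') \<otimes> ?v w"
        unfolding fe using CG[OF c] CG[OF c'C(1)] wG by (simp add: G.m_assoc)
      have rhs: "\<psi> c \<otimes>\<^bsub>H\<^esub> h f = \<psi> (c \<otimes> c') \<otimes>\<^bsub>H\<^esub> ?p w"
        unfolding hf using \<psi>[OF c c'C(1)] \<psi>(1)[OF c'C(1) c'C(1)] wG by (simp add: H.m_assoc)
      show ?thesis
      proof (cases "c \<otimes> c' = \<one>")
        case True
        have "h (c \<otimes> f) = ?p w" unfolding cf True h_def using wG nfv[OF tw(2)] by simp
        then show ?thesis unfolding rhs True \<psi>1 using wG by simp
      next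
        case False
        have "con (c \<otimes> c') # w \<in> ?W"
          unfolding WC conmem using False tw c c'C subgroup.m_closed[OF C] w(2) conv(3)[of "c \<otimes> c'" c] by auto
        from nfv[OF this] have "nf (c \<otimes> f) = con (c \<otimes> c') # w" unfolding cf by (simp add: conv)
        then have "h (c \<otimes> f) = \<psi> (c \<otimes> c') \<otimes>\<^bsub>H\<^esub> ?p w" by (simp add: h_def conv)
        then show ?thesis unfolding rhs .
      qed
    next
      case False': False
      have "con c # nf f \<in> ?W"
        unfolding WC conmem using False False' c nf(1)[OF f] by auto
      from nfv[OF this] have "nf (c \<otimes> f) = con c # nf f" using nf(2)[OF f] by (simp add: conv)
      then show ?thesis by (simp add: h_def conv)
    qed
  qed
  have stepA: "h (a \<otimes> f) = \<alpha> a \<otimes>\<^bsub>H\<^esub> h f" if "a \<in> A" "f \<in> carrier G" for a f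
    by (rule step[of Inl A]) (use that in auto)
  have stepB: "h (b \<otimes> f) = \<beta> b \<otimes>\<^bsub>H\<^esub> h f" if "b \<in> B" "f \<in> carrier G" for b f
    by (rule step[of Inr B]) (use that in auto)
  have "[] \<in> ?W" by (simp add: free_product_words_def)
  then have h1: "h \<one> = \<one>\<^bsub>H\<^esub>" using nfv[of "[]"] by (simp add: h_def)
  have mult: "h (f \<otimes> g) = h f \<otimes>\<^bsub>H\<^esub> h g" if f: "f \<in> carrier G" and g: "g \<in> carrier G" for f g
  proof (rule internal_free_product_induct[OF G AB f])
    show "h (\<one> \<otimes> g) = h \<one> \<otimes>\<^bsub>H\<^esub> h g" using h1 g hc by simp
  next
    fix a f assume a: "a \<in> A" and f: "f \<in> carrier G" and IH: "h (f \<otimes> g) = h f \<otimes>\<^bsub>H\<^esub> h g"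
    have "h (a \<otimes> f \<otimes> g) = h (a \<otimes> (f \<otimes> g))"
      using subgroup.mem_carrier[OF A a] f g by (simp add: G.m_assoc)
    then show "h (a \<otimes> f \<otimes> g) = h (a \<otimes> f) \<otimes>\<^bsub>H\<^esub> h g"
      using stepA[OF a f] stepA[OF a G.m_closed[OF f g]] IH hA(1)[OF a a] hc f g by (simp add: H.m_assoc)
  next
    fix b f assume b: "b \<in> B" and f: "f \<in> carrier G" and IH: "h (f \<otimes> g) = h f \<otimes>\<^bsub>H\<^esub> h g"
    have "h (b \<otimes> f \<otimes> g) = h (b \<otimes> (f \<otimes> g))"
      using subgroup.mem_carrier[OF B b] f g by (simp add: G.m_assoc)
    then show "h (b \<otimes> f \<otimes> g) = h (b \<otimes> f) \<otimes>\<^bsub>H\<^esub> h g"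
      using stepB[OF b f] stepB[OF b G.m_closed[OF f g]] IH hB(1)[OF b b] hc f g by (simp add: H.m_assoc)
  qed
  show thesis
  proof (rule that)
    show "h \<in> hom G H" using hc mult by (intro homI) auto
    show "h a = \<alpha> a" if "a \<in> A" for a
      using stepA[OF that G.one_closed] h1 subgroup.mem_carrier[OF A that] hA(1)[OF that that] by simp
    show "h b = \<beta> b" if "b \<in> B" for b
      using stepB[OF that G.one_closed] h1 subgroup.mem_carrier[OF B that] hB(1)[OF that that] by simp
  qed
qed

text \<open>An edge \<open>(x\<^sub>0, u\<^sub>0 B)\<close> of the Schreier graph of \<open>B\<close> that is not a bridge: the middle edge of a
  shortest essential loop is avoided by the two halves of the loop.\<close>

definition avoids :: "('a, 'b) monoid_scheme \<Rightarrow> 'a set \<Rightarrow> 'a \<Rightarrow> 'a \<Rightarrow> ('a \<times> bool) list \<Rightarrow> bool" where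
  "avoids G B x\<^sub>0 u\<^sub>0 w \<longleftrightarrow> (\<forall>p e q. w = p @ (x\<^sub>0, e) # q \<longrightarrow>
     inv\<^bsub>G\<^esub> u\<^sub>0 \<otimes>\<^bsub>G\<^esub> (if e then word_value G q else inv\<^bsub>G\<^esub> x\<^sub>0 \<otimes>\<^bsub>G\<^esub> word_value G q) \<notin> B)"

text \<open>If \<open>u\<close> used the edge, some tail \<open>s\<close> of \<open>u\<close> would
  end at the same vertex of the Schreier graph as \<open>u\<close>. If \<open>s\<close> is shorter,
  the loop formed by \<open>s\<close> and the inverse of \<open>u\<close> is shorter than the
  minimal one, hence trivial in \<open>G\<close>, and replacing \<open>u\<close> by \<open>s\<close>
  shortens the minimal loop. If \<open>s = u\<close>, then \<open>u\<close> begins with the inverse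
  of the middle letter, which cancels.\<close>

lemma shortest_loop_half:
  fixes G (structure)
  assumes G: "group G" and XG: "X \<subseteq> carrier G" and B: "subgroup B G"
    and w: "v @ (x, e) # u \<in> lists (X \<times> UNIV)" and len: "2 * length u \<le> length (v @ (x, e) # u)"
    and ne: "word_value G (v @ (x, e) # u) \<noteq> \<one>"
    and val: "word_value G (v @ (x, e) # u) \<in> B"
    and min: "\<And>w'. w' \<in> lists (X \<times> UNIV) \<Longrightarrow> word_value G w' \<in> B \<Longrightarrow> word_value G w' \<noteq> \<one> \<Longrightarrow>
      length (v @ (x, e) # u) \<le> length w'"
  shows "avoids G B x (if e then word_value G u else inv x \<otimes> word_value G u) u"
  unfolding avoids_def
proof (intro allI impI notI)
  interpret G: group G by (rule G)
  fix p e' q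
  let ?u0 = "if e then word_value G u else inv x \<otimes> word_value G u"
  assume u: "u = p @ (x, e') # q"
    and mem: "inv ?u0 \<otimes> (if e' then word_value G q else inv x \<otimes> word_value G q) \<in> B"
  have lists: "v \<in> lists (X \<times> UNIV)" "p \<in> lists (X \<times> UNIV)" "q \<in> lists (X \<times> UNIV)" "u \<in> lists (X \<times> UNIV)" "x \<in> X"
    using w unfolding u by auto
  have x: "x \<in> carrier G" using lists XG by blast
  note wc = G.word_value_closed[OF XG]
  note vq = wc[OF lists(3)] and vu = wc[OF lists(4)] and vv = wc[OF lists(1)]
  \<comment> \<open>A traversal in the same direction starts at the vertex in question, so the tail
    is \<open>q\<close>; one in the opposite direction ends there, so its letter belongs to the
    tail.\<close>
  define s where "s = (if e' = e then q else (x, e') # q)"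
  have s: "s \<in> lists (X \<times> UNIV)" using lists by (auto simp: s_def)
  have valB: "inv (word_value G u) \<otimes> word_value G s \<in> B"
    using mem x vq vu unfolding s_def
    by (cases e; cases e') (simp_all add: word_value_Cons G.inv_mult_group G.m_assoc G.m_assoc[symmetric, of x "inv x"])
  have short: False if r: "r \<in> lists (X \<times> UNIV)" "length r < length (v @ (x, e) # u)"
    "word_value G r = word_value G (v @ (x, e) # u)" for r
    using min[OF r(1)] val ne r by simp
  have su: "word_value G s = word_value G u" if "s \<noteq> u"
  proof (rule ccontr)
    assume neq: "word_value G s \<noteq> word_value G u"
    have "length s < length u" using that unfolding s_def u by (cases p) (auto split: if_splits)
    let ?r = "inv_word u @ s"
    have "word_value G ?r = inv (word_value G u) \<otimes> word_value G s"
      using G.word_value_append[OF XG inv_word_in_lists[OF lists(4)] s] G.word_value_inv_word[OF XG lists(4)] by simp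
    moreover have "inv (word_value G u) \<otimes> word_value G s \<noteq> \<one>"
      using neq vu wc[OF s] by (metis G.inv_equality G.inv_inv G.inv_closed)
    ultimately have "length (v @ (x, e) # u) \<le> length ?r"
      using min[of ?r] valB inv_word_in_lists[OF lists(4)] s by simp
    then show False using len \<open>length s < length u\<close> by simp
  qed
  show False
  proof (cases "s = u")
    case True
    then have "u = (x, \<not> e) # q" unfolding s_def u by (cases p) (auto split: if_splits)
    then have "word_value G (v @ (x, e) # u) = word_value G (v @ q)"
      using G.word_value_append[OF XG lists(1)] lists x vq vv
      by (cases e) (simp_all add: word_value_Cons G.m_assoc[symmetric])
    then show False using short[of "v @ q"] lists u by simp
  next
    case False
    have "length s < length u" using False unfolding s_def u by (cases p) (auto split: if_splits)
    have "word_value G (v @ (x, e) # s) = word_value G (v @ (x, e) # u)"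
      using G.word_value_append[OF XG lists(1), of "(x, e) # s"] G.word_value_append[OF XG lists(1), of "(x, e) # u"]
        lists s su[OF False] by (simp add: word_value_Cons)
    then show False using short[of "v @ (x, e) # s"] lists s \<open>length s < length u\<close> by simp
  qed
qed

text \<open>\<open>w\<^sub>0\<close> and \<open>w\<^sub>1\<close> lead from the base vertex to the
  two ends of the middle edge. The second is the other half of the loop, reversed, so
  \<open>shortest_loop_half\<close> is applied to the loop and to its inverse. A loop whose middle
  letter is an inverse is inverted first.\<close>

lemma nonbridge_edge:
  fixes G (structure)
  assumes G: "group G" and X: "free_basis G X" and B: "subgroup B G" and nt: "b \<in> B" "b \<noteq> \<one>"
  obtains x\<^sub>0 w\<^sub>0 w\<^sub>1 where "x\<^sub>0 \<in> X" "w\<^sub>0 \<in> lists (X \<times> UNIV)" "w\<^sub>1 \<in> lists (X \<times> UNIV)"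
    "inv (word_value G w\<^sub>1) \<otimes> x\<^sub>0 \<otimes> word_value G w\<^sub>0 \<in> B"
    "avoids G B x\<^sub>0 (word_value G w\<^sub>0) w\<^sub>0" "avoids G B x\<^sub>0 (word_value G w\<^sub>0) w\<^sub>1"
proof -
  note result = that
  interpret G: group G by (rule G)
  have XG: "X \<subseteq> carrier G" using X by (simp add: free_basis_def)
  note wc = G.word_value_closed[OF XG] and BG = subgroup.mem_carrier[OF B]
  define ok where "ok w \<longleftrightarrow> w \<in> lists (X \<times> UNIV) \<and> word_value G w \<in> B \<and> word_value G w \<noteq> \<one>" for w
  obtain w where "w \<in> lists (X \<times> UNIV)" "word_value G w = b" using free_basis_words[OF G X BG[OF nt(1)]] .
  then have "ok w" using nt by (simp add: ok_def)
  then obtain w where w: "ok w" and min: "\<And>w'. ok w' \<Longrightarrow> length w \<le> length w'"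
    using exists_least_iff[of "\<lambda>n. \<exists>w. ok w \<and> length w = n"] by (metis not_le)
  have main: thesis if ok: "ok (v @ (x, True) # u)" and l: "length (v @ (x, True) # u) = length w"
      "2 * length u \<le> length w" "2 * length v \<le> length w" for v x u
  proof -
    have lists: "v @ (x, True) # u \<in> lists (X \<times> UNIV)" "v \<in> lists (X \<times> UNIV)" "u \<in> lists (X \<times> UNIV)" "x \<in> X"
      using ok by (auto simp: ok_def)
    have x: "x \<in> carrier G" using lists XG by blast
    note vu = wc[OF lists(3)] and vv = wc[OF lists(2)]
    let ?b = "word_value G (v @ (x, True) # u)"
    have bB: "?b \<in> B" "?b \<noteq> \<one>" using ok by (auto simp: ok_def)
    have be: "?b = word_value G v \<otimes> x \<otimes> word_value G u"
      using G.word_value_append[OF XG lists(2), of "(x, True) # u"] lists x vu vv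
      by (simp add: word_value_Cons G.m_assoc)
    have iw: "inv_word (v @ (x, True) # u) = inv_word u @ (x, False) # inv_word v" by (simp add: inv_word_def)
    let ?w1 = "inv_word v"
    have w1: "word_value G ?w1 = inv (word_value G v)" by (rule G.word_value_inv_word[OF XG lists(2)])
    have ival: "word_value G (inv_word u @ (x, False) # ?w1) = inv ?b"
      unfolding iw[symmetric] by (rule G.word_value_inv_word[OF XG lists(1)])
    have a0: "avoids G B x (word_value G u) u"
      using shortest_loop_half[OF G XG B lists(1)] l bB min by (simp add: ok_def)
    have "avoids G B x (if False then word_value G ?w1 else inv x \<otimes> word_value G ?w1) ?w1"
    proof (rule shortest_loop_half[OF G XG B, where v = "inv_word u"])
      show "inv_word u @ (x, False) # ?w1 \<in> lists (X \<times> UNIV)"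
        unfolding iw[symmetric] by (rule inv_word_in_lists[OF lists(1)])
      show "2 * length ?w1 \<le> length (inv_word u @ (x, False) # ?w1)" using l by simp
      show "word_value G (inv_word u @ (x, False) # ?w1) \<noteq> \<one>"
        unfolding ival using bB BG by (metis G.inv_inv G.inv_one)
      show "word_value G (inv_word u @ (x, False) # ?w1) \<in> B"
        unfolding ival by (rule subgroup.m_inv_closed[OF B bB(1)])
      show "length (inv_word u @ (x, False) # ?w1) \<le> length w'" if "w' \<in> lists (X \<times> UNIV)"
        "word_value G w' \<in> B" "word_value G w' \<noteq> \<one>" for w'
        using min[of w'] that l by (simp add: ok_def)
    qed
    then have a1': "avoids G B x (inv x \<otimes> word_value G ?w1) ?w1" by simp
    \<comment> \<open>Reached along the reversed loop, the start of the middle edge is another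
      representative of the same left coset of \<open>B\<close>.\<close>
    have e: "inv (word_value G u) = inv ?b \<otimes> inv (inv x \<otimes> word_value G ?w1)"
      unfolding be w1 using x vu vv by (simp add: G.inv_mult_group G.m_assoc G.m_assoc[symmetric, of "inv x" x] G.m_assoc[symmetric, of "inv (word_value G v)" "word_value G v"])
    have a1: "avoids G B x (word_value G u) ?w1"
      unfolding avoids_def
    proof (intro allI impI notI)
      fix p e' q
      let ?s = "if e' then word_value G q else inv x \<otimes> word_value G q"
      assume pq: "?w1 = p @ (x, e') # q" and mem: "inv (word_value G u) \<otimes> ?s \<in> B"
      have "q \<in> lists (X \<times> UNIV)" using inv_word_in_lists[OF lists(2)] unfolding pq by simp
      then have s: "?s \<in> carrier G" using wc x by simp
      let ?t = "inv x \<otimes> word_value G ?w1"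
      have t: "?t \<in> carrier G" unfolding w1 using x vv by simp
      have "?b \<otimes> (inv (word_value G u) \<otimes> ?s) = inv ?t \<otimes> ?s"
        unfolding e using t s BG[OF bB(1)] by (simp add: G.m_assoc[symmetric])
      moreover have "?b \<otimes> (inv (word_value G u) \<otimes> ?s) \<in> B"
        by (rule subgroup.m_closed[OF B bB(1) mem])
      ultimately show False using a1' pq unfolding avoids_def by auto
    qed
    show thesis
    proof (rule result[OF lists(4) lists(3) inv_word_in_lists[OF lists(2)] _ a0 a1])
      show "inv (word_value G ?w1) \<otimes> x \<otimes> word_value G u \<in> B"
        using bB(1) unfolding be w1 using vv by simp
    qed
  qed
  define m where "m = length w"
  have "w \<noteq> []" using w by (auto simp: ok_def)
  then have m: "m > 0" by (simp add: m_def)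
  \<comment> \<open>Position of the middle letter: the right half has length
    \<open>(m - 1) div 2\<close> and the left half at most one more, so that twice either length is
    at most \<open>m\<close>.\<close>
  define k where "k = m - 1 - (m - 1) div 2"
  have k: "k < m" using m by (simp add: k_def)
  obtain x e where xe: "w ! k = (x, e)" by (cases "w ! k")
  have dec: "w = take k w @ (x, e) # drop (Suc k) w"
    using id_take_nth_drop[of k w] k xe by (simp add: m_def)
  define v u where "v = take k w" and "u = drop (Suc k) w"
  have vu: "length v = k" "length u = m - Suc k" using k by (auto simp: v_def u_def m_def)
  have l: "2 * length u \<le> length w" "2 * length v \<le> length w"
    unfolding vu using m by (auto simp: k_def m_def[symmetric])
  have wd: "w = v @ (x, e) # u" using dec by (simp add: v_def u_def)
  show thesis
  proof (cases e)
    case True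
    then show thesis using main[of v x u] w l wd by simp
  next
    case False
    have "ok (inv_word w)"
      using w G.word_value_inv_word[OF XG, of w] inv_word_in_lists[of w X] subgroup.m_inv_closed[OF B] BG
      unfolding ok_def by (metis G.inv_inv G.inv_one)
    moreover have "inv_word w = inv_word u @ (x, True) # inv_word v" using False by (simp add: wd inv_word_def)
    ultimately show thesis using main[of "inv_word u" x "inv_word v"] l wd by simp
  qed
qed

section \<open>Transvections along a free factor\<close>

text \<open>With \<open>a \<otimes> z\<close> instead of \<open>inv a \<otimes> z\<close> the last
  clause would be inconsistent in general, as the composition of \<open>\<alpha> a\<close> and
  \<open>\<alpha> b\<close> would reverse the order of \<open>a\<close> and
  \<open>b\<close>.\<close>

definition transvections :: "('a, 'b) monoid_scheme \<Rightarrow> 'a set \<Rightarrow> 'a \<Rightarrow> ('a \<Rightarrow> 'a \<Rightarrow> 'a) \<Rightarrow> bool" where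
  "transvections G A z \<alpha> \<longleftrightarrow> z \<in> carrier G \<and> (\<forall>a\<in>A. \<alpha> a \<in> hom G G) \<and> (\<forall>a\<in>A. \<forall>c\<in>A. \<alpha> a c = c) \<and>
     (\<forall>a\<in>A. \<alpha> a z = inv\<^bsub>G\<^esub> a \<otimes>\<^bsub>G\<^esub> z) \<and> (\<forall>f\<in>carrier G. \<alpha> \<one>\<^bsub>G\<^esub> f = f) \<and>
     (\<forall>a\<in>A. \<forall>b\<in>A. \<forall>f\<in>carrier G. \<alpha> a (\<alpha> b f) = \<alpha> (a \<otimes>\<^bsub>G\<^esub> b) f)"

lemma hom_equalizer_subgroup:
  assumes "group G" "group H" "h \<in> hom G H" "k \<in> hom G H"
  shows "subgroup {f \<in> carrier G. h f = k f} G"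
proof -
  interpret h: group_hom G H h using assms by (simp add: group_hom_def group_hom_axioms_def)
  interpret k: group_hom G H k using assms by (simp add: group_hom_def group_hom_axioms_def)
  show ?thesis by (rule h.G.subgroupI) auto
qed

lemma transvections_subgroup:
  fixes G (structure)
  assumes G: "group G" and A: "subgroup A G" and hom: "\<And>a. a \<in> A \<Longrightarrow> \<alpha> a \<in> hom G G"
  shows "subgroup {f \<in> carrier G. \<alpha> \<one> f = f \<and> (\<forall>a\<in>A. \<forall>b\<in>A. \<alpha> a (\<alpha> b f) = \<alpha> (a \<otimes> b) f)} G"
proof -
  interpret G: group G by (rule G)
  have *: "\<alpha> a (f \<otimes> g) = \<alpha> a f \<otimes> \<alpha> a g" "\<alpha> a f \<in> carrier G" "\<alpha> a (inv f) = inv (\<alpha> a f)"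
    "\<alpha> a \<one> = \<one>"
    if "a \<in> A" "f \<in> carrier G" "g \<in> carrier G" for a f g
  proof -
    interpret h: group_hom G G "\<alpha> a" using hom[OF that(1)] G by (simp add: group_hom_def group_hom_axioms_def)
    show "\<alpha> a (f \<otimes> g) = \<alpha> a f \<otimes> \<alpha> a g" "\<alpha> a f \<in> carrier G" "\<alpha> a (inv f) = inv (\<alpha> a f)"
      "\<alpha> a \<one> = \<one>" using that by auto
  qed
  note A1 = subgroup.one_closed[OF A] and Am = subgroup.m_closed[OF A]
  have one: "\<alpha> a \<one> = \<one>" if "a \<in> A" for a
    using *(4)[OF that G.one_closed G.one_closed] .
  show ?thesis
    by (rule subgroup.intro) (auto simp: *(1-3) one A1 Am)
qed

text \<open>Twisted holonomy is a homomorphism \<open>\<theta> a\<close> on \<open>B\<close>, and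
  \<open>\<alpha> a\<close> is glued from the identity on \<open>A\<close> and
  \<open>\<theta> a\<close>. Multiplicativity in \<open>a\<close> is clear on \<open>A\<close>, on
  \<open>z\<close> and on elements of \<open>B\<close> with untwisted holonomy; the main work is to
  show that \<open>B\<close> is generated by the latter two kinds.\<close>

lemma free_factor_transvections:
  fixes G (structure)
  assumes G: "group G" and X: "free_basis G X" and AB: "internal_free_product G A B" and proper: "A \<noteq> carrier G"
  shows "\<exists>z \<alpha>. transvections G A z \<alpha>"
proof -
  interpret G: group G by (rule G)
  have A: "subgroup A G" and B: "subgroup B G" using AB by (auto simp: internal_free_product_def)
  have XG: "X \<subseteq> carrier G" using X by (simp add: free_basis_def)
  note AG = subgroup.mem_carrier[OF A] and BG = subgroup.mem_carrier[OF B]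
  have "\<exists>b\<in>B. b \<noteq> \<one>"
  proof (rule ccontr)
    assume nt: "\<not> ?thesis"
    have "f \<in> A" if "f \<in> carrier G" for f
      by (rule internal_free_product_induct[OF G AB that])
        (use nt subgroup.one_closed[OF A] subgroup.m_closed[OF A] in auto)
    then show False using proper AG by blast
  qed
  then obtain b\<^sub>0 where b\<^sub>0: "b\<^sub>0 \<in> B" "b\<^sub>0 \<noteq> \<one>" by blast
  obtain x\<^sub>0 w\<^sub>0 w\<^sub>1 where x\<^sub>0: "x\<^sub>0 \<in> X" and w: "w\<^sub>0 \<in> lists (X \<times> UNIV)" "w\<^sub>1 \<in> lists (X \<times> UNIV)"
    and zB: "inv (word_value G w\<^sub>1) \<otimes> x\<^sub>0 \<otimes> word_value G w\<^sub>0 \<in> B"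
    and av: "avoids G B x\<^sub>0 (word_value G w\<^sub>0) w\<^sub>0" "avoids G B x\<^sub>0 (word_value G w\<^sub>0) w\<^sub>1"
    by (rule nonbridge_edge[OF G X B b\<^sub>0])
  define u\<^sub>0 u\<^sub>1 where "u\<^sub>0 = word_value G w\<^sub>0" and "u\<^sub>1 = word_value G w\<^sub>1"
  have x\<^sub>0G: "x\<^sub>0 \<in> carrier G" using x\<^sub>0 XG by blast
  have u: "u\<^sub>0 \<in> carrier G" "u\<^sub>1 \<in> carrier G" using w G.word_value_closed[OF XG] by (auto simp: u\<^sub>0_def u\<^sub>1_def)
  define z where "z = inv u\<^sub>1 \<otimes> x\<^sub>0 \<otimes> u\<^sub>0"
  have z: "z \<in> B" "z \<in> carrier G" using zB BG by (auto simp: z_def u\<^sub>0_def u\<^sub>1_def)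
  define edge where "edge x g \<longleftrightarrow> x = x\<^sub>0 \<and> inv u\<^sub>0 \<otimes> g \<in> B" for x g
  \<comment> \<open>Twisting the tautological holonomy \<open>x\<close> along a single edge of the Schreier graph of \<open>B\<close>, off the
    paths to its two ends, multiplies the loop \<open>z \<in> B\<close> through this edge by \<open>a\<inverse>\<close>.\<close>
  define c where "c a x g = (if edge x g then u\<^sub>1 \<otimes> inv a \<otimes> inv u\<^sub>1 \<otimes> x else x)" for a x g
  have "\<exists>\<kappa>. is_cocycle G G \<kappa> \<and> (\<forall>x\<in>X. \<forall>g\<in>carrier G. \<kappa> x g = c a x g)" if "a \<in> carrier G" for a
  proof -
    have "c a x g \<in> carrier G" if "x \<in> X" "g \<in> carrier G" for x g
      using that \<open>a \<in> carrier G\<close> u XG by (auto simp: c_def)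
    then show ?thesis using free_basis_cocycle[OF G G X, of "c a"] by metis
  qed
  then obtain \<kappa> where \<kappa>: "\<And>a. a \<in> carrier G \<Longrightarrow> is_cocycle G G (\<kappa> a)"
    and \<kappa>x: "\<And>a x g. a \<in> carrier G \<Longrightarrow> x \<in> X \<Longrightarrow> g \<in> carrier G \<Longrightarrow> \<kappa> a x g = c a x g"
    by metis
  note \<kappa>c = is_cocycleD(1)[OF \<kappa>] and \<kappa>m = is_cocycleD(2)[OF \<kappa>] and \<kappa>i = cocycle_inv[OF G G \<kappa>]
  have Bshift: "inv u\<^sub>0 \<otimes> (g \<otimes> b) \<in> B \<longleftrightarrow> inv u\<^sub>0 \<otimes> g \<in> B" if "b \<in> B" "g \<in> carrier G" for g b
  proof
    assume 1: "inv u\<^sub>0 \<otimes> (g \<otimes> b) \<in> B"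
    have "inv u\<^sub>0 \<otimes> (g \<otimes> b) \<otimes> inv b = inv u\<^sub>0 \<otimes> g"
      using that BG u by (simp add: G.m_assoc)
    then show "inv u\<^sub>0 \<otimes> g \<in> B"
      using subgroup.m_closed[OF B 1 subgroup.m_inv_closed[OF B that(1)]] by simp
  next
    assume 1: "inv u\<^sub>0 \<otimes> g \<in> B"
    show "inv u\<^sub>0 \<otimes> (g \<otimes> b) \<in> B"
      using subgroup.m_closed[OF B 1 that(1)] that BG u by (simp add: G.m_assoc)
  qed
  \<comment> \<open>The twisted set of edges is invariant under right translation by
    \<open>B\<close>, so the labels descend to the Schreier graph and holonomy is multiplicative on
    \<open>B\<close>.\<close>
  have \<kappa>B: "\<kappa> a f (g \<otimes> b) = \<kappa> a f g" if a: "a \<in> carrier G" and b: "b \<in> B" and fg: "f \<in> carrier G" "g \<in> carrier G" for a b f g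
  proof (rule free_basis_cocycle_invariant[OF G G X \<kappa>[OF a] BG[OF b] _ fg])
    fix x g assume "x \<in> X" "g \<in> carrier G"
    then show "\<kappa> a x (g \<otimes> b) = \<kappa> a x g"
      using \<kappa>x[OF a] BG[OF b] Bshift[OF b] by (simp add: c_def edge_def)
  qed
  \<comment> \<open>Off the twisted edge the label of \<open>x\<close> is \<open>x\<close> itself,
    so the holonomy of an avoiding path is the value of its word.\<close>
  have path: "\<kappa> a (word_value G w) \<one> = word_value G w"
    if a: "a \<in> carrier G" and "w \<in> lists (X \<times> UNIV)" "avoids G B x\<^sub>0 u\<^sub>0 w" for a w
    using that(2,3)
  proof (induction w rule: list.induct)
    case Nil
    then show ?case using \<kappa>i(1)[OF a G.one_closed G.one_closed] by simp
  next
    case (Cons l w)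
    obtain x e where l: "l = (x, e)" "x \<in> X" using Cons by auto
    have xG: "x \<in> carrier G" using l XG by blast
    have wl: "w \<in> lists (X \<times> UNIV)" using Cons by simp
    note wG = G.word_value_closed[OF XG wl]
    have "avoids G B x\<^sub>0 u\<^sub>0 w" using Cons.prems(2) unfolding avoids_def by (metis append_Cons)
    then have IH: "\<kappa> a (word_value G w) \<one> = word_value G w" using Cons.IH wl by blast
    have ne: "\<not> edge x (if e then word_value G w else inv x \<otimes> word_value G w)"
      using Cons.prems(2) l unfolding avoids_def edge_def by (metis append_Nil)
    have k: "\<kappa> a (if e then x else inv x) (word_value G w) = (if e then x else inv x)"
    proof (cases e)
      case True
      then show ?thesis using \<kappa>x[OF a l(2) wG] ne by (simp add: c_def)
    next
      case False
      have "\<kappa> a (inv x) (x \<otimes> (inv x \<otimes> word_value G w)) = inv (\<kappa> a x (inv x \<otimes> word_value G w))"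
        by (rule \<kappa>i(2)[OF a xG]) (use xG wG in simp)
      moreover have "\<kappa> a x (inv x \<otimes> word_value G w) = x"
        using \<kappa>x[OF a l(2), of "inv x \<otimes> word_value G w"] ne False xG wG by (simp add: c_def)
      ultimately show ?thesis using False xG wG by (simp add: G.m_assoc[symmetric])
    qed
    have "\<kappa> a (word_value G (l # w)) \<one> = \<kappa> a (if e then x else inv x) (word_value G w) \<otimes> \<kappa> a (word_value G w) \<one>"
      unfolding l word_value_Cons using \<kappa>m[OF a, of "if e then x else inv x" "word_value G w" "\<one>"] xG wG by simp
    then show ?case unfolding k IH l word_value_Cons .
  qed
  have good0: "\<kappa> a u\<^sub>0 \<one> = u\<^sub>0" "\<kappa> a u\<^sub>1 \<one> = u\<^sub>1" if "a \<in> carrier G" for a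
    using path[OF that w(1)] path[OF that w(2)] av by (auto simp: u\<^sub>0_def u\<^sub>1_def)
  have goodB: "\<kappa> a (inv v \<otimes> f) \<one> = inv v \<otimes> f"
    if a: "a \<in> carrier G" and v: "v \<in> carrier G" "\<kappa> a v \<one> = v" and f: "f \<in> carrier G" "\<kappa> a f \<one> = f"
      and vf: "inv v \<otimes> f \<in> B" for a v f
  proof -
    have "\<kappa> a (inv v \<otimes> f) \<one> = \<kappa> a (inv v) f \<otimes> f"
      using \<kappa>m[OF a, of "inv v" f "\<one>"] v f by simp
    also have "\<kappa> a (inv v) f = \<kappa> a (inv v) (v \<otimes> (inv v \<otimes> f))"
      using v f by (simp add: G.m_assoc[symmetric])
    also have "\<dots> = \<kappa> a (inv v) v" by (rule \<kappa>B[OF a vf]) (use v in auto)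
    also have "\<dots> = inv v" using \<kappa>i(2)[OF a v(1) G.one_closed] v by simp
    finally show ?thesis .
  qed
  define \<theta> where "\<theta> a b = \<kappa> a b \<one>" for a b
  have \<theta>hom: "\<theta> a \<in> hom (G\<lparr>carrier := B\<rparr>) G" if a: "a \<in> carrier G" for a
  proof (rule homI)
    fix b b' assume "b \<in> carrier (G\<lparr>carrier := B\<rparr>)" "b' \<in> carrier (G\<lparr>carrier := B\<rparr>)"
    then have bb: "b \<in> B" "b' \<in> B" by auto
    have "\<kappa> a (b \<otimes> b') \<one> = \<kappa> a b (\<one> \<otimes> b') \<otimes> \<kappa> a b' \<one>"
      using \<kappa>m[OF a BG[OF bb(1)] BG[OF bb(2)] G.one_closed] BG[OF bb(2)] by simp
    then show "\<theta> a (b \<otimes>\<^bsub>G\<lparr>carrier := B\<rparr>\<^esub> b') = \<theta> a b \<otimes> \<theta> a b'"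
      using \<kappa>B[OF a bb(2) BG[OF bb(1)] G.one_closed] by (simp add: \<theta>_def)
  qed (use \<kappa>c[OF a] BG in \<open>auto simp: \<theta>_def\<close>)
  have \<theta>z: "\<theta> a z = inv a \<otimes> z" if a: "a \<in> carrier G" for a
  proof -
    have x\<^sub>0u\<^sub>0: "x\<^sub>0 \<otimes> u\<^sub>0 = u\<^sub>1 \<otimes> z"
      unfolding z_def using x\<^sub>0G u by (simp add: G.m_assoc G.m_assoc[symmetric, of u\<^sub>1 "inv u\<^sub>1"])
    have "\<theta> a z = \<kappa> a (inv u\<^sub>1) (x\<^sub>0 \<otimes> u\<^sub>0) \<otimes> (\<kappa> a x\<^sub>0 u\<^sub>0 \<otimes> \<kappa> a u\<^sub>0 \<one>)"
    proof -
      have "z = inv u\<^sub>1 \<otimes> (x\<^sub>0 \<otimes> u\<^sub>0)" unfolding z_def using x\<^sub>0G u by (simp add: G.m_assoc)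
      then show ?thesis unfolding \<theta>_def
        using \<kappa>m[OF a G.inv_closed[OF u(2)] G.m_closed[OF x\<^sub>0G u(1)] G.one_closed]
          \<kappa>m[OF a x\<^sub>0G u(1) G.one_closed] x\<^sub>0G u by simp
    qed
    also have "\<kappa> a (inv u\<^sub>1) (x\<^sub>0 \<otimes> u\<^sub>0) = \<kappa> a (inv u\<^sub>1) u\<^sub>1"
      unfolding x\<^sub>0u\<^sub>0 by (rule \<kappa>B[OF a z(1)]) (use u in auto)
    also have "\<dots> = inv u\<^sub>1" using \<kappa>i(2)[OF a u(2) G.one_closed] u good0(2)[OF a] by simp
    also have "\<kappa> a u\<^sub>0 \<one> = u\<^sub>0" by (rule good0(1)[OF a])
    also have "\<kappa> a x\<^sub>0 u\<^sub>0 = u\<^sub>1 \<otimes> inv a \<otimes> inv u\<^sub>1 \<otimes> x\<^sub>0"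
      using \<kappa>x[OF a x\<^sub>0 u(1)] u subgroup.one_closed[OF B] by (simp add: c_def edge_def)
    also have "inv u\<^sub>1 \<otimes> (u\<^sub>1 \<otimes> inv a \<otimes> inv u\<^sub>1 \<otimes> x\<^sub>0 \<otimes> u\<^sub>0) = inv a \<otimes> z"
      unfolding z_def using a u x\<^sub>0G by (simp add: G.m_assoc G.m_assoc[symmetric, of "inv u\<^sub>1" u\<^sub>1])
    finally show ?thesis .
  qed
  have "\<exists>h. h \<in> hom G G \<and> (\<forall>c\<in>A. h c = c) \<and> (\<forall>b\<in>B. h b = \<theta> a b)" if a: "a \<in> carrier G" for a
  proof -
    have "(\<lambda>c. c) \<in> hom (G\<lparr>carrier := A\<rparr>) G" using AG by (intro homI) auto
    then show ?thesis using internal_free_product_hom[OF G G AB _ \<theta>hom[OF a]] by metis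
  qed
  then obtain \<alpha> where \<alpha>hom: "\<And>a. a \<in> carrier G \<Longrightarrow> \<alpha> a \<in> hom G G"
    and \<alpha>A: "\<And>a c. a \<in> carrier G \<Longrightarrow> c \<in> A \<Longrightarrow> \<alpha> a c = c"
    and \<alpha>B: "\<And>a b. a \<in> carrier G \<Longrightarrow> b \<in> B \<Longrightarrow> \<alpha> a b = \<theta> a b"
    by metis
  define E where "E = {f \<in> carrier G. \<alpha> \<one> f = f \<and> (\<forall>a\<in>A. \<forall>b\<in>A. \<alpha> a (\<alpha> b f) = \<alpha> (a \<otimes> b) f)}"
  have E: "subgroup E G" unfolding E_def by (rule transvections_subgroup[OF G A]) (use \<alpha>hom AG in auto)
  have AE: "c \<in> E" if "c \<in> A" for c using that \<alpha>A AG subgroup.m_closed[OF A] by (simp add: E_def)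
  have \<alpha>z: "\<alpha> a z = inv a \<otimes> z" if "a \<in> carrier G" for a using \<alpha>B[OF that z(1)] \<theta>z[OF that] by simp
  have zE: "z \<in> E"
  proof -
    have "\<alpha> a (\<alpha> b z) = \<alpha> (a \<otimes> b) z" if ab: "a \<in> A" "b \<in> A" for a b
    proof -
      note abG = AG[OF ab(1)] AG[OF ab(2)]
      have "\<alpha> a (\<alpha> b z) = \<alpha> a (inv b) \<otimes> \<alpha> a z"
        unfolding \<alpha>z[OF abG(2)] using \<alpha>hom[OF abG(1)] abG z by (auto simp: hom_def)
      also have "\<dots> = inv b \<otimes> (inv a \<otimes> z)"
        using \<alpha>A[OF abG(1) subgroup.m_inv_closed[OF A ab(2)]] \<alpha>z[OF abG(1)] by simp
      also have "\<dots> = \<alpha> (a \<otimes> b) z"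
        using \<alpha>z[OF G.m_closed[OF abG]] abG z by (simp add: G.inv_mult_group G.m_assoc)
      finally show ?thesis .
    qed
    then show ?thesis using z \<alpha>z[OF G.one_closed] by (simp add: E_def)
  qed
  have goodE: "f \<in> E" if f: "f \<in> B" and good: "\<And>a. a \<in> carrier G \<Longrightarrow> \<kappa> a f \<one> = f" for f
    using \<alpha>B[OF _ f] good BG[OF f] AG by (simp add: E_def \<theta>_def)
  let ?good = "\<lambda>f. f \<in> carrier G \<and> (\<forall>a\<in>carrier G. \<kappa> a f \<one> = f)"
  have EB: "subgroup (E \<inter> B) G" by (rule G.subgroups_Inter_pair[OF E B])
  note EBm = subgroup.m_closed[OF EB] and EBi = subgroup.m_inv_closed[OF EB]
  \<comment> \<open>\<open>f'\<close> follows the path as long as it stays untwisted, and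
    \<open>b\<close> collects the loops split off so far. When the path crosses the twisted edge
    forwards, its untwisted part is closed up by the inverse of \<open>u\<^sub>0\<close>, moved into
    \<open>b\<close> together with \<open>z\<close>, and the path restarts at
    \<open>u\<^sub>1\<close>. A backward crossing exchanges the two ends and uses the inverse of
    \<open>z\<close>.\<close>
  have dec: "\<exists>f' b. ?good f' \<and> b \<in> E \<inter> B \<and> f = f' \<otimes> b" if f: "f \<in> carrier G" for f
  proof (rule free_basis_induct[OF G X f])
    show "\<exists>f' b. ?good f' \<and> b \<in> E \<inter> B \<and> \<one> = f' \<otimes> b"
      using \<kappa>i(1) subgroup.one_closed[OF EB] by (intro exI[of _ "\<one>"]) auto
  next
    fix x f assume x: "x \<in> X" and f: "f \<in> carrier G" and "\<exists>f' b. ?good f' \<and> b \<in> E \<inter> B \<and> f = f' \<otimes> b"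
    then obtain f' b where f': "f' \<in> carrier G" "\<And>a. a \<in> carrier G \<Longrightarrow> \<kappa> a f' \<one> = f'"
      and b: "b \<in> E \<inter> B" and fe: "f = f' \<otimes> b" by blast
    have xG: "x \<in> carrier G" using x XG by blast
    have bG: "b \<in> carrier G" using b BG by blast
    show "\<exists>f' b. ?good f' \<and> b \<in> E \<inter> B \<and> x \<otimes> f = f' \<otimes> b"
    proof (cases "edge x f'")
      case False
      have "\<kappa> a (x \<otimes> f') \<one> = x \<otimes> f'" if a: "a \<in> carrier G" for a
        using \<kappa>m[OF a xG f'(1) G.one_closed] \<kappa>x[OF a x f'(1)] f' a False by (simp add: c_def)
      then show ?thesis using xG f' b bG
        by (intro exI[of _ "x \<otimes> f'"] exI[of _ b]) (simp add: fe G.m_assoc)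
    next
      case True
      then have x': "x = x\<^sub>0" and mem: "inv u\<^sub>0 \<otimes> f' \<in> B" by (auto simp: edge_def)
      have "inv u\<^sub>0 \<otimes> f' \<in> E" by (rule goodE[OF mem]) (use goodB u good0 f' mem in auto)
      then have "z \<otimes> (inv u\<^sub>0 \<otimes> f' \<otimes> b) \<in> E \<inter> B" using EBm mem z zE b by blast
      moreover have "x \<otimes> f = u\<^sub>1 \<otimes> (z \<otimes> (inv u\<^sub>0 \<otimes> f' \<otimes> b))"
        unfolding x' fe z_def using x\<^sub>0G u f' bG
        by (simp add: G.m_assoc G.m_assoc[symmetric, of u\<^sub>1 "inv u\<^sub>1"] G.m_assoc[symmetric, of u\<^sub>0 "inv u\<^sub>0"])
      ultimately show ?thesis using u good0 by blast
    qed
    show "\<exists>f' b. ?good f' \<and> b \<in> E \<inter> B \<and> inv x \<otimes> f = f' \<otimes> b"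
    proof (cases "edge x (inv x \<otimes> f')")
      case False
      have "\<kappa> a (inv x \<otimes> f') \<one> = inv x \<otimes> f'" if a: "a \<in> carrier G" for a
      proof -
        have "\<kappa> a (inv x) (x \<otimes> (inv x \<otimes> f')) = inv (\<kappa> a x (inv x \<otimes> f'))"
          by (rule \<kappa>i(2)[OF a xG]) (use xG f' in simp)
        moreover have "\<kappa> a x (inv x \<otimes> f') = x"
          using \<kappa>x[OF a x, of "inv x \<otimes> f'"] xG f' False by (simp add: c_def)
        ultimately have "\<kappa> a (inv x) f' = inv x" using xG f' by (simp add: G.m_assoc[symmetric])
        then show ?thesis using \<kappa>m[OF a G.inv_closed[OF xG] f'(1) G.one_closed] f' a by simp
      qed
      then show ?thesis using xG f' b bG
        by (intro exI[of _ "inv x \<otimes> f'"] exI[of _ b]) (simp add: fe G.m_assoc)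
    next
      case True
      then have x': "x = x\<^sub>0" and mem: "inv u\<^sub>0 \<otimes> (inv x\<^sub>0 \<otimes> f') \<in> B" by (auto simp: edge_def)
      have "z \<otimes> (inv u\<^sub>0 \<otimes> (inv x\<^sub>0 \<otimes> f')) = inv u\<^sub>1 \<otimes> f'"
        unfolding z_def using x\<^sub>0G u f'
        by (simp add: G.m_assoc G.m_assoc[symmetric, of u\<^sub>0 "inv u\<^sub>0"] G.m_assoc[symmetric, of x\<^sub>0 "inv x\<^sub>0"])
      then have mem1: "inv u\<^sub>1 \<otimes> f' \<in> B" using subgroup.m_closed[OF B z(1) mem] by simp
      have "inv u\<^sub>1 \<otimes> f' \<in> E" by (rule goodE[OF mem1]) (use goodB u good0 f' mem1 in auto)
      then have "inv z \<otimes> (inv u\<^sub>1 \<otimes> f' \<otimes> b) \<in> E \<inter> B" using EBm EBi mem1 z zE b by blast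
      moreover have "inv x \<otimes> f = u\<^sub>0 \<otimes> (inv z \<otimes> (inv u\<^sub>1 \<otimes> f' \<otimes> b))"
        unfolding x' fe z_def using x\<^sub>0G u f' bG
        by (simp add: G.inv_mult_group G.m_assoc G.m_assoc[symmetric, of u\<^sub>1 "inv u\<^sub>1"] G.m_assoc[symmetric, of u\<^sub>0 "inv u\<^sub>0"])
      ultimately show ?thesis using u good0 by blast
    qed
  qed
  have BE: "f \<in> E" if f: "f \<in> B" for f
  proof -
    obtain f' b where f': "f' \<in> carrier G" "\<And>a. a \<in> carrier G \<Longrightarrow> \<kappa> a f' \<one> = f'"
      and b: "b \<in> E \<inter> B" and fe: "f = f' \<otimes> b" using dec[OF BG[OF f]] by blast
    have "f' = f \<otimes> inv b" unfolding fe using f' b BG by (simp add: G.m_assoc)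
    then have "f' \<in> B" using subgroup.m_closed[OF B f] subgroup.m_inv_closed[OF B] b by simp
    then have "f' \<in> E" by (rule goodE) (rule f'(2))
    then show ?thesis unfolding fe using subgroup.m_closed[OF E] b by simp
  qed
  have all: "f \<in> E" if "f \<in> carrier G" for f
    by (rule internal_free_product_induct[OF G AB that]) (use subgroup.one_closed[OF E] subgroup.m_closed[OF E] AE BE in auto)
  have "transvections G A z \<alpha>"
    unfolding transvections_def using z \<alpha>hom \<alpha>A \<alpha>z AG all by (simp add: E_def)
  then show ?thesis by blast
qed

text \<open>Serves the claim on faithfulness, where a basis is at hand and the transvections can be
  prescribed on it directly.\<close>

lemma free_basis_transvections:
  fixes G (structure)
  assumes G: "group G" and X: "free_basis G X" and z: "z \<in> X" and YX: "Y \<subseteq> X - {z}"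
  shows "\<exists>\<alpha>. transvections G (generate G Y) z \<alpha>"
proof -
  interpret G: group G by (rule G)
  have XG: "X \<subseteq> carrier G" using X by (simp add: free_basis_def)
  have YG: "Y \<subseteq> carrier G" using YX XG by blast
  let ?A = "generate G Y"
  have A: "subgroup ?A G" by (rule G.generate_is_subgroup[OF YG])
  note AG = subgroup.mem_carrier[OF A]
  have "\<exists>h. h \<in> hom G G \<and> (\<forall>x\<in>X. h x = (if x = z then inv a \<otimes> z else x))" if a: "a \<in> carrier G" for a
    using free_basis_hom[OF G G X, of "\<lambda>x. if x = z then inv a \<otimes> z else x"] a XG z
    by (smt (verit, best) G.inv_closed G.m_closed subsetD)
  then obtain \<alpha> where \<alpha>hom: "\<And>a. a \<in> carrier G \<Longrightarrow> \<alpha> a \<in> hom G G"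
    and \<alpha>x: "\<And>a x. a \<in> carrier G \<Longrightarrow> x \<in> X \<Longrightarrow> \<alpha> a x = (if x = z then inv a \<otimes> z else x)"
    by metis
  have zG: "z \<in> carrier G" using z XG by blast
  have \<alpha>A: "\<alpha> a c = c" if a: "a \<in> carrier G" and c: "c \<in> ?A" for a c
  proof -
    have "(\<lambda>f. f) \<in> hom G G" by (auto simp: hom_def)
    then have "subgroup {f \<in> carrier G. \<alpha> a f = f} G"
      using hom_equalizer_subgroup[OF G G \<alpha>hom[OF a]] by blast
    moreover have "Y \<subseteq> {f \<in> carrier G. \<alpha> a f = f}"
    proof
      fix y assume "y \<in> Y"
      then have "y \<in> X" "y \<noteq> z" "y \<in> carrier G" using YX YG by auto
      then show "y \<in> {f \<in> carrier G. \<alpha> a f = f}" using \<alpha>x[OF a] by simp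
    qed
    ultimately show ?thesis using G.generate_subgroup_incl c by blast
  qed
  define E where "E = {f \<in> carrier G. \<alpha> \<one> f = f \<and> (\<forall>a\<in>?A. \<forall>b\<in>?A. \<alpha> a (\<alpha> b f) = \<alpha> (a \<otimes> b) f)}"
  have E: "subgroup E G" unfolding E_def by (rule transvections_subgroup[OF G A]) (use \<alpha>hom AG in auto)
  have XE: "x \<in> E" if x: "x \<in> X" for x
  proof (cases "x = z")
    case False
    then show ?thesis using \<alpha>x x XG AG by (auto simp: E_def)
  next
    case True
    have "\<alpha> a (\<alpha> b z) = \<alpha> (a \<otimes> b) z" if ab: "a \<in> ?A" "b \<in> ?A" for a b
    proof -
      note abG = AG[OF ab(1)] AG[OF ab(2)]
      have "\<alpha> a (\<alpha> b z) = \<alpha> a (inv b) \<otimes> \<alpha> a z"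
        using \<alpha>x[OF abG(2) z] \<alpha>hom[OF abG(1)] abG zG by (auto simp: hom_def)
      also have "\<dots> = inv b \<otimes> (inv a \<otimes> z)"
        using \<alpha>A[OF abG(1) subgroup.m_inv_closed[OF A ab(2)]] \<alpha>x[OF abG(1) z] by simp
      also have "\<dots> = \<alpha> (a \<otimes> b) z"
        using \<alpha>x[OF G.m_closed[OF abG] z] abG zG by (simp add: G.inv_mult_group G.m_assoc)
      finally show ?thesis .
    qed
    then show ?thesis using True zG \<alpha>x[OF G.one_closed z] by (simp add: E_def)
  qed
  have all: "f \<in> E" if "f \<in> carrier G" for f
    by (rule free_basis_induct[OF G X that])
      (use subgroup.one_closed[OF E] subgroup.m_closed[OF E] subgroup.m_inv_closed[OF E] XE in auto)
  have "transvections G ?A z \<alpha>"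
    unfolding transvections_def using z zG \<alpha>hom \<alpha>A \<alpha>x AG all by (simp add: E_def)
  then show ?thesis by blast
qed

section \<open>A congruence subgroup that is not virtually solvable\<close>

text \<open>The quadruple \<open>(a, b, c, d)\<close> is the matrix with rows \<open>(a, b)\<close> and \<open>(c, d)\<close>. The congruence
  subgroup of level \<open>3\<close> is used since it does not contain \<open>- 1\<close>.\<close>

definition Gamma3 :: "(int \<times> int \<times> int \<times> int) monoid" where
  "Gamma3 = \<lparr>carrier = {(a, b, c, d). a * d - b * c = 1 \<and> 3 dvd a - 1 \<and> 3 dvd b \<and> 3 dvd c \<and> 3 dvd d - 1},
     monoid.mult = (\<lambda>(a, b, c, d) (a', b', c', d').
       (a * a' + b * c', a * b' + b * d', c * a' + d * c', c * b' + d * d')),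
     monoid.one = (1, 0, 0, 1)\<rparr>"

lemma Gamma3_carrier: "(a, b, c, d) \<in> carrier Gamma3 \<longleftrightarrow>
    a * d - b * c = 1 \<and> 3 dvd a - 1 \<and> 3 dvd b \<and> 3 dvd c \<and> 3 dvd d - 1"
  and Gamma3_mult: "(a, b, c, d) \<otimes>\<^bsub>Gamma3\<^esub> (a', b', c', d') =
    (a * a' + b * c', a * b' + b * d', c * a' + d * c', c * b' + d * d')"
  and Gamma3_one: "\<one>\<^bsub>Gamma3\<^esub> = (1, 0, 0, 1)"
  by (simp_all add: Gamma3_def)

lemma group_Gamma3: "group Gamma3"
proof (rule groupI)
  fix x y assume "x \<in> carrier Gamma3" "y \<in> carrier Gamma3"
  then obtain a b c d a' b' c' d' where xy: "x = (a, b, c, d)" "y = (a', b', c', d')"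
    and h: "a * d - b * c = 1" "3 dvd a - 1" "3 dvd b" "3 dvd c" "3 dvd d - 1"
      "a' * d' - b' * c' = 1" "3 dvd a' - 1" "3 dvd b'" "3 dvd c'" "3 dvd d' - 1"
    by (cases x; cases y) (auto simp: Gamma3_carrier)
  have "(a * a' + b * c') * (c * b' + d * d') - (a * b' + b * d') * (c * a' + d * c') = (a * d - b * c) * (a' * d' - b' * c')"
    by (simp add: algebra_simps)
  moreover have "a * a' + b * c' - 1 = a * (a' - 1) + (a - 1) + b * c'" "c * b' + d * d' - 1 = c * b' + d * (d' - 1) + (d - 1)"
    by (simp_all add: algebra_simps)
  ultimately show "x \<otimes>\<^bsub>Gamma3\<^esub> y \<in> carrier Gamma3"
    unfolding xy Gamma3_mult Gamma3_carrier using h by (metis dvd_add dvd_mult dvd_mult2 mult_1)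
next
  fix x y z assume "x \<in> carrier Gamma3" "y \<in> carrier Gamma3" "z \<in> carrier Gamma3"
  show "x \<otimes>\<^bsub>Gamma3\<^esub> y \<otimes>\<^bsub>Gamma3\<^esub> z = x \<otimes>\<^bsub>Gamma3\<^esub> (y \<otimes>\<^bsub>Gamma3\<^esub> z)"
    by (cases x; cases y; cases z) (simp add: Gamma3_mult algebra_simps)
next
  fix x assume "x \<in> carrier Gamma3"
  then obtain a b c d where x: "x = (a, b, c, d)"
    and h: "a * d - b * c = 1" "3 dvd a - 1" "3 dvd b" "3 dvd c" "3 dvd d - 1"
    by (cases x) (auto simp: Gamma3_carrier)
  then show "\<exists>y\<in>carrier Gamma3. y \<otimes>\<^bsub>Gamma3\<^esub> x = \<one>\<^bsub>Gamma3\<^esub>"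
    by (intro bexI[of _ "(d, - b, - c, a)"]) (auto simp: Gamma3_mult Gamma3_one Gamma3_carrier algebra_simps)
qed (auto simp: Gamma3_carrier Gamma3_one Gamma3_mult)

lemma Gamma3_pow:
  "(1, m, 0, 1) [^]\<^bsub>Gamma3\<^esub> (n :: nat) = (1, int n * m, 0, 1)"
  "(1, 0, m, 1) [^]\<^bsub>Gamma3\<^esub> (n :: nat) = (1, 0, int n * m, 1)"
  by (induction n) (simp_all add: nat_pow_def Gamma3_one Gamma3_mult algebra_simps)

text \<open>The entries of the first relation force \<open>c = 0\<close> and then
  \<open>a = d\<close>, because a nonzero multiple of a square vanishes; the second relation forces
  \<open>b = 0\<close>. The determinant leaves plus or minus the identity, and the congruence modulo
  3 excludes the minus sign.\<close>

lemma Gamma3_commute_conj: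
  assumes g: "(a, b, c, d) \<in> carrier Gamma3" and m: "m \<noteq> 0" "m' \<noteq> 0"
    and upper: "(a, b, c, d) \<otimes>\<^bsub>Gamma3\<^esub> ((1, m, 0, 1) \<otimes>\<^bsub>Gamma3\<^esub> (a, b, c, d) \<otimes>\<^bsub>Gamma3\<^esub> (1, - m, 0, 1))
      = ((1, m, 0, 1) \<otimes>\<^bsub>Gamma3\<^esub> (a, b, c, d) \<otimes>\<^bsub>Gamma3\<^esub> (1, - m, 0, 1)) \<otimes>\<^bsub>Gamma3\<^esub> (a, b, c, d)"
    and lower: "(a, b, c, d) \<otimes>\<^bsub>Gamma3\<^esub> ((1, 0, m', 1) \<otimes>\<^bsub>Gamma3\<^esub> (a, b, c, d) \<otimes>\<^bsub>Gamma3\<^esub> (1, 0, - m', 1))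
      = ((1, 0, m', 1) \<otimes>\<^bsub>Gamma3\<^esub> (a, b, c, d) \<otimes>\<^bsub>Gamma3\<^esub> (1, 0, - m', 1)) \<otimes>\<^bsub>Gamma3\<^esub> (a, b, c, d)"
  shows "(a, b, c, d) = \<one>\<^bsub>Gamma3\<^esub>"
proof -
  have "2 * m * c * c = 0"
    using upper by (auto simp: Gamma3_mult algebra_simps)
  then have c: "c = 0" using m by simp
  have "m * (a - d) * (a - d) = 0"
    using upper unfolding c by (auto simp: Gamma3_mult algebra_simps)
  then have ad: "a = d" using m by simp
  have "2 * m' * b * b = 0"
    using lower by (auto simp: Gamma3_mult algebra_simps)
  then have b: "b = 0" using m by simp
  have "a * a = 1" "3 dvd a - 1" using g unfolding Gamma3_carrier b c ad by auto
  then have "a = 1" by (auto simp: zmult_eq_1_iff)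
  then show ?thesis using ad b c by (simp add: Gamma3_one)
qed

section \<open>Finite index and the derived series\<close>

lemma (in group) finite_index_pow:
  assumes H: "subgroup H G" and fin: "finite (rcosets H)" and x: "x \<in> carrier G"
  shows "\<exists>n>0. x [^] (n :: nat) \<in> H"
proof -
  have "(\<lambda>n :: nat. H #> x [^] n) ` UNIV \<subseteq> rcosets H" using x by (auto simp: RCOSETS_def)
  then have "finite ((\<lambda>n :: nat. H #> x [^] n) ` UNIV)" using fin finite_subset by blast
  then have "\<not> inj (\<lambda>n :: nat. H #> x [^] n)" using finite_imageD infinite_UNIV_nat by blast
  then obtain i j :: nat where "i \<noteq> j" "H #> x [^] i = H #> x [^] j" unfolding inj_def by blast
  then obtain i j :: nat where ij: "i < j" "H #> x [^] i = H #> x [^] j" by (metis nat_neq_iff)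
  have "x [^] j \<in> H #> x [^] i" unfolding ij(2) using x by (intro rcos_self[OF _ H]) simp
  then obtain h where h: "h \<in> H" "x [^] j = h \<otimes> x [^] i" unfolding r_coset_def by blast
  have "x [^] j = x [^] (j - i) \<otimes> x [^] i" using ij x by (simp add: nat_pow_mult)
  then have "x [^] (j - i) = h" using h x subgroup.mem_carrier[OF H] by simp
  then show ?thesis using h ij by (intro exI[of _ "j - i"]) simp
qed

lemma (in group) exp_of_derived_normal: "(derived G ^^ n) (carrier G) \<lhd> G"
  by (induction n) (auto intro: derived_is_normal normal_self)

lemma commutator_in_derived:
  fixes G (structure)
  assumes "g \<in> H" "h \<in> H"
  shows "g \<otimes> h \<otimes> inv g \<otimes> inv h \<in> derived G H"
  unfolding derived_def by (rule generate.incl) (use assms in blast)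

text \<open>The last nontrivial term of the derived series would be an abelian normal subgroup;
  its elements commute with their conjugates by the two unipotents, hence are trivial.\<close>

lemma Gamma3_not_solvable:
  assumes K: "subgroup K Gamma3" and m: "m \<noteq> 0" "m' \<noteq> 0" "(1, m, 0, 1) \<in> K" "(1, 0, m', 1) \<in> K"
  shows "(derived Gamma3 ^^ n) K \<noteq> {\<one>\<^bsub>Gamma3\<^esub>}"
proof
  interpret G: group Gamma3 by (rule group_Gamma3)
  assume "(derived Gamma3 ^^ n) K = {\<one>\<^bsub>Gamma3\<^esub>}"
  define k where "k = (LEAST k. (derived Gamma3 ^^ k) K = {\<one>\<^bsub>Gamma3\<^esub>})"
  have k: "(derived Gamma3 ^^ k) K = {\<one>\<^bsub>Gamma3\<^esub>}"
    unfolding k_def by (rule LeastI) fact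
  have "K \<noteq> {\<one>\<^bsub>Gamma3\<^esub>}" using m by (auto simp: Gamma3_one)
  have "k \<noteq> 0"
  proof
    assume "k = 0"
    then show False using k \<open>K \<noteq> {\<one>\<^bsub>Gamma3\<^esub>}\<close> by simp
  qed
  then obtain l where l: "k = Suc l" by (cases k) auto
  let ?L = "(derived Gamma3 ^^ l) K"
  have ne: "?L \<noteq> {\<one>\<^bsub>Gamma3\<^esub>}"
    using not_less_Least[of l "\<lambda>k. (derived Gamma3 ^^ k) K = {\<one>\<^bsub>Gamma3\<^esub>}"] l unfolding k_def by (metis lessI)
  have L: "subgroup ?L Gamma3" by (rule G.exp_of_derived_is_subgroup[OF K])
  note LG = subgroup.mem_carrier[OF L]
  let ?K = "Gamma3\<lparr>carrier := K\<rparr>"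
  have KL: "(derived ?K ^^ l) (carrier ?K) = ?L" using G.exp_of_derived_consistent[OF K, of l] by simp
  \<comment> \<open>Normality in \<open>K\<close> suffices, since both conjugating unipotents lie in
    \<open>K\<close>.\<close>
  interpret L: normal ?L ?K
    using group.exp_of_derived_normal[OF G.subgroup_imp_group[OF K], of l] unfolding KL .
  have comm: "g \<otimes>\<^bsub>Gamma3\<^esub> h = h \<otimes>\<^bsub>Gamma3\<^esub> g" if gh: "g \<in> ?L" "h \<in> ?L" for g h
  proof -
    have "g \<otimes>\<^bsub>Gamma3\<^esub> h \<otimes>\<^bsub>Gamma3\<^esub> inv\<^bsub>Gamma3\<^esub> g \<otimes>\<^bsub>Gamma3\<^esub> inv\<^bsub>Gamma3\<^esub> h \<in> derived Gamma3 ?L"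

      by (rule commutator_in_derived[OF gh])
    then have "g \<otimes>\<^bsub>Gamma3\<^esub> h \<otimes>\<^bsub>Gamma3\<^esub> inv\<^bsub>Gamma3\<^esub> g \<otimes>\<^bsub>Gamma3\<^esub> inv\<^bsub>Gamma3\<^esub> h = \<one>\<^bsub>Gamma3\<^esub>"
      using k unfolding l by simp
    then have "g \<otimes>\<^bsub>Gamma3\<^esub> h \<otimes>\<^bsub>Gamma3\<^esub> inv\<^bsub>Gamma3\<^esub> (h \<otimes>\<^bsub>Gamma3\<^esub> g) = \<one>\<^bsub>Gamma3\<^esub>"
      using LG gh by (simp add: G.inv_mult_group G.m_assoc)
    then have "inv\<^bsub>Gamma3\<^esub> (inv\<^bsub>Gamma3\<^esub> (h \<otimes>\<^bsub>Gamma3\<^esub> g)) = g \<otimes>\<^bsub>Gamma3\<^esub> h"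
      using LG gh by (intro G.inv_equality) auto
    then show ?thesis using LG gh by simp
  qed
  have invK: "inv\<^bsub>?K\<^esub> x = inv\<^bsub>Gamma3\<^esub> x" if "x \<in> K" for x using G.m_inv_consistent[OF K that] .
  have inv_up: "inv\<^bsub>Gamma3\<^esub> (1, m, 0, 1) = (1, - m, 0, 1)" and inv_lo: "inv\<^bsub>Gamma3\<^esub> (1, 0, m', 1) = (1, 0, - m', 1)"
    using m subgroup.mem_carrier[OF K]
    by (auto intro!: G.inv_equality simp: Gamma3_mult Gamma3_one Gamma3_carrier dvd_minus_iff)
  have conj: "x \<otimes>\<^bsub>Gamma3\<^esub> g \<otimes>\<^bsub>Gamma3\<^esub> inv\<^bsub>Gamma3\<^esub> x \<in> ?L" if "x \<in> K" "g \<in> ?L" for x g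
    using L.inv_op_closed2[of x g] that invK by simp
  have "g = \<one>\<^bsub>Gamma3\<^esub>" if g: "g \<in> ?L" for g
  proof -
    obtain a b c d where abcd: "g = (a, b, c, d)" by (cases g)
    show ?thesis unfolding abcd
    proof (rule Gamma3_commute_conj[OF _ m(1,2)])
      show "(a, b, c, d) \<in> carrier Gamma3" using LG[OF g] by (simp add: abcd)
    qed (use comm[OF g conj[OF m(3) g]] comm[OF g conj[OF m(4) g]] in \<open>simp_all add: abcd inv_up inv_lo\<close>)
  qed
  then show False using ne subgroup.one_closed[OF L] by blast
qed

section \<open>Representations of the automorphism group\<close>

lemma BijGroup_mult: "f \<in> Bij S \<Longrightarrow> g \<in> Bij S \<Longrightarrow> f \<otimes>\<^bsub>BijGroup S\<^esub> g = compose S f g"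
  by (simp add: BijGroup_def)

lemma AutoGroup_simps:
  "carrier (AutoGroup G) = auto G"
  "f \<in> auto G \<Longrightarrow> g \<in> auto G \<Longrightarrow> f \<otimes>\<^bsub>AutoGroup G\<^esub> g = compose (carrier G) f g"
  by (auto simp: AutoGroup_def auto_def BijGroup_mult)

context group
begin

lemma inner_aut_auto: "a \<in> carrier G \<Longrightarrow> inner_aut G a \<in> auto G"
proof -
  assume a: "a \<in> carrier G"
  have "bij_betw (inner_aut G a) (carrier G) (carrier G)"
    by (rule bij_betw_byWitness[where f' = "inner_aut G (inv a)"])
      (use a in \<open>auto simp: inner_aut_def m_assoc m_assoc[symmetric, of "inv a" a] m_assoc[symmetric, of a "inv a"]\<close>)
  moreover have "inner_aut G a \<in> hom G G"
    using a by (intro homI) (auto simp: inner_aut_def m_assoc m_assoc[symmetric, of "inv a" a])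
  ultimately show ?thesis by (simp add: auto_def Bij_def inner_aut_def)
qed

lemma inner_aut_hom: "inner_aut G \<in> hom G (AutoGroup G)"
proof (rule homI)
  fix a b assume ab: "a \<in> carrier G" "b \<in> carrier G"
  have "inner_aut G (a \<otimes> b) = compose (carrier G) (inner_aut G a) (inner_aut G b)"
    using ab by (auto simp: inner_aut_def compose_def fun_eq_iff inv_mult_group m_assoc)
  then show "inner_aut G (a \<otimes> b) = inner_aut G a \<otimes>\<^bsub>AutoGroup G\<^esub> inner_aut G b"
    using ab by (simp add: AutoGroup_simps inner_aut_auto)
qed (simp add: AutoGroup_simps inner_aut_auto)

lemma transvection_auto:
  assumes A: "subgroup A G" and t: "transvections G A z \<alpha>" and a: "a \<in> A"
  shows "restrict (\<alpha> a) (carrier G) \<in> auto G"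
proof -
  have hom: "\<alpha> b \<in> hom G G" if "b \<in> A" for b using t that by (simp add: transvections_def)
  have clos: "\<alpha> b f \<in> carrier G" if "b \<in> A" "f \<in> carrier G" for b f using hom[OF that(1)] that by (auto simp: hom_def)
  have inv: "\<alpha> b (\<alpha> c f) = f" if "b \<in> A" "c \<in> A" "b \<otimes> c = \<one>" "f \<in> carrier G" for b c f
    using t that by (simp add: transvections_def)
  have ia: "inv a \<in> A" by (rule subgroup.m_inv_closed[OF A a])
  have aG: "a \<in> carrier G" by (rule subgroup.mem_carrier[OF A a])
  have "bij_betw (restrict (\<alpha> a) (carrier G)) (carrier G) (carrier G)"
    by (rule bij_betw_byWitness[where f' = "\<alpha> (inv a)"]) (use clos inv a ia aG in auto)
  moreover have "restrict (\<alpha> a) (carrier G) \<in> hom G G" using hom[OF a] by (auto simp: hom_def)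
  ultimately show ?thesis by (simp add: auto_def Bij_def)
qed

end

section \<open>General linear groups and the passage to the algebraic closure\<close>

lemma group_GL: "group (GL d :: 'k::field mat monoid)"
proof -
  interpret ring "ring_mat TYPE('k) d ()" by (rule ring_mat)
  show ?thesis unfolding GL_def by (rule units_group)
qed

lemma GL_simps: "\<one>\<^bsub>GL d\<^esub> = (1\<^sub>m d :: 'k::field mat)" "M \<otimes>\<^bsub>GL d\<^esub> M' = (M * M' :: 'k mat)"
  by (simp_all add: GL_def units_of_def ring_mat_def)

lemma GL_carrier: "M \<in> carrier (GL d :: 'k::field mat monoid) \<Longrightarrow> M \<in> carrier_mat d d"
  by (auto simp: GL_def units_of_def Units_def ring_mat_def)

lemma map_mat_to_ac_mult:
  fixes M :: "'k::field mat"
  assumes "M \<in> carrier_mat d d" "M' \<in> carrier_mat d d"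
  shows "map_mat to_ac (M * M') = map_mat to_ac M * map_mat to_ac M'"
  using assms by (intro eq_matI) (auto simp: scalar_prod_def to_ac_sum)

lemma map_mat_to_ac_one: "map_mat to_ac (1\<^sub>m d :: 'k::field mat) = 1\<^sub>m d"
  by (intro eq_matI) auto

lemma map_mat_to_ac_inject:
  "map_mat to_ac M = map_mat to_ac (M' :: 'k::field mat) \<Longrightarrow> M = M'"
  by (intro eq_matI) (metis index_map_mat(1) index_map_mat(2,3) to_ac_eq_iff, (metis index_map_mat(2,3))+)

text \<open>Both claims of the theorem rest on this: \<open>A\<close> is any subgroup with
  transvections, be it a proper free factor or generated by part of a basis. The argument runs over
  the algebraic closure, but a matrix is the identity as soon as it is so there, and the conclusion
  is stated in that form to come back to the given field.\<close>

lemma aut_representation_transvections: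
  fixes G :: "('a, 'b) monoid_scheme" (structure) and R :: "('a \<Rightarrow> 'a) \<Rightarrow> 'k::field mat"
  assumes G: "group G" and A: "subgroup A G" and t: "transvections G A z \<alpha>" and R: "aut_representation G d R"
  shows "\<exists>L n. subgroup L (G\<lparr>carrier := A\<rparr>) \<and> finite (rcosets\<^bsub>G\<lparr>carrier := A\<rparr>\<^esub> L) \<and>
    (\<forall>x\<in>(derived (G\<lparr>carrier := A\<rparr>) ^^ n) L. R (inner_aut G x) = 1\<^sub>m d)"
proof -
  interpret G: group G by (rule G)
  interpret Aut: group "AutoGroup G" by (rule G.AutoGroup)
  interpret R: group_hom "AutoGroup G" "GL d" R
    using R group_GL Aut.is_group by (simp add: aut_representation_def group_hom_def group_hom_axioms_def)
  let ?A = "G\<lparr>carrier := A\<rparr>"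
  interpret A: group ?A by (rule G.subgroup_imp_group[OF A])
  note AG = subgroup.mem_carrier[OF A]
  define E where "E \<phi> = map_mat to_ac (R \<phi>)" for \<phi>
  have Ec: "E \<phi> \<in> carrier_mat d d" if "\<phi> \<in> auto G" for \<phi>
    using GL_carrier[OF R.hom_closed] that by (auto simp: E_def AutoGroup_simps)
  have Rm: "E (compose (carrier G) \<phi> \<psi>) = E \<phi> * E \<psi>" if "\<phi> \<in> auto G" "\<psi> \<in> auto G" for \<phi> \<psi>
  proof -
    have "R (compose (carrier G) \<phi> \<psi>) = R \<phi> * R \<psi>"
      using R.hom_mult[of \<phi> \<psi>] that by (simp add: AutoGroup_simps GL_simps)
    then show ?thesis unfolding E_def
      using map_mat_to_ac_mult[of "R \<phi>" d "R \<psi>"] GL_carrier[OF R.hom_closed] that by (simp add: AutoGroup_simps)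
  qed
  have R1: "E \<one>\<^bsub>AutoGroup G\<^esub> = 1\<^sub>m d" using R.hom_one by (simp add: E_def GL_simps map_mat_to_ac_one)
  define \<beta> where "\<beta> a = restrict (\<alpha> a) (carrier G)" for a
  let ?\<iota> = "inner_aut G"
  interpret \<iota>: group_hom G "AutoGroup G" ?\<iota>
    using G.inner_aut_hom Aut.is_group G by (simp add: group_hom_def group_hom_axioms_def)
  have \<beta>: "\<beta> a \<in> auto G" if "a \<in> A" for a
    unfolding \<beta>_def by (rule G.transvection_auto[OF A t that])
  note \<iota> = G.inner_aut_auto
  have zG: "z \<in> carrier G" using t by (simp add: transvections_def)
  have \<alpha>hom: "\<alpha> a \<in> hom G G" if "a \<in> A" for a using t that by (simp add: transvections_def)
  have \<alpha>: "\<alpha> a c = c" "\<alpha> a z = inv a \<otimes> z" if "a \<in> A" "c \<in> A" for a c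
    using t that by (simp_all add: transvections_def)
  have \<alpha>g: "\<alpha> a (f \<otimes> v \<otimes> inv f) = \<alpha> a f \<otimes> \<alpha> a v \<otimes> inv (\<alpha> a f)" "\<alpha> a v \<in> carrier G"
    if "a \<in> A" "f \<in> carrier G" "v \<in> carrier G" for a f v
  proof -
    interpret h: group_hom G G "\<alpha> a" using \<alpha>hom[OF that(1)] G by (simp add: group_hom_def group_hom_axioms_def)
    show "\<alpha> a (f \<otimes> v \<otimes> inv f) = \<alpha> a f \<otimes> \<alpha> a v \<otimes> inv (\<alpha> a f)" "\<alpha> a v \<in> carrier G"
      using that by auto
  qed
  define \<rho> where "\<rho> a = E (?\<iota> a)" for a
  define \<sigma> where "\<sigma> a = E (\<beta> a)" for a
  have rep: "mat_rep ?A d \<rho>"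
    unfolding mat_rep_def
  proof (intro conjI ballI)
    show "\<rho> \<one>\<^bsub>?A\<^esub> = 1\<^sub>m d" using R1 \<iota>.hom_one by (simp add: \<rho>_def)
    show "\<rho> (x \<otimes>\<^bsub>?A\<^esub> y) = \<rho> x * \<rho> y" if "x \<in> carrier ?A" "y \<in> carrier ?A" for x y
      using \<iota>.hom_mult[of x y] Rm[OF \<iota> \<iota>, of x y] that AG by (simp add: \<rho>_def AutoGroup_simps \<iota>)
  qed (use Ec \<iota> AG in \<open>auto simp: \<rho>_def\<close>)
  have \<sigma>c: "\<sigma> a \<in> carrier_mat d d" if "a \<in> A" for a using Ec \<beta> that by (simp add: \<sigma>_def)
  have \<sigma>inv: "\<sigma> a * \<sigma> (inv a) = 1\<^sub>m d" if a: "a \<in> A" for a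
  proof -
    have ia: "inv a \<in> A" by (rule subgroup.m_inv_closed[OF A a])
    have "\<alpha> a (\<alpha> (inv a) f) = f" if "f \<in> carrier G" for f
      using t a ia that AG[OF a] by (simp add: transvections_def)
    then have "compose (carrier G) (\<beta> a) (\<beta> (inv a)) = \<one>\<^bsub>AutoGroup G\<^esub>"
      using \<alpha>g(2)[OF ia] zG by (auto simp: \<beta>_def compose_def AutoGroup_def BijGroup_def fun_eq_iff)
    then show ?thesis using Rm[OF \<beta>[OF a] \<beta>[OF ia]] R1 by (simp add: \<sigma>_def)
  qed
  have \<sigma>det: "det (\<sigma> a) \<noteq> 0" if a: "a \<in> A" for a
    using det_mult[OF \<sigma>c[OF a] \<sigma>c[OF subgroup.m_inv_closed[OF A a]]] \<sigma>inv[OF a] by auto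
  have comm: "\<rho> a * \<sigma> b = \<sigma> b * \<rho> a" if ab: "a \<in> A" "b \<in> A" for a b
  proof -
    have "compose (carrier G) (?\<iota> a) (\<beta> b) = compose (carrier G) (\<beta> b) (?\<iota> a)"
      using \<alpha>g[OF ab(2) AG[OF ab(1)]] \<alpha>(1)[OF ab(2,1)] AG[OF ab(1)]
      by (auto simp: compose_def \<beta>_def inner_aut_def fun_eq_iff)
    then show ?thesis
      using Rm[OF \<iota>[OF AG[OF ab(1)]] \<beta>[OF ab(2)]] Rm[OF \<beta>[OF ab(2)] \<iota>[OF AG[OF ab(1)]]] by (simp add: \<rho>_def \<sigma>_def)
  qed
  define Z where "Z = E (?\<iota> z)"
  define Z' where "Z' = E (?\<iota> (inv z))"
  have Zc: "Z \<in> carrier_mat d d" "Z' \<in> carrier_mat d d"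
    unfolding Z_def Z'_def by (rule Ec[OF \<iota>[OF zG]], rule Ec[OF \<iota>[OF G.inv_closed[OF zG]]])
  have Em: "E (?\<iota> (f \<otimes> g)) = E (?\<iota> f) * E (?\<iota> g)" if "f \<in> carrier G" "g \<in> carrier G" for f g
    unfolding \<iota>.hom_mult[OF that] AutoGroup_simps(2)[OF \<iota>[OF that(1)] \<iota>[OF that(2)]]
    by (rule Rm[OF \<iota>[OF that(1)] \<iota>[OF that(2)]])
  have E1: "E (?\<iota> \<one>) = 1\<^sub>m d" unfolding \<iota>.hom_one by (rule R1)
  have ZZ: "Z * Z' = 1\<^sub>m d" "Z' * Z = 1\<^sub>m d"
    unfolding Z_def Z'_def Em[OF zG G.inv_closed[OF zG], symmetric] Em[OF G.inv_closed[OF zG] zG, symmetric]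
      G.r_inv[OF zG] G.l_inv[OF zG] by (rule E1)+
  have conj: "char_poly (\<rho> a * \<sigma> a) = char_poly (\<sigma> a)" if a: "a \<in> A" for a
  proof -
    note aG = AG[OF a]
    \<comment> \<open>Rests on \<open>\<alpha> a (a \<otimes> z) = z\<close>. Once the factor
      \<open>Z\<close> is moved to the other side, this becomes the similarity of
      \<open>\<rho> a * \<sigma> a\<close> and \<open>\<sigma> a\<close>.\<close>
    have "compose (carrier G) (\<beta> a) (?\<iota> (a \<otimes> z)) = compose (carrier G) (?\<iota> z) (\<beta> a)"
    proof
      fix v
      show "compose (carrier G) (\<beta> a) (?\<iota> (a \<otimes> z)) v = compose (carrier G) (?\<iota> z) (\<beta> a) v"
      proof (cases "v \<in> carrier G")
        case True
        have "\<alpha> a (a \<otimes> z) = z"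
          using \<alpha>hom[OF a] \<alpha>[OF a a] aG zG by (simp add: hom_def G.m_assoc[symmetric])
        then show ?thesis using \<alpha>g[OF a _ True, of "a \<otimes> z"] aG zG True
          by (simp add: compose_def \<beta>_def inner_aut_def)
      qed (simp add: compose_def)
    qed
    then have "\<sigma> a * E (?\<iota> (a \<otimes> z)) = Z * \<sigma> a"
      using Rm[OF \<beta>[OF a] \<iota>[OF G.m_closed[OF aG zG]]] Rm[OF \<iota>[OF zG] \<beta>[OF a]] by (simp add: \<sigma>_def Z_def)
    moreover have "E (?\<iota> (a \<otimes> z)) = \<rho> a * Z"
      unfolding \<rho>_def Z_def by (rule Em[OF aG zG])
    ultimately have eq: "\<sigma> a * (\<rho> a * Z) = Z * \<sigma> a" by simp
    have \<rho>c: "\<rho> a \<in> carrier_mat d d" using mat_rep_carrier[OF rep] a by simp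
    have "Z * \<sigma> a * Z' = \<sigma> a * \<rho> a * (Z * Z')"
      unfolding eq[symmetric] using \<sigma>c[OF a] \<rho>c Zc by (simp add: assoc_mult_mat[of _ d d _ d _ d])
    then have "Z * \<sigma> a * Z' = \<rho> a * \<sigma> a"
      unfolding ZZ using comm[OF a a] \<sigma>c[OF a] \<rho>c by simp
    then show ?thesis using char_poly_similar[OF conj_similar[OF Zc ZZ \<sigma>c[OF a]]] by simp
  qed
  obtain N where N: "N > 0" "\<forall>g \<in> derived ?A (carrier ?A). \<exists>es. length es = d \<and> (\<forall>e\<in>set es. e ^ N = 1) \<and>
      char_poly (\<rho> g) = (\<Prod>e\<leftarrow>es. [:- e, 1:])"
    using derived_eigenvalues_torsion[OF A.is_group rep, of \<sigma>] \<sigma>c \<sigma>det comm conj by auto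
  obtain L n where L: "subgroup L ?A" "finite (rcosets\<^bsub>?A\<^esub> L)" "\<forall>x\<in>(derived ?A ^^ n) L. \<rho> x = 1\<^sub>m d"
    using rep_virtually_solvable[OF A.is_group rep N] by blast
  have "R (?\<iota> x) = 1\<^sub>m d" if "x \<in> (derived ?A ^^ n) L" for x
    using L(3) that map_mat_to_ac_inject[of "R (?\<iota> x)" "1\<^sub>m d"] by (simp add: \<rho>_def E_def map_mat_to_ac_one)
  then show ?thesis using L by blast
qed

text \<open>Only a derived term of \<open>L\<close> has to be killed by \<open>f\<close>, so the
  image of \<open>L\<close> is solvable even where \<open>L\<close> is a nonabelian free
  group.\<close>

lemma virtually_solvable_image:
  fixes G (structure)
  assumes f: "group_hom G H f" and surj: "f ` carrier G = carrier H"
    and L: "subgroup L G" "finite (rcosets L)" and n: "\<forall>x\<in>(derived G ^^ n) L. f x = \<one>\<^bsub>H\<^esub>"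
  shows "virtually_solvable H"
proof -
  interpret f: group_hom G H f by (rule f)
  have K: "subgroup (f ` L) H" by (rule f.subgroup_img_is_subgroup[OF L(1)])
  have LG: "L \<subseteq> carrier G" by (rule subgroup.subset[OF L(1)])
  have coset: "f ` L #>\<^bsub>H\<^esub> f a = f ` (L #> a)" if "a \<in> carrier G" for a
    using that LG unfolding r_coset_def by (auto simp: image_iff subset_iff)
  have "rcosets\<^bsub>H\<^esub> (f ` L) \<subseteq> (\<lambda>C. f ` C) ` (rcosets L)"
    unfolding RCOSETS_def surj[symmetric] using coset by auto
  then have fin: "finite (rcosets\<^bsub>H\<^esub> (f ` L))" using L(2) finite_surj by blast
  have "(derived H ^^ n) (f ` L) = f ` ((derived G ^^ n) L)" by (rule f.exp_of_derived_img[OF LG])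
  also have "\<dots> = {\<one>\<^bsub>H\<^esub>}"
    using n subgroup.one_closed[OF f.G.exp_of_derived_is_subgroup[OF L(1), of n]] by (auto simp: image_iff)
  finally have "(derived (H\<lparr>carrier := f ` L\<rparr>) ^^ n) (f ` L) = {\<one>\<^bsub>H\<^esub>}"
    unfolding f.H.exp_of_derived_consistent[OF K] .
  then have "solvable (H\<lparr>carrier := f ` L\<rparr>)"
    using group.solvable_iff_trivial_derived_seq[OF f.H.subgroup_imp_group[OF K]] by auto
  then show ?thesis using K fin unfolding virtually_solvable_def by blast
qed

theorem corollary5p2:
  fixes F :: "('a, 'b) monoid_scheme" and n :: nat
  assumes "n \<ge> 3" and "free_group_of_rank F n"
  shows "\<not> (\<exists>d (R :: ('a \<Rightarrow> 'a) \<Rightarrow> 'k::field mat).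
              aut_representation F d R \<and> inj_on R (carrier (AutoGroup F)))
       \<and> (\<forall>d (R :: ('a \<Rightarrow> 'a) \<Rightarrow> 'k mat) A.
              aut_representation F d R \<longrightarrow> proper_free_factor A F \<longrightarrow>
              virtually_solvable ((GL d :: 'k mat monoid)\<lparr>carrier := R ` (inner_aut F ` A)\<rparr>))"
proof (intro conjI allI impI notI)
  obtain X where F: "group F" and X: "finite X" "card X = n" "free_basis F X"
    using assms(2) by (auto simp: free_group_of_rank_def)
  interpret F: group F by (rule F)
  interpret Aut: group "AutoGroup F" by (rule F.AutoGroup)
  interpret \<iota>: group_hom F "AutoGroup F" "inner_aut F"
    using F.inner_aut_hom by (simp add: group_hom_def group_hom_axioms_def F Aut.is_group)
  {
    assume "\<exists>d (R :: ('a \<Rightarrow> 'a) \<Rightarrow> 'k mat). aut_representation F d R \<and> inj_on R (carrier (AutoGroup F))"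
    then obtain d and R :: "('a \<Rightarrow> 'a) \<Rightarrow> 'k mat" where R: "aut_representation F d R"
      and inj: "inj_on R (carrier (AutoGroup F))" by blast
    interpret R: group_hom "AutoGroup F" "GL d" R
      using R group_GL Aut.is_group by (simp add: aut_representation_def group_hom_def group_hom_axioms_def)
    \<comment> \<open>This is where rank at least 3 enters: \<open>z\<close> is moved by the
      transvections, and two basis elements remain to generate a group that is not virtually
      solvable.\<close>
    obtain S where S: "S \<subseteq> X" "card S = 3" using obtain_subset_with_card_n[of 3 X] assms(1) X by blast
    then obtain x y z where xyz: "x \<in> X" "y \<in> X" "z \<in> X" "x \<noteq> y" "x \<noteq> z" "y \<noteq> z"
      by (auto simp: card_3_iff)
    have XF: "X \<subseteq> carrier F" using X(3) by (simp add: free_basis_def)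
    have xyF: "{x, y} \<subseteq> carrier F" using xyz XF by auto
    let ?A = "generate F {x, y}"
    have A: "subgroup ?A F" by (rule F.generate_is_subgroup[OF xyF])
    have xyA: "x \<in> ?A" "y \<in> ?A" by (auto intro: generate.incl)
    let ?G = "F\<lparr>carrier := ?A\<rparr>"
    interpret A: group ?G by (rule F.subgroup_imp_group[OF A])
    obtain \<alpha> where "transvections F ?A z \<alpha>"
      using free_basis_transvections[OF F X(3) xyz(3), of "{x, y}"] xyz by auto
    then obtain L k where L: "subgroup L ?G" "finite (rcosets\<^bsub>?G\<^esub> L)"
      and k: "\<forall>u\<in>(derived ?G ^^ k) L. R (inner_aut F u) = 1\<^sub>m d"
      using aut_representation_transvections[OF F A _ R] by blast
    let ?D = "(derived ?G ^^ k) L"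
    have D: "subgroup ?D ?G" by (rule A.exp_of_derived_is_subgroup[OF L(1)])
    have DF: "u \<in> carrier F" if "u \<in> ?D" for u
      using subgroup.mem_carrier[OF D that] subgroup.mem_carrier[OF A] by simp
    \<comment> \<open>If \<open>R\<close> is injective, \<open>u\<close> has trivial inner
      automorphism and is central in \<open>F\<close>. Hence \<open>?D\<close> is abelian, and one
      more derived step is trivial.\<close>
    have central: "u \<otimes>\<^bsub>F\<^esub> v = v \<otimes>\<^bsub>F\<^esub> u" if u: "u \<in> ?D" and v: "v \<in> carrier F" for u v
    proof -
      have eq: "R (inner_aut F u) = R (inner_aut F \<one>\<^bsub>F\<^esub>)"
        using k u R.hom_one \<iota>.hom_one by (simp add: GL_simps)
      have eq': "inner_aut F u = inner_aut F \<one>\<^bsub>F\<^esub>"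
        by (rule inj_onD[OF inj eq \<iota>.hom_closed[OF DF[OF u]] \<iota>.hom_closed[OF F.one_closed]])
      have "u \<otimes>\<^bsub>F\<^esub> v \<otimes>\<^bsub>F\<^esub> inv\<^bsub>F\<^esub> u = v"
        using arg_cong[OF eq', of "\<lambda>f. f v"] v by (simp add: inner_aut_def)
      then have "v \<otimes>\<^bsub>F\<^esub> u = u \<otimes>\<^bsub>F\<^esub> v \<otimes>\<^bsub>F\<^esub> inv\<^bsub>F\<^esub> u \<otimes>\<^bsub>F\<^esub> u" by simp
      also have "\<dots> = u \<otimes>\<^bsub>F\<^esub> v" using DF[OF u] v by (simp add: F.m_assoc)
      finally show ?thesis by simp
    qed
    have "derived_set ?G ?D \<subseteq> {\<one>\<^bsub>?G\<^esub>}"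
    proof clarify
      fix u v assume uv: "u \<in> ?D" "v \<in> ?D"
      note uvG = subgroup.mem_carrier[OF D uv(1)] subgroup.mem_carrier[OF D uv(2)]
      have "u \<otimes>\<^bsub>?G\<^esub> v \<otimes>\<^bsub>?G\<^esub> inv\<^bsub>?G\<^esub> u \<otimes>\<^bsub>?G\<^esub> inv\<^bsub>?G\<^esub> v = (v \<otimes>\<^bsub>?G\<^esub> u) \<otimes>\<^bsub>?G\<^esub> inv\<^bsub>?G\<^esub> u \<otimes>\<^bsub>?G\<^esub> inv\<^bsub>?G\<^esub> v"
        using central[OF uv(1) DF[OF uv(2)]] by simp
      also have "\<dots> = \<one>\<^bsub>?G\<^esub>" using uvG by (simp only: A.m_assoc A.m_closed A.inv_closed A.r_inv A.r_one)
      finally show "u \<otimes>\<^bsub>?G\<^esub> v \<otimes>\<^bsub>?G\<^esub> inv\<^bsub>?G\<^esub> u \<otimes>\<^bsub>?G\<^esub> inv\<^bsub>?G\<^esub> v = \<one>\<^bsub>?G\<^esub>" .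
    qed
    then have triv: "(derived ?G ^^ Suc k) L \<subseteq> {\<one>\<^bsub>?G\<^esub>}"
      unfolding derived_def[of ?G ?D] funpow.simps o_apply
      by (rule A.generate_subgroup_incl[OF _ A.triv_subgroup])
    have trivE: "(derived ?G ^^ Suc k) L = {\<one>\<^bsub>?G\<^esub>}"
      by (rule equalityI[OF triv])
        (use subgroup.one_closed[OF A.exp_of_derived_is_subgroup[OF L(1), of "Suc k"]] in blast)
    \<comment> \<open>On the subgroup generated by \<open>x\<close> and \<open>y\<close> only their
      two values matter: an upper and a lower unipotent, with entry 3 to meet the congruence
      condition.\<close>
    obtain h where h: "h \<in> hom F Gamma3" and hx: "\<And>w. w \<in> X \<Longrightarrow> h w = (if w = x then (1, 3, 0, 1) else (1, 0, 3, 1))"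
      by (rule free_basis_hom[OF F group_Gamma3 X(3), where \<phi> = "\<lambda>w. if w = x then (1, 3, 0, 1) else (1, 0, 3, 1)"])
        (auto simp: Gamma3_carrier)
    interpret h: group_hom ?G Gamma3 h
      using h subgroup.mem_carrier[OF A] group_Gamma3 A.is_group
      by (auto simp: group_hom_def group_hom_axioms_def hom_def)
    have LG: "L \<subseteq> carrier ?G" by (rule subgroup.subset[OF L(1)])
    have "(derived Gamma3 ^^ Suc k) (h ` L) = h ` ((derived ?G ^^ Suc k) L)" by (rule h.exp_of_derived_img[OF LG])
    also have "\<dots> = {\<one>\<^bsub>Gamma3\<^esub>}"
      unfolding trivE using h.hom_one by simp
    finally have 1: "(derived Gamma3 ^^ Suc k) (h ` L) = {\<one>\<^bsub>Gamma3\<^esub>}" .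
    \<comment> \<open>Finite index puts positive powers of \<open>x\<close> and \<open>y\<close>
      into \<open>L\<close>, so its image still contains nontrivial unipotents of both
      kinds.\<close>
    obtain p q :: nat where pq: "p > 0" "x [^]\<^bsub>?G\<^esub> p \<in> L" "q > 0" "y [^]\<^bsub>?G\<^esub> q \<in> L"
      using A.finite_index_pow[OF L, of x] A.finite_index_pow[OF L, of y] xyA by auto
    have "h (x [^]\<^bsub>?G\<^esub> p) = (1, int p * 3, 0, 1)" "h (y [^]\<^bsub>?G\<^esub> q) = (1, 0, int q * 3, 1)"
      using h.hom_nat_pow[of x p] h.hom_nat_pow[of y q] xyA xyz hx Gamma3_pow by auto
    then have "(1, int p * 3, 0, 1) \<in> h ` L" "(1, 0, int q * 3, 1) \<in> h ` L"
      using pq by (metis imageI)+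
    then show False
      using Gamma3_not_solvable[OF h.subgroup_img_is_subgroup[OF L(1)], of "int p * 3" "int q * 3" "Suc k"] pq 1 by simp
  }
  {
    fix d and R :: "('a \<Rightarrow> 'a) \<Rightarrow> 'k mat" and A
    assume R: "aut_representation F d R" and "proper_free_factor A F"
    then obtain B where AB: "internal_free_product F A B" and ne: "A \<noteq> carrier F"
      by (auto simp: proper_free_factor_def free_factor_def)
    have A: "subgroup A F" using AB by (simp add: internal_free_product_def)
    let ?G = "F\<lparr>carrier := A\<rparr>"
    let ?H = "(GL d :: 'k mat monoid)\<lparr>carrier := R ` (inner_aut F ` A)\<rparr>"
    interpret R: group_hom "AutoGroup F" "GL d" R
      using R group_GL Aut.is_group by (simp add: aut_representation_def group_hom_def group_hom_axioms_def)
    obtain z \<alpha> where "transvections F A z \<alpha>" using free_factor_transvections[OF F X(3) AB ne] by blast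
    then obtain L k where L: "subgroup L ?G" "finite (rcosets\<^bsub>?G\<^esub> L)"
      and k: "\<forall>u\<in>(derived ?G ^^ k) L. R (inner_aut F u) = 1\<^sub>m d"
      using aut_representation_transvections[OF F A _ R] by blast
    have "subgroup (R ` (inner_aut F ` A)) (GL d)"
      by (intro R.subgroup_img_is_subgroup \<iota>.subgroup_img_is_subgroup A)
    then have H: "group ?H" by (rule group.subgroup_imp_group[OF group_GL])
    have hom: "(\<lambda>a. R (inner_aut F a)) \<in> hom ?G ?H"
      using subgroup.mem_carrier[OF A] by (intro homI) (auto simp: \<iota>.hom_mult R.hom_mult)
    show "virtually_solvable ?H"
    proof (rule virtually_solvable_image[OF _ _ L])
      show "group_hom ?G ?H (\<lambda>a. R (inner_aut F a))"
        using hom H F.subgroup_imp_group[OF A] by (simp add: group_hom_def group_hom_axioms_def)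
      show "(\<lambda>a. R (inner_aut F a)) ` carrier ?G = carrier ?H" by auto
      show "\<forall>x\<in>(derived ?G ^^ k) L. R (inner_aut F x) = \<one>\<^bsub>?H\<^esub>" using k by (simp add: GL_simps)
    qed
  }
qed

end
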